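(* Let $M$ be a compact connected manifold and let $\phi_t$, with $t\in\mathbb R$ or $t\in\mathbb Z$, be an $\mathbb R$-action (a smooth flow) or a $\mathbb Z$-action (generated by a smooth diffeomorphism) on $M$. Assume that $\phi_t$ leaves invariant a foliation $\mathcal F$ of positive leaf dimension, with smooth leaves and continuous tangent bundle $T\mathcal F$, and that the action $\phi_t$ expands the norm of the vectors tangent to $\mathcal F$ uniformly. Then there are infinitely many different $\phi_t$-minimal sets.
   Context: Uniform expansion: for some Riemannian metric on $M$ there are constants $C>0$ and $\lambda>1$ such that $\|D\phi_t v\|\ge C\lambda^t\|v\|$ for all $x\in M$, all $v\in T_x\mathcal F$ and all $t\ge 0$. A $\phi_t$-minimal set is a nonempty closed $\phi_t$-invariant subset of $M$ containing no proper nonempty closed $\phi_t$-invariant subset. *)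

theory Defs
  imports "HOL-Analysis.Analysis"
begin

section \<open>Smooth maps between Euclidean spaces\<close>

text \<open>Only meant for open \<open>S\<close> and a finite-dimensional domain, where having all directional
  derivatives of class \<open>C\<^sup>k\<close> is the same as having an operator-valued derivative of class
  \<open>C\<^sup>k\<close>.\<close>

primrec Ck_on :: "nat \<Rightarrow> ('a::real_normed_vector \<Rightarrow> 'b::real_normed_vector) \<Rightarrow> 'a set \<Rightarrow> bool" where
  "Ck_on 0 f S \<longleftrightarrow> continuous_on S f"
| "Ck_on (Suc k) f S \<longleftrightarrow>
     (\<forall>x\<in>S. f differentiable (at x)) \<and>
     (\<forall>v. Ck_on k (\<lambda>x. frechet_derivative f (at x) v) S)"

definition smooth_on :: "'a set \<Rightarrow> ('a::real_normed_vector \<Rightarrow> 'b::real_normed_vector) \<Rightarrow> bool" where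
  "smooth_on S f \<longleftrightarrow> (\<forall>k. Ck_on k f S)"


section \<open>Smooth manifolds\<close>

text \<open>A chart is a pair of its domain and its coordinate map; the values of the map outside
  the domain are irrelevant. Manifolds are without boundary and modelled on the Euclidean
  space \<open>'e\<close>, so their dimension is \<open>DIM('e)\<close>.\<close>

type_synonym ('a, 'e) chart = "'a set \<times> ('a \<Rightarrow> 'e)"

definition is_chart :: "'a topology \<Rightarrow> ('a, 'e::euclidean_space) chart \<Rightarrow> bool" where
  "is_chart X = (\<lambda>(U, c). openin X U \<and> open (c ` U) \<and>
     homeomorphic_map (subtopology X U) (top_of_set (c ` U)) c)"

definition smooth_compatible ::
    "('a, 'e::euclidean_space) chart \<Rightarrow> ('a, 'e) chart \<Rightarrow> bool" where
  "smooth_compatible = (\<lambda>(U, c) (V, d).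
     smooth_on (c ` (U \<inter> V)) (d \<circ> inv_into U c) \<and>
     smooth_on (d ` (U \<inter> V)) (c \<circ> inv_into V d))"

text \<open>The atlas \<open>A\<close> is required to be maximal, i.e. to be a smooth structure.\<close>

definition smooth_manifold :: "'a topology \<Rightarrow> ('a, 'e::euclidean_space) chart set \<Rightarrow> bool" where
  "smooth_manifold X A \<longleftrightarrow>
     Hausdorff_space X \<and> second_countable X \<and>
     (\<forall>a\<in>A. is_chart X a) \<and>
     (\<Union>(U, c)\<in>A. U) = topspace X \<and>
     (\<forall>a\<in>A. \<forall>b\<in>A. smooth_compatible a b) \<and>
     (\<forall>a. is_chart X a \<and> (\<forall>b\<in>A. smooth_compatible a b) \<longrightarrow> a \<in> A)"

definition smooth_self_map ::
    "'a topology \<Rightarrow> ('a, 'e::euclidean_space) chart set \<Rightarrow> ('a \<Rightarrow> 'a) \<Rightarrow> bool" where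
  "smooth_self_map X A f \<longleftrightarrow> continuous_map X X f \<and>
     (\<forall>(U, c)\<in>A. \<forall>(V, d)\<in>A. smooth_on (c ` {x\<in>U. f x \<in> V}) (d \<circ> f \<circ> inv_into U c))"

definition diffeomorphism ::
    "'a topology \<Rightarrow> ('a, 'e::euclidean_space) chart set \<Rightarrow> ('a \<Rightarrow> 'a) \<Rightarrow> bool" where
  "diffeomorphism X A f \<longleftrightarrow> bij_betw f (topspace X) (topspace X) \<and>
     smooth_self_map X A f \<and> smooth_self_map X A (inv_into (topspace X) f)"


section \<open>Tangent vectors and Riemannian metrics\<close>

text \<open>A tangent vector at \<open>x\<close> is given by its coordinates in all charts of \<open>A\<close> around \<open>x\<close>,
  related by the derivatives of the coordinate changes; at all other pairs it is \<open>0\<close> by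
  convention.\<close>

type_synonym ('a, 'e) tvec = "('a, 'e) chart \<Rightarrow> 'e"

definition tangent_space ::
    "('a, 'e::euclidean_space) chart set \<Rightarrow> 'a \<Rightarrow> ('a, 'e) tvec set" where
  "tangent_space A x = {v.
     (\<forall>(U, c)\<in>A. \<forall>(V, d)\<in>A. x \<in> U \<inter> V \<longrightarrow>
        v (V, d) = frechet_derivative (d \<circ> inv_into U c) (at (c x)) (v (U, c))) \<and>
     (\<forall>U c. \<not> ((U, c) \<in> A \<and> x \<in> U) \<longrightarrow> v (U, c) = 0)}"

text \<open>The tangent vector at \<open>x\<close> with coordinates \<open>u\<close> in a given chart around \<open>x\<close>.\<close>

definition coord_vector ::
    "('a, 'e::euclidean_space) chart set \<Rightarrow> ('a, 'e) chart \<Rightarrow> 'a \<Rightarrow> 'e \<Rightarrow> ('a, 'e) tvec" where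
  "coord_vector A = (\<lambda>(U, c) x u (V, d).
     if (V, d) \<in> A \<and> x \<in> V then frechet_derivative (d \<circ> inv_into U c) (at (c x)) u else 0)"

text \<open>The chart around \<open>x\<close> used to compute the differential \<open>D f(x) v\<close> is arbitrary.\<close>

definition tangent_map ::
    "('a, 'e::euclidean_space) chart set \<Rightarrow> ('a \<Rightarrow> 'a) \<Rightarrow> 'a \<Rightarrow> ('a, 'e) tvec \<Rightarrow> ('a, 'e) tvec" where
  "tangent_map A f x v = (\<lambda>(V, d).
     if (V, d) \<in> A \<and> f x \<in> V
     then case (SOME a. a \<in> A \<and> x \<in> fst a) of (U, c) \<Rightarrow>
       frechet_derivative (d \<circ> f \<circ> inv_into U c) (at (c x)) (v (U, c))
     else 0)"

definition riemannian_metric ::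
    "('a, 'e::euclidean_space) chart set \<Rightarrow>
     ('a \<Rightarrow> ('a, 'e) tvec \<Rightarrow> ('a, 'e) tvec \<Rightarrow> real) \<Rightarrow> bool" where
  "riemannian_metric A g \<longleftrightarrow> (\<forall>(U, c)\<in>A.
     (\<forall>x\<in>U. bilinear (\<lambda>u w. g x (coord_vector A (U, c) x u) (coord_vector A (U, c) x w))) \<and>
     (\<forall>x\<in>U. \<forall>v\<in>tangent_space A x. \<forall>w\<in>tangent_space A x. g x v w = g x w v) \<and>
     (\<forall>x\<in>U. \<forall>v\<in>tangent_space A x. v \<noteq> (\<lambda>_. 0) \<longrightarrow> g x v v > 0) \<and>
     (\<forall>u w. smooth_on (c ` U) (\<lambda>y. let x = inv_into U c y in
        g x (coord_vector A (U, c) x u) (coord_vector A (U, c) x w))))"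

definition riem_norm ::
    "('a \<Rightarrow> ('a, 'e) tvec \<Rightarrow> ('a, 'e) tvec \<Rightarrow> real) \<Rightarrow> 'a \<Rightarrow> ('a, 'e) tvec \<Rightarrow> real" where
  "riem_norm g x v = sqrt (g x v v)"


section \<open>Foliations\<close>

text \<open>A foliated chart is a topological chart onto a product of a disc in a \<open>p\<close>-dimensional
  subspace \<open>P\<close> and a disc in its orthogonal complement (which may be \<open>0\<close>); its plaques are
  the slices parallel to \<open>P\<close>.\<close>

definition foliated_chart ::
    "'a topology \<Rightarrow> nat \<Rightarrow> ('a, 'e::euclidean_space) chart \<Rightarrow> 'e set \<Rightarrow> bool" where
  "foliated_chart X p = (\<lambda>(W, \<psi>) P.
     is_chart X (W, \<psi>) \<and> subspace P \<and> dim P = p \<and>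
     \<psi> ` W = {a + b | a b. a \<in> P \<and> norm a < 1 \<and> b \<in> orthogonal_comp P \<and> norm b < 1})"

definition plaque :: "('a, 'e::euclidean_space) chart \<Rightarrow> 'e set \<Rightarrow> 'a \<Rightarrow> 'a set" where
  "plaque = (\<lambda>(W, \<psi>) P x. {y\<in>W. \<psi> y - \<psi> x \<in> P})"

text \<open>A topological foliation with \<open>p\<close>-dimensional leaves, given by its set \<open>F\<close> of leaves.
  A leaf \<open>L\<close> may meet a foliated chart domain \<open>W\<close> in many plaques, which are then the path
  components of \<open>L \<inter> W\<close>. Path-connectedness cannot be weakened to connectedness: the union
  of two dense leaves is connected in the topology of the manifold.\<close>

definition foliation ::
    "'e::euclidean_space itself \<Rightarrow> 'a topology \<Rightarrow> nat \<Rightarrow> 'a set set \<Rightarrow> bool" where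
  "foliation _ X p F \<longleftrightarrow>
     partition_on (topspace X) F \<and>
     (\<forall>L\<in>F. path_connectedin X L) \<and>
     (\<forall>x\<in>topspace X. \<exists>W (\<psi>::'a \<Rightarrow> 'e) P. x \<in> W \<and> foliated_chart X p (W, \<psi>) P \<and>
        (\<Union>L\<in>F. path_components_of (subtopology X (L \<inter> W))) = plaque (W, \<psi>) P ` W)"

text \<open>The leaf through \<open>x\<close> is, near \<open>x\<close> and in its own (plaque) topology, the slice through
  \<open>x\<close> parallel to \<open>P\<close> in a smooth chart of the manifold. The sets
  \<open>path_component_of_set (subtopology X (L \<inter> U)) x\<close> with \<open>U\<close> open and \<open>x \<in> L \<inter> U\<close> form a
  basis of the plaque topology of the leaf \<open>L\<close>.\<close>

definition leaf_slice ::
    "'a topology \<Rightarrow> ('a, 'e::euclidean_space) chart set \<Rightarrow> nat \<Rightarrow> 'a set set \<Rightarrow> 'a \<Rightarrow>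
     ('a, 'e) chart \<Rightarrow> 'e set \<Rightarrow> bool" where
  "leaf_slice X A p F x = (\<lambda>(U, c) P.
     (U, c) \<in> A \<and> x \<in> U \<and> subspace P \<and> dim P = p \<and>
     (\<exists>L\<in>F. x \<in> L \<and> path_component_of_set (subtopology X (L \<inter> U)) x = plaque (U, c) P x))"

text \<open>Every leaf, with its plaque topology, is an injectively immersed smooth
  \<open>p\<close>-dimensional submanifold (local slice criterion).\<close>

definition smooth_leaves ::
    "'a topology \<Rightarrow> ('a, 'e::euclidean_space) chart set \<Rightarrow> nat \<Rightarrow> 'a set set \<Rightarrow> bool" where
  "smooth_leaves X A p F \<longleftrightarrow> (\<forall>x\<in>topspace X. \<exists>a P. leaf_slice X A p F x a P)"

text \<open>The tangent space at \<open>x\<close> of the leaf through \<open>x\<close>; it does not depend on the slice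
  chart.\<close>

definition leaf_tangent_space ::
    "'a topology \<Rightarrow> ('a, 'e::euclidean_space) chart set \<Rightarrow> nat \<Rightarrow> 'a set set \<Rightarrow> 'a \<Rightarrow>
     ('a, 'e) tvec set" where
  "leaf_tangent_space X A p F x =
     {v \<in> tangent_space A x. \<exists>a P. leaf_slice X A p F x a P \<and> v a \<in> P}"

text \<open>The tangent bundle of \<open>F\<close> is locally spanned by \<open>p\<close> continuous vector fields.\<close>

definition continuous_tangent_bundle ::
    "'a topology \<Rightarrow> ('a, 'e::euclidean_space) chart set \<Rightarrow> nat \<Rightarrow> 'a set set \<Rightarrow> bool" where
  "continuous_tangent_bundle X A p F \<longleftrightarrow>
     (\<forall>x\<in>topspace X. \<exists>(U, c)\<in>A. x \<in> U \<and> (\<exists>e :: nat \<Rightarrow> 'a \<Rightarrow> 'e.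
        (\<forall>i<p. continuous_map (subtopology X U) euclidean (e i)) \<and>
        (\<forall>y\<in>U. (\<lambda>v. v (U, c)) ` leaf_tangent_space X A p F y = span ((\<lambda>i. e i y) ` {..<p}))))"


section \<open>Smooth actions of the reals and of the integers\<close>

text \<open>Both kinds of actions are functions \<open>\<phi> :: real \<Rightarrow> 'a \<Rightarrow> 'a\<close>, restricted to times in
  \<open>T = UNIV\<close> or \<open>T = \<int>\<close>; values at other times are irrelevant.\<close>

definition group_action_on :: "'a topology \<Rightarrow> real set \<Rightarrow> (real \<Rightarrow> 'a \<Rightarrow> 'a) \<Rightarrow> bool" where
  "group_action_on X T \<phi> \<longleftrightarrow>
     (\<forall>t\<in>T. \<forall>x\<in>topspace X. \<phi> t x \<in> topspace X) \<and>
     (\<forall>x\<in>topspace X. \<phi> 0 x = x) \<and>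
     (\<forall>s\<in>T. \<forall>t\<in>T. \<forall>x\<in>topspace X. \<phi> (s + t) x = \<phi> s (\<phi> t x))"

definition smooth_flow ::
    "'a topology \<Rightarrow> ('a, 'e::euclidean_space) chart set \<Rightarrow> (real \<Rightarrow> 'a \<Rightarrow> 'a) \<Rightarrow> bool" where
  "smooth_flow X A \<phi> \<longleftrightarrow>
     group_action_on X UNIV \<phi> \<and>
     continuous_map (prod_topology euclidean X) X (\<lambda>(t, x). \<phi> t x) \<and>
     (\<forall>(U, c)\<in>A. \<forall>(V, d)\<in>A.
        smooth_on {(t, y). y \<in> c ` U \<and> \<phi> t (inv_into U c y) \<in> V}
          (\<lambda>(t, y). d (\<phi> t (inv_into U c y))))"

definition smooth_int_action ::
    "'a topology \<Rightarrow> ('a, 'e::euclidean_space) chart set \<Rightarrow> (real \<Rightarrow> 'a \<Rightarrow> 'a) \<Rightarrow> bool" where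
  "smooth_int_action X A \<phi> \<longleftrightarrow> group_action_on X \<int> \<phi> \<and> diffeomorphism X A (\<phi> 1)"

definition smooth_action ::
    "'a topology \<Rightarrow> ('a, 'e::euclidean_space) chart set \<Rightarrow> real set \<Rightarrow> (real \<Rightarrow> 'a \<Rightarrow> 'a) \<Rightarrow> bool" where
  "smooth_action X A T \<phi> \<longleftrightarrow>
     T = UNIV \<and> smooth_flow X A \<phi> \<or> T = \<int> \<and> smooth_int_action X A \<phi>"

definition leaves_foliation_invariant ::
    "real set \<Rightarrow> (real \<Rightarrow> 'a \<Rightarrow> 'a) \<Rightarrow> 'a set set \<Rightarrow> bool" where
  "leaves_foliation_invariant T \<phi> F \<longleftrightarrow> (\<forall>t\<in>T. \<forall>L\<in>F. \<phi> t ` L \<in> F)"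

definition uniformly_expands ::
    "'a topology \<Rightarrow> ('a, 'e::euclidean_space) chart set \<Rightarrow> nat \<Rightarrow> 'a set set \<Rightarrow>
     real set \<Rightarrow> (real \<Rightarrow> 'a \<Rightarrow> 'a) \<Rightarrow> bool" where
  "uniformly_expands X A p F T \<phi> \<longleftrightarrow>
     (\<exists>g C l. riemannian_metric A g \<and> C > 0 \<and> l > 1 \<and>
        (\<forall>x\<in>topspace X. \<forall>v\<in>leaf_tangent_space X A p F x. \<forall>t\<in>T. t \<ge> 0 \<longrightarrow>
           riem_norm g (\<phi> t x) (tangent_map A (\<phi> t) x v) \<ge> C * (l powr t) * riem_norm g x v))"


section \<open>Minimal sets\<close>

definition closed_invariant :: "'a topology \<Rightarrow> real set \<Rightarrow> (real \<Rightarrow> 'a \<Rightarrow> 'a) \<Rightarrow> 'a set \<Rightarrow> bool" where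
  "closed_invariant X T \<phi> S \<longleftrightarrow> closedin X S \<and> (\<forall>t\<in>T. \<phi> t ` S = S)"

definition minimal_set :: "'a topology \<Rightarrow> real set \<Rightarrow> (real \<Rightarrow> 'a \<Rightarrow> 'a) \<Rightarrow> 'a set \<Rightarrow> bool" where
  "minimal_set X T \<phi> S \<longleftrightarrow> S \<noteq> {} \<and> closed_invariant X T \<phi> S \<and>
     \<not> (\<exists>S'. S' \<noteq> {} \<and> S' \<subset> S \<and> closed_invariant X T \<phi> S')"

end

theory Submission
  imports Defs
begin

text \<open>The proof constructs, for every finite set \<open>Q\<close> of points, a minimal set that avoids \<open>Q\<close>. If there
  were only finitely many minimal sets, one would let \<open>Q\<close> contain a point of each and get a
  contradiction.

  An orbit avoiding \<open>Q\<close> is found by a nested ball construction inside the leaves. Distances along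
  leaves, expressed by the relation \<open>reach\<close>, are contracted exponentially by negative times
  (\<open>reach_contract\<close>). Suppose that \<open>N\<close> is an open set, and that from every point one can travel
  within its leaf, over a distance at most \<open>R\<close>, to a point whose leafwise ball of radius \<open>r\<close> is
  disjoint from \<open>N\<close>. If the contraction in time \<open>n\<close> is at least by the factor \<open>r / (R + r)\<close>, then
  balls chosen successively at the times \<open>0, n, 2 n, \<dots>\<close> are nested after being pulled back to time
  zero, and a point in their intersection has an orbit that avoids \<open>N\<close> at all these times
  (\<open>avoiding_orbit_discrete\<close>). Taking for \<open>N\<close> a neighbourhood of the backward orbit segments of \<open>Q\<close>
  of duration \<open>n\<close>, one gets a forward orbit whose closure misses \<open>Q\<close>, and a minimal set in its limit
  set.

  The main point is therefore to find \<open>n\<close>, \<open>R\<close>, \<open>r\<close> and \<open>N\<close> (\<open>avoiding_neighbourhood\<close>). For a flow the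
  orbit segments of \<open>Q\<close> are curves, whose number of pieces grows with \<open>n\<close>, whereas the factor
  \<open>(R + r) / r\<close> must not exceed the expansion in time \<open>n\<close>. This is possible because the velocity
  is transverse to the leaves: a tangent velocity would have to grow exponentially along its orbit,
  which is impossible on a compact manifold (\<open>velocity_tangent_zero\<close>), and a zero of the velocity
  would spread over a piece of a leaf, against the contraction in negative time
  (\<open>velocity_nonzero\<close>). So in suitable coordinates there is a height function that grows steadily
  along the leaves but hardly varies along short orbit segments. Climbing along a leaf one finds a
  chain of points at different heights (\<open>leaf_advance\<close>, \<open>box_chain\<close>); each short piece of an orbit
  comes near at most one of them (\<open>box_separation\<close>), and with more points than pieces one point
  remains. The number of pieces is linear in \<open>n\<close>, so \<open>r\<close> is of the order of \<open>1 / n\<close>, while the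
  expansion is exponential.

  Two devices keep the differential geometry elementary. Since the atlas is maximal, the action maps
  charts to charts, and in the carried charts it is the identity; so chart-straight segments in
  leaves are mapped to such segments, and only their speeds have to be compared. And since the tangent
  bundle of the foliation is merely continuous, its integral curves need not stay in leaves; long
  leaf paths in a given direction are obtained instead by maximising the height over the points that
  can be reached cheaply, where the topological product structure of the foliation supplies
  compactness.\<close>


section \<open>Smooth maps on open subsets of Euclidean space\<close>

lemma smooth_on_differentiable:
  assumes "smooth_on S f" "x \<in> S"
  shows "f differentiable (at x)"
proof -
  have "Ck_on (Suc 0) f S" using assms(1) by (simp only: smooth_on_def)
  then show ?thesis using assms(2) by simp
qed

lemma smooth_on_continuous:
  "smooth_on S f \<Longrightarrow> continuous_on S f"
  unfolding smooth_on_def by (metis Ck_on.simps(1))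

lemma Ck_on_cong:
  assumes "open S" "\<And>x. x \<in> S \<Longrightarrow> f x = g x" "Ck_on k f S"
  shows "Ck_on k g S"
  using assms(2,3)
proof (induction k arbitrary: f g)
  case 0
  then show ?case by (simp cong: continuous_on_cong)
next
  case (Suc k)
  have diff: "\<And>x. x \<in> S \<Longrightarrow> f differentiable (at x)"
    and ck: "\<And>v. Ck_on k (\<lambda>x. frechet_derivative f (at x) v) S"
    using Suc.prems by auto
  have eq: "frechet_derivative f (at x) = frechet_derivative g (at x)" if "x \<in> S" for x
    using frechet_derivative_transform_within_open[OF diff[OF that] assms(1) that] Suc.prems(1)
    by blast
  have "g differentiable (at x)" if "x \<in> S" for x
    using diff[OF that] has_derivative_transform_within_open[of f _ x UNIV S g] assms(1) that
      Suc.prems(1)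
    unfolding differentiable_def by blast
  moreover have "Ck_on k (\<lambda>x. frechet_derivative g (at x) v) S" for v
    by (rule Suc.IH[OF _ ck[of v]]) (simp add: eq)
  ultimately show ?case by simp
qed

lemma smooth_on_cong:
  assumes "open S" "\<And>x. x \<in> S \<Longrightarrow> f x = g x" "smooth_on S f"
  shows "smooth_on S g"
  using assms Ck_on_cong unfolding smooth_on_def by blast

text \<open>Freezing the time variable turns the joint smoothness of a flow into smoothness of its
  time-\<open>t\<close> maps.\<close>

lemma Ck_on_slice:
  assumes "open S" "Ck_on k f S"
  shows "Ck_on k (\<lambda>y. f (t, y)) {y. (t, y) \<in> S}"
  using assms(2)
proof (induction k arbitrary: f)
  case 0
  have "continuous_on ((\<lambda>y. (t, y)) ` {y. (t, y) \<in> S}) f"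
    by (rule continuous_on_subset[OF 0[simplified]]) auto
  then have "continuous_on {y. (t, y) \<in> S} (f \<circ> (\<lambda>y. (t, y)))"
    by (intro continuous_on_compose continuous_intros)
  then show ?case by (simp add: o_def)
next
  case (Suc k)
  have op: "open {y. (t, y) \<in> S}"
    using continuous_open_vimage[OF assms(1), of "\<lambda>y. (t, y)"]
    by (simp add: vimage_def continuous_on_Pair)
  have der: "((\<lambda>y. f (t, y)) has_derivative (\<lambda>v. frechet_derivative f (at (t, y)) (0, v))) (at y)"
    if "(t, y) \<in> S" for y
  proof -
    have "(f has_derivative frechet_derivative f (at (t, y))) (at (t, y))"
      using Suc.prems that using frechet_derivative_works by auto
    moreover have "((\<lambda>y. (t, y)) has_derivative (\<lambda>v. (0, v))) (at y)"
      by (auto intro!: derivative_eq_intros)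
    ultimately show ?thesis
      using has_derivative_compose[of "\<lambda>y. (t, y)" "\<lambda>v. (0, v)" y UNIV f] by simp
  qed
  have "Ck_on k (\<lambda>y. frechet_derivative (\<lambda>y. f (t, y)) (at y) v) {y. (t, y) \<in> S}" for v
  proof (rule Ck_on_cong[OF op])
    show "Ck_on k (\<lambda>y. (\<lambda>z. frechet_derivative f (at z) (0, v)) (t, y)) {y. (t, y) \<in> S}"
      by (rule Suc.IH) (use Suc.prems in simp)
    show "frechet_derivative f (at (t, y)) (0, v) = frechet_derivative (\<lambda>y. f (t, y)) (at y) v"
      if "y \<in> {y. (t, y) \<in> S}" for y
      using frechet_derivative_at[OF der[of y]] that by (metis mem_Collect_eq)
  qed
  then show ?case using der unfolding Ck_on.simps differentiable_def by blast
qed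

lemma smooth_on_slice:
  "open S \<Longrightarrow> smooth_on S f \<Longrightarrow> smooth_on {y. (t, y) \<in> S} (\<lambda>y. f (t, y))"
  unfolding smooth_on_def using Ck_on_slice by blast


section \<open>Charts\<close>

lemma is_chart_openin: "is_chart X (U, c) \<Longrightarrow> openin X U"
  and is_chart_open_image: "is_chart X (U, c) \<Longrightarrow> open (c ` U)"
  and is_chart_homeo: "is_chart X (U, c) \<Longrightarrow> homeomorphic_map (subtopology X U) (top_of_set (c ` U)) c"
  by (auto simp: is_chart_def)

lemma is_chart_subset: "is_chart X (U, c) \<Longrightarrow> U \<subseteq> topspace X"
  using is_chart_openin openin_subset by blast

lemma is_chart_inj: "is_chart X (U, c) \<Longrightarrow> inj_on c U"
  using homeomorphic_imp_injective_map[OF is_chart_homeo, of X U c] is_chart_subset[of X U c]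
  by (simp add: Int_absorb1)

lemma is_chart_cont:
  assumes "is_chart X (U, c)"
  shows "continuous_map (subtopology X U) euclidean c"
  using homeomorphic_imp_continuous_map[OF is_chart_homeo[OF assms]]
  by (simp add: continuous_map_in_subtopology)

lemma is_chart_inv_cont:
  assumes "is_chart X (U, c)"
  shows "continuous_map (top_of_set (c ` U)) X (inv_into U c)"
proof -
  obtain g where g: "homeomorphic_maps (subtopology X U) (top_of_set (c ` U)) c g"
    using is_chart_homeo[OF assms] homeomorphic_map_maps by blast
  have "g y = inv_into U c y" if "y \<in> c ` U" for y
  proof -
    obtain x where x: "x \<in> U" "y = c x" using \<open>y \<in> c ` U\<close> by blast
    have "x \<in> topspace (subtopology X U)"
      using x is_chart_subset[OF assms] by auto
    then have "g (c x) = x" using g by (simp add: homeomorphic_maps_def)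
    then show ?thesis using x is_chart_inj[OF assms] by simp
  qed
  moreover have "continuous_map (top_of_set (c ` U)) (subtopology X U) g"
    using g by (simp add: homeomorphic_maps_def)
  ultimately have "continuous_map (top_of_set (c ` U)) (subtopology X U) (inv_into U c)"
    by (elim continuous_map_eq) auto
  then show ?thesis by (simp add: continuous_map_in_subtopology)
qed

lemma is_chart_openin_preimage:
  assumes "is_chart X (U, c)" "open B"
  shows "openin X {x\<in>U. c x \<in> B}"
proof -
  have "openin (subtopology X U) {x \<in> topspace (subtopology X U). c x \<in> B}"
    using is_chart_cont[OF assms(1)] assms(2) by (simp add: continuous_map)
  moreover have "{x \<in> topspace (subtopology X U). c x \<in> B} = {x\<in>U. c x \<in> B}"
    using is_chart_subset[OF assms(1)] by auto
  ultimately show ?thesis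
    using is_chart_openin[OF assms(1)] openin_trans_full by metis
qed

lemma is_chart_open_image_subset:
  assumes "is_chart X (U, c)" "openin X V" "V \<subseteq> U"
  shows "open (c ` V)"
proof -
  have "openin (subtopology X U) V"
    using assms by (simp add: is_chart_openin openin_open_subtopology)
  then have "openin (top_of_set (c ` U)) (c ` V)"
    using homeomorphic_imp_open_map[OF is_chart_homeo[OF assms(1)]] open_map_def by blast
  then show ?thesis
    using is_chart_open_image[OF assms(1)] openin_open_trans by blast
qed

lemma is_chart_compactin:
  assumes "is_chart X (U, c)" "compact K" "K \<subseteq> c ` U"
  shows "compactin X {x\<in>U. c x \<in> K}"
proof -
  have "compactin (top_of_set (c ` U)) K"
    using assms by (simp add: compactin_subtopology)
  then have "compactin X (inv_into U c ` K)"
    using is_chart_inv_cont[OF assms(1)] image_compactin by blast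
  moreover have "inv_into U c ` K = {x\<in>U. c x \<in> K}"
    using assms(3) is_chart_inj[OF assms(1)]
    by (auto simp: f_inv_into_f intro!: inv_into_into)
      (metis imageI inv_into_f_f)
  ultimately show ?thesis by simp
qed

lemma is_chart_cong:
  assumes "is_chart X (U, c)" "\<And>x. x \<in> U \<Longrightarrow> c x = c' x"
  shows "is_chart X (U, c')"
proof -
  have "c' ` U = c ` U" using assms(2) by force
  moreover have "homeomorphic_map (subtopology X U) (top_of_set (c ` U)) c'"
    using homeomorphic_map_eq[OF is_chart_homeo[OF assms(1)], of c'] assms(2) by simp
  ultimately show ?thesis
    using is_chart_openin[OF assms(1)] is_chart_open_image[OF assms(1)] by (simp add: is_chart_def)
qed

lemma inv_into_cong:
  assumes "\<And>x. x \<in> U \<Longrightarrow> c x = c' x"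
  shows "inv_into U c = inv_into U c'"
  unfolding inv_into_def using assms by (intro ext arg_cong[where f=Eps]) auto

lemma is_chart_push:
  assumes "is_chart X (U, c)" "homeomorphic_maps X X f f'"
  shows "is_chart X (f ` U, c \<circ> f')"
proof -
  have f: "homeomorphic_map X X f" "homeomorphic_map X X f'"
    using assms(2) homeomorphic_maps_map by blast+
  have UX: "U \<subseteq> topspace X" by (rule is_chart_subset[OF assms(1)])
  have f'f: "f' (f x) = x" if "x \<in> U" for x
    using assms(2) that UX by (auto simp: homeomorphic_maps_def)
  have im: "f' ` f ` U = U" using f'f by force
  have op: "openin X (f ` U)"
    using f(1) is_chart_openin[OF assms(1)] homeomorphic_map_openness_eq UX by blast
  have im2: "(c \<circ> f') ` f ` U = c ` U" unfolding image_comp[symmetric] im by simp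
  have "homeomorphic_map (subtopology X (f ` U)) (subtopology X U) f'"
  proof -
    have "f ` U \<subseteq> topspace X" using op openin_subset by blast
    then show ?thesis
      using homeomorphic_map_subtopologies[OF f(2), of "f ` U" U] UX im
      by (simp add: Int_absorb1)
  qed
  then have "homeomorphic_map (subtopology X (f ` U)) (top_of_set (c ` U)) (c \<circ> f')"
    using is_chart_homeo[OF assms(1)] homeomorphic_map_compose by blast
  then show ?thesis
    using op is_chart_open_image[OF assms(1)] im2 by (simp add: is_chart_def)
qed

lemma inv_into_push:
  assumes "inj_on c U" "\<And>x. x \<in> U \<Longrightarrow> f' (f x) = x" "y \<in> c ` U"
  shows "inv_into (f ` U) (c \<circ> f') y = f (inv_into U c y)"
proof -
  obtain x where x: "x \<in> U" "y = c x" using assms(3) by auto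
  have inj: "inj_on (c \<circ> f') (f ` U)"
    using assms(1,2) by (auto simp: inj_on_def)
  have "inv_into (f ` U) (c \<circ> f') ((c \<circ> f') (f x)) = f x"
    using inj x by (intro inv_into_f_f) auto
  then show ?thesis using x assms by simp
qed


locale smooth_mfd =
  fixes X :: "'a topology" and A :: "('a, 'e::euclidean_space) chart set"
  assumes manifold: "smooth_manifold X A"
begin

lemma Hausdorff: "Hausdorff_space X"
  using manifold by (simp add: smooth_manifold_def)

lemma chart: "a \<in> A \<Longrightarrow> is_chart X a"
  using manifold by (simp add: smooth_manifold_def)

lemma chart_at:
  assumes "x \<in> topspace X"
  obtains U c where "(U, c) \<in> A" "x \<in> U"
proof -
  have "(\<Union>(U, c)\<in>A. U) = topspace X"
    using manifold by (simp add: smooth_manifold_def)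
  then show ?thesis using assms that by blast
qed

lemma compatible: "a \<in> A \<Longrightarrow> b \<in> A \<Longrightarrow> smooth_compatible a b"
  using manifold by (simp add: smooth_manifold_def)

lemma maximal:
  "is_chart X a \<Longrightarrow> (\<And>b. b \<in> A \<Longrightarrow> smooth_compatible a b) \<Longrightarrow> a \<in> A"
  using manifold unfolding smooth_manifold_def by blast

lemma overlap_open:
  assumes "is_chart X (U, c)" "is_chart X (V, d)"
  shows "open (c ` (U \<inter> V))"
  by (rule is_chart_open_image_subset[OF assms(1)])
    (use assms is_chart_openin[of X U c] is_chart_openin[of X V d] in auto)

text \<open>Charts are pairs whose coordinate map takes arbitrary values off its domain. Carrying a chart
  along by time \<open>s\<close> and then by time \<open>t\<close> agrees with carrying it along by time \<open>s + t\<close> on the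
  domain only, so the maximality of the atlas has to absorb such changes.\<close>

lemma chart_cong:
  assumes "(U, c) \<in> A" "\<And>x. x \<in> U \<Longrightarrow> c x = c' x"
  shows "(U, c') \<in> A"
proof (rule maximal)
  show ch': "is_chart X (U, c')" using is_chart_cong[OF chart[OF assms(1)] assms(2)] .
  fix b assume b: "b \<in> A"
  obtain V d where bV: "b = (V, d)" by (cases b)
  have comp: "smooth_compatible (U, c) (V, d)" using compatible assms(1) b bV by blast
  have im: "c ` (U \<inter> V) = c' ` (U \<inter> V)" using assms(2) by force
  have inv: "inv_into U c = inv_into U c'" using assms(2) by (rule inv_into_cong)
  have "smooth_on (d ` (U \<inter> V)) (c' \<circ> inv_into V d)"
  proof (rule smooth_on_cong)
    show "open (d ` (U \<inter> V))"
      using overlap_open[OF chart[OF b[unfolded bV]] ch'] by (simp add: Int_commute)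
    show "smooth_on (d ` (U \<inter> V)) (c \<circ> inv_into V d)"
      using comp by (simp add: smooth_compatible_def)
    fix y assume "y \<in> d ` (U \<inter> V)"
    then obtain z where z: "z \<in> U" "z \<in> V" "y = d z" by auto
    then have "inv_into V d y \<in> U"
      using is_chart_inj[OF chart[OF b[unfolded bV]]] by simp
    then show "(c \<circ> inv_into V d) y = (c' \<circ> inv_into V d) y" using assms(2) by simp
  qed
  then show "smooth_compatible (U, c') b"
    using comp im inv bV by (simp add: smooth_compatible_def)
qed

text \<open>The transition maps between \<open>(f ` U, c \<circ> f')\<close> and a chart \<open>(V, d)\<close> are the coordinate
  expressions of \<open>f\<close> and \<open>f'\<close>. So smoothness of these is compatibility, and the maximality of the
  atlas does the rest.\<close>

lemma push_chart:
  assumes "(U, c) \<in> A" "homeomorphic_maps X X f f'"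
    and f: "\<And>V d. (V, d) \<in> A \<Longrightarrow> smooth_on (c ` {x\<in>U. f x \<in> V}) (d \<circ> f \<circ> inv_into U c)"
    and f': "\<And>V d. (V, d) \<in> A \<Longrightarrow> smooth_on (d ` {x\<in>V. f' x \<in> U}) (c \<circ> f' \<circ> inv_into V d)"
  shows "(f ` U, c \<circ> f') \<in> A"
proof (rule maximal)
  note ch = chart[OF assms(1)]
  show ch': "is_chart X (f ` U, c \<circ> f')" by (rule is_chart_push[OF ch assms(2)])
  fix b assume b: "b \<in> A"
  obtain V d where bV: "b = (V, d)" by (cases b)
  note VX = is_chart_subset[OF chart[OF b[unfolded bV]]]
  note UX = is_chart_subset[OF ch]
  have f'f: "f' (f x) = x" if "x \<in> topspace X" for x
    using assms(2) that by (auto simp: homeomorphic_maps_def)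
  have ff': "f (f' x) = x" if "x \<in> topspace X" for x
    using assms(2) that by (auto simp: homeomorphic_maps_def)
  have s1: "(c \<circ> f') ` (f ` U \<inter> V) = c ` {x\<in>U. f x \<in> V}"
  proof
    show "(c \<circ> f') ` (f ` U \<inter> V) \<subseteq> c ` {x\<in>U. f x \<in> V}"
    proof
      fix y assume "y \<in> (c \<circ> f') ` (f ` U \<inter> V)"
      then obtain x where x: "x \<in> U" "f x \<in> V" "y = c (f' (f x))" by auto
      then have "y = c x" using f'f UX by auto
      then show "y \<in> c ` {x\<in>U. f x \<in> V}" using x by blast
    qed
    show "c ` {x\<in>U. f x \<in> V} \<subseteq> (c \<circ> f') ` (f ` U \<inter> V)"
    proof
      fix y assume "y \<in> c ` {x\<in>U. f x \<in> V}"
      then obtain x where x: "x \<in> U" "f x \<in> V" "y = c x" by auto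
      then have "y = (c \<circ> f') (f x)" using f'f UX by auto
      then show "y \<in> (c \<circ> f') ` (f ` U \<inter> V)" using x by blast
    qed
  qed
  have s2: "{x\<in>V. f' x \<in> U} = f ` U \<inter> V"
  proof
    show "{x\<in>V. f' x \<in> U} \<subseteq> f ` U \<inter> V"
    proof
      fix x assume x: "x \<in> {x\<in>V. f' x \<in> U}"
      then have "x = f (f' x)" using ff' VX by auto
      then show "x \<in> f ` U \<inter> V" using x by blast
    qed
    show "f ` U \<inter> V \<subseteq> {x\<in>V. f' x \<in> U}"
    proof
      fix x assume "x \<in> f ` U \<inter> V"
      then obtain z where "z \<in> U" "x = f z" "x \<in> V" by auto
      then show "x \<in> {x\<in>V. f' x \<in> U}" using f'f UX by auto
    qed
  qed
  have "smooth_on ((c \<circ> f') ` (f ` U \<inter> V)) (d \<circ> inv_into (f ` U) (c \<circ> f'))"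
  proof (rule smooth_on_cong)
    show "open ((c \<circ> f') ` (f ` U \<inter> V))"
      using overlap_open[OF ch' chart[OF b[unfolded bV]]] .
    show "smooth_on ((c \<circ> f') ` (f ` U \<inter> V)) (d \<circ> f \<circ> inv_into U c)"
      using f b bV s1 by simp
    fix y assume "y \<in> (c \<circ> f') ` (f ` U \<inter> V)"
    then have y: "y \<in> c ` U" using s1 by auto
    have "f' (f x) = x" if "x \<in> U" for x using f'f UX that by auto
    with y show "(d \<circ> f \<circ> inv_into U c) y = (d \<circ> inv_into (f ` U) (c \<circ> f')) y"
      using inv_into_push[OF is_chart_inj[OF ch], of f' f y] by simp
  qed
  moreover have "smooth_on (d ` (f ` U \<inter> V)) (c \<circ> f' \<circ> inv_into V d)"
    using f'[of V d] b bV s2 by simp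
  ultimately show "smooth_compatible (f ` U, c \<circ> f') b"
    by (simp add: smooth_compatible_def bV)
qed

end


section \<open>Coordinate changes and tangent vectors\<close>

definition trans_deriv ::
    "('a, 'e::euclidean_space) chart \<Rightarrow> ('a, 'e) chart \<Rightarrow> 'a \<Rightarrow> 'e \<Rightarrow> 'e" where
  "trans_deriv a b x = frechet_derivative (snd b \<circ> inv_into (fst a) (snd a)) (at (snd a x))"

lemma coord_vector_apply:
  "coord_vector A a x u b = (if b \<in> A \<and> x \<in> fst b then trans_deriv a b x u else 0)"
  by (simp add: coord_vector_def trans_deriv_def split: prod.split)

context smooth_mfd
begin

lemma trans_has_derivative:
  assumes "(U, c) \<in> A" "(V, d) \<in> A" "x \<in> U" "x \<in> V"
  shows "((d \<circ> inv_into U c) has_derivative trans_deriv (U, c) (V, d) x) (at (c x))"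
proof -
  have "smooth_on (c ` (U \<inter> V)) (d \<circ> inv_into U c)"
    using compatible[OF assms(1,2)] by (simp add: smooth_compatible_def)
  then have "(d \<circ> inv_into U c) differentiable (at (c x))"
    by (rule smooth_on_differentiable) (use assms in auto)
  then show ?thesis
    unfolding trans_deriv_def fst_conv snd_conv by (rule frechet_derivative_works[THEN iffD1])
qed

lemma trans_linear:
  assumes "(U, c) \<in> A" "(V, d) \<in> A" "x \<in> U" "x \<in> V"
  shows "linear (trans_deriv (U, c) (V, d) x)"
  using trans_has_derivative[OF assms] has_derivative_linear by blast

lemma inv_chart [simp]: "(U, c) \<in> A \<Longrightarrow> x \<in> U \<Longrightarrow> inv_into U c (c x) = x"
  using is_chart_inj[OF chart] by simp

lemma trans_cocycle:
  assumes "(U, c) \<in> A" "(V, d) \<in> A" "(W, e) \<in> A" "x \<in> U" "x \<in> V" "x \<in> W"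
  shows "trans_deriv (V, d) (W, e) x (trans_deriv (U, c) (V, d) x u) = trans_deriv (U, c) (W, e) x u"
proof -
  have 1: "((d \<circ> inv_into U c) has_derivative trans_deriv (U, c) (V, d) x) (at (c x))"
    by (rule trans_has_derivative) (use assms in auto)
  have 2: "((e \<circ> inv_into V d) has_derivative trans_deriv (V, d) (W, e) x) (at ((d \<circ> inv_into U c) (c x)))"
    using trans_has_derivative[of V d W e x] assms by simp
  have 3: "((e \<circ> inv_into V d) \<circ> (d \<circ> inv_into U c) has_derivative
      trans_deriv (V, d) (W, e) x \<circ> trans_deriv (U, c) (V, d) x) (at (c x))"
    by (rule diff_chain_at[OF 1 2])
  have op: "open (c ` (U \<inter> V))" using overlap_open assms chart by blast
  have "(e \<circ> inv_into U c has_derivative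
      trans_deriv (V, d) (W, e) x \<circ> trans_deriv (U, c) (V, d) x) (at (c x))"
    by (rule has_derivative_transform_within_open[OF 3 op]) (use assms in auto)
  then have "trans_deriv (V, d) (W, e) x \<circ> trans_deriv (U, c) (V, d) x = trans_deriv (U, c) (W, e) x"
    unfolding trans_deriv_def[of "(U, c)" "(W, e)"] using frechet_derivative_at by auto
  then show ?thesis by (metis comp_apply)
qed

lemma trans_id:
  assumes "(U, c) \<in> A" "x \<in> U"
  shows "trans_deriv (U, c) (U, c) x u = u"
proof -
  have op: "open (c ` U)" using is_chart_open_image chart assms(1) by blast
  have "(c \<circ> inv_into U c has_derivative (\<lambda>u. u)) (at (c x))"
    by (rule has_derivative_transform_within_open[OF has_derivative_ident op])
      (use assms in \<open>auto simp: f_inv_into_f\<close>)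
  then have "(\<lambda>u. u) = trans_deriv (U, c) (U, c) x"
    unfolding trans_deriv_def using frechet_derivative_at by auto
  then show ?thesis by metis
qed

lemma curve_change:
  assumes "(U, c) \<in> A" "(V, d) \<in> A" "k s \<in> U" "k s \<in> V" "s \<in> S"
    and der: "((\<lambda>r. c (k r)) has_vector_derivative u) (at s within S)"
    and ev: "\<forall>\<^sub>F r in at s within S. k r \<in> U"
  shows "((\<lambda>r. d (k r)) has_vector_derivative trans_deriv (U, c) (V, d) (k s) u) (at s within S)"
proof -
  have lin: "linear (trans_deriv (U, c) (V, d) (k s))"
    using trans_linear assms by blast
  have "((\<lambda>r. (d \<circ> inv_into U c) (c (k r))) has_derivative
      (\<lambda>h. trans_deriv (U, c) (V, d) (k s) (h *\<^sub>R u))) (at s within S)"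
    by (rule has_derivative_compose[OF der[unfolded has_vector_derivative_def]
          trans_has_derivative[OF assms(1-4)]])
  then have "((\<lambda>r. (d \<circ> inv_into U c) (c (k r))) has_derivative
      (\<lambda>h. h *\<^sub>R trans_deriv (U, c) (V, d) (k s) u)) (at s within S)"
    using linear_scale[OF lin] by simp
  then have "((\<lambda>r. d (k r)) has_derivative
      (\<lambda>h. h *\<^sub>R trans_deriv (U, c) (V, d) (k s) u)) (at s within S)"
  proof (rule has_derivative_transform_eventually)
    show "\<forall>\<^sub>F r in at s within S. (d \<circ> inv_into U c) (c (k r)) = d (k r)"
      using ev by eventually_elim (use assms(1) in simp)
  qed (use assms in auto)
  then show ?thesis by (simp add: has_vector_derivative_def)
qed

lemma coord_vector_tangent:
  assumes "(U, c) \<in> A" "x \<in> U"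
  shows "coord_vector A (U, c) x u \<in> tangent_space A x"
proof -
  have "frechet_derivative (e \<circ> inv_into V d) (at (d x)) (coord_vector A (U, c) x u (V, d))
      = coord_vector A (U, c) x u (W, e)"
    if "(V, d) \<in> A" "(W, e) \<in> A" "x \<in> V \<inter> W" for V d W e
    using trans_cocycle[of U c V d W e x u] that assms
    by (simp add: coord_vector_apply trans_deriv_def[of "(V, d)"])
  moreover have "coord_vector A (U, c) x u (V, d) = 0" if "\<not> ((V, d) \<in> A \<and> x \<in> V)" for V d
    using that by (auto simp: coord_vector_apply)
  ultimately show ?thesis unfolding tangent_space_def by auto
qed

lemma tangent_eq_coord:
  assumes "(U, c) \<in> A" "x \<in> U" "v \<in> tangent_space A x"
  shows "coord_vector A (U, c) x (v (U, c)) = v"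
proof
  fix b :: "('a, 'e) chart"
  obtain V d where b: "b = (V, d)" by (cases b)
  show "coord_vector A (U, c) x (v (U, c)) b = v b"
  proof (cases "(V, d) \<in> A \<and> x \<in> V")
    case True
    then have "v (V, d) = frechet_derivative (d \<circ> inv_into U c) (at (c x)) (v (U, c))"
      using assms unfolding tangent_space_def by blast
    then show ?thesis using True b by (simp add: coord_vector_apply trans_deriv_def)
  next
    case False
    then have "v (V, d) = 0" using assms(3) unfolding tangent_space_def by blast
    then show ?thesis using False b by (auto simp: coord_vector_apply)
  qed
qed

lemma coord_vector_self:
  "(U, c) \<in> A \<Longrightarrow> x \<in> U \<Longrightarrow> coord_vector A (U, c) x u (U, c) = u"
  by (simp add: coord_vector_apply trans_id)

lemma coord_vector_change:
  assumes "(U, c) \<in> A" "(V, d) \<in> A" "x \<in> U" "x \<in> V"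
  shows "coord_vector A (V, d) x (trans_deriv (U, c) (V, d) x u) = coord_vector A (U, c) x u"
  using tangent_eq_coord[OF assms(2,4) coord_vector_tangent[OF assms(1,3)], of u] assms
  by (simp add: coord_vector_apply)

lemma compact_ball_closedin:
  assumes "(U, c) \<in> A" "compact K" "K \<subseteq> c ` U"
  shows "closedin X {x\<in>U. c x \<in> K}"
  using is_chart_compactin[OF chart[OF assms(1)] assms(2,3)] Hausdorff compactin_imp_closedin by blast

text \<open>Mean value inequality with a first-exit argument: the derivative bound is only needed
  inside the ball, and it keeps the curve there.\<close>

lemma curve_stays_in_chart_ball:
  assumes a: "(U, c) \<in> A" "ball y0 \<rho> \<subseteq> c ` U"
    and k: "continuous_map (top_of_set {0..1}) X k" "k 0 \<in> U"
    and M: "dist (c (k 0)) y0 + M < \<rho>" "M \<ge> 0"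
    and der: "\<And>s::real. s \<in> {0..1} \<Longrightarrow> k s \<in> U \<Longrightarrow> dist (c (k s)) y0 < \<rho> \<Longrightarrow>
      \<exists>u. ((\<lambda>r. c (k r)) has_vector_derivative u) (at s within {0..1}) \<and> norm u \<le> M"
    and s: "s \<in> {0..1}"
  shows "k s \<in> U \<and> dist (c (k s)) (c (k 0)) \<le> M * s"
proof -
  define B where "B = {x\<in>U. c x \<in> ball y0 \<rho>}"
  define Kc where "Kc = {x\<in>U. c x \<in> cball (c (k 0)) M}"
  have opB: "openin X B"
    unfolding B_def by (rule is_chart_openin_preimage[OF chart[OF a(1)]]) simp
  have sub: "cball (c (k 0)) M \<subseteq> ball y0 \<rho>"
  proof
    fix y assume "y \<in> cball (c (k 0)) M"
    then show "y \<in> ball y0 \<rho>"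
      using M(1) dist_triangle[of y0 y "c (k 0)"] by (simp add: dist_commute)
  qed
  have clK: "closedin X Kc"
    unfolding Kc_def by (rule compact_ball_closedin[OF a(1)]) (use sub a(2) in auto)
  have KB: "Kc \<subseteq> B" using sub by (auto simp: Kc_def B_def)
  have bound: "dist (c (k s)) (c (k 0)) \<le> M * s"
    if s: "s \<in> {0..1}" and in_B: "\<And>r. r \<in> {0..s} \<Longrightarrow> k r \<in> B" for s
  proof -
    have "\<exists>u. ((\<lambda>r. c (k r)) has_vector_derivative u) (at r within {0..s}) \<and> norm u \<le> M"
      if r: "r \<in> {0..s}" for r
    proof -
      have "k r \<in> U" "dist (c (k r)) y0 < \<rho>"
        using in_B[OF r] by (auto simp: B_def dist_commute)
      then obtain u where "((\<lambda>r. c (k r)) has_vector_derivative u) (at r within {0..1})" "norm u \<le> M"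
        using der[of r] r s by auto
      then show ?thesis
        using has_vector_derivative_within_subset[of _ u r "{0..1}" "{0..s}"] s by auto
    qed
    then obtain u where u: "\<And>r. r \<in> {0..s} \<Longrightarrow>
        ((\<lambda>r. c (k r)) has_vector_derivative u r) (at r within {0..s}) \<and> norm (u r) \<le> M"
      by metis
    have "norm (c (k s) - c (k 0)) \<le> M * norm (s - 0)"
    proof (rule differentiable_bound[of "{0..s}" _ "\<lambda>r h. h *\<^sub>R u r"])
      show "((\<lambda>r. c (k r)) has_derivative (\<lambda>h. h *\<^sub>R u r)) (at r within {0..s})" if "r \<in> {0..s}" for r
        using u[OF that] by (simp add: has_vector_derivative_def)
      show "onorm (\<lambda>h. h *\<^sub>R u r) \<le> M" if "r \<in> {0..s}" for r
      proof (rule onorm_le)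
        fix h :: real
        show "norm (h *\<^sub>R u r) \<le> M * norm h"
          using u[OF that] mult_right_mono[of "norm (u r)" M "\<bar>h\<bar>"] by (simp add: mult.commute)
      qed
    qed (use s in auto)
    then show ?thesis using s by (simp add: dist_norm)
  qed
  define Z where "Z = {s\<in>{0..1}. k s \<in> topspace X - B}"
  have clpre: "closed {s\<in>{0..1}. k s \<in> S}" if "closedin X S" for S
  proof -
    have "closedin (top_of_set {0..1::real}) {s \<in> topspace (top_of_set {0..1}). k s \<in> S}"
      by (rule closedin_continuous_map_preimage[OF k(1) that])
    then have "closedin (top_of_set {0..1::real}) {s \<in> {0..1}. k s \<in> S}" by simp
    then show ?thesis using closedin_closed_trans by (metis closed_real_atLeastAtMost)
  qed
  have Zcl: "closed Z"
    unfolding Z_def by (rule clpre) (use opB in blast)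
  have kX: "k s \<in> topspace X" if "s \<in> {0..1}" for s
    using continuous_map_image_subset_topspace[OF k(1)] that by auto
  have "Z = {}"
  proof (rule ccontr)
    assume ne: "Z \<noteq> {}"
    have bdd: "bdd_below Z" unfolding Z_def by (rule bdd_belowI[of _ 0]) auto
    define s1 where "s1 = Inf Z"
    have s1: "s1 \<in> Z" unfolding s1_def by (rule closed_contains_Inf[OF ne bdd Zcl])
    have k0: "k 0 \<in> B" using k(2) M by (simp add: B_def dist_commute)
    have "s1 \<noteq> 0" using s1 k0 by (auto simp: Z_def)
    then have s1pos: "0 < s1" "s1 \<le> 1" using s1 by (auto simp: Z_def)
    have below: "k r \<in> B" if "r \<in> {0..<s1}" for r
    proof (rule ccontr)
      assume "k r \<notin> B"
      then have "r \<in> Z" using that s1pos kX by (auto simp: Z_def)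
      then show False using cInf_lower[OF _ bdd, of r] that by (simp add: s1_def)
    qed
    have inK: "k r \<in> Kc" if "r \<in> {0..<s1}" for r
    proof -
      have "dist (c (k r)) (c (k 0)) \<le> M * r"
        by (rule bound) (use that s1pos below in auto)
      also have "\<dots> \<le> M" using that s1pos M(2) by (simp add: mult_left_le)
      finally show ?thesis using below[OF that] by (auto simp: Kc_def B_def dist_commute)
    qed
    have "{0..<s1} \<subseteq> {s\<in>{0..1}. k s \<in> Kc}" using inK s1pos by auto
    then have "closure {0..<s1} \<subseteq> {s\<in>{0..1}. k s \<in> Kc}"
      using closure_minimal clpre[OF clK] by blast
    moreover have "s1 \<in> closure {0..<s1}" using s1pos by simp
    ultimately have "k s1 \<in> Kc" by blast
    then show False using KB s1 by (auto simp: Z_def)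
  qed
  then have all: "k r \<in> B" if "r \<in> {0..1}" for r using that kX by (auto simp: Z_def)
  then show ?thesis using bound[OF s] s by (auto simp: B_def)
qed

end


section \<open>Riemannian norms in coordinates\<close>

locale riemannian_mfd = smooth_mfd X A
  for X :: "'a topology" and A :: "('a, 'e::euclidean_space) chart set" +
  fixes g :: "'a \<Rightarrow> ('a, 'e) tvec \<Rightarrow> ('a, 'e) tvec \<Rightarrow> real"
  assumes metric: "riemannian_metric A g"
begin

definition cnorm :: "('a, 'e) chart \<Rightarrow> 'a \<Rightarrow> 'e \<Rightarrow> real" where
  "cnorm a x u = riem_norm g x (coord_vector A a x u)"

lemma cnorm_change:
  assumes "(U, c) \<in> A" "(V, d) \<in> A" "x \<in> U" "x \<in> V"
  shows "cnorm (V, d) x (trans_deriv (U, c) (V, d) x u) = cnorm (U, c) x u"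
  using coord_vector_change[OF assms] by (simp add: cnorm_def)

lemma metric_bilinear:
  "(U, c) \<in> A \<Longrightarrow> x \<in> U \<Longrightarrow>
    bilinear (\<lambda>u w. g x (coord_vector A (U, c) x u) (coord_vector A (U, c) x w))"
  using metric unfolding riemannian_metric_def by blast

lemma metric_pos:
  assumes "(U, c) \<in> A" "x \<in> U" "u \<noteq> 0"
  shows "g x (coord_vector A (U, c) x u) (coord_vector A (U, c) x u) > 0"
proof -
  have "coord_vector A (U, c) x u \<noteq> (\<lambda>_. 0)"
    using coord_vector_self[OF assms(1,2), of u] assms(3) by (metis)
  then show ?thesis
    using metric coord_vector_tangent[OF assms(1,2), of u] assms(1,2)
    unfolding riemannian_metric_def by blast
qed

lemma metric_cont:
  assumes "(U, c) \<in> A"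
  shows "continuous_on (c ` U) (\<lambda>y. g (inv_into U c y) (coord_vector A (U, c) (inv_into U c y) u)
    (coord_vector A (U, c) (inv_into U c y) w))"
proof -
  have "smooth_on (c ` U) (\<lambda>y. let x = inv_into U c y in
        g x (coord_vector A (U, c) x u) (coord_vector A (U, c) x w))"
    using metric[unfolded riemannian_metric_def, rule_format, OF assms] by simp
  then show ?thesis using smooth_on_continuous unfolding Let_def by blast
qed

lemma cnorm_continuous:
  assumes "(U, c) \<in> A"
  shows "continuous_on (c ` U) (\<lambda>y. cnorm (U, c) (inv_into U c y) u)"
  unfolding cnorm_def riem_norm_def
  by (intro continuous_on_real_sqrt metric_cont[OF assms])

lemma cnorm_scale:
  assumes "(U, c) \<in> A" "x \<in> U"
  shows "cnorm (U, c) x (k *\<^sub>R u) = \<bar>k\<bar> * cnorm (U, c) x u"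
  using bilinear_lmul[OF metric_bilinear[OF assms]] bilinear_rmul[OF metric_bilinear[OF assms]]
  by (simp add: cnorm_def riem_norm_def real_sqrt_mult mult.assoc[symmetric])

lemma cnorm_pos:
  "(U, c) \<in> A \<Longrightarrow> x \<in> U \<Longrightarrow> u \<noteq> 0 \<Longrightarrow> 0 < cnorm (U, c) x u"
  using metric_pos by (simp add: cnorm_def riem_norm_def)

lemma cnorm_nonneg:
  assumes "(U, c) \<in> A" "x \<in> U"
  shows "0 \<le> cnorm (U, c) x u"
proof (cases "u = 0")
  case True
  then show ?thesis using cnorm_scale[OF assms, of 0 u] by simp
next
  case False
  then show ?thesis using cnorm_pos[OF assms] by (simp add: less_imp_le)
qed

text \<open>The norm is continuous and positive on the compact set \<open>K \<times> sphere 0 1\<close>, so on \<open>K\<close> it is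
  uniformly comparable with the Euclidean norm of the coordinates.\<close>

lemma cnorm_bounds:
  assumes a: "(U, c) \<in> A" and K: "compact K" "K \<subseteq> c ` U"
  obtains M where "M > 0" "\<And>x u. x \<in> U \<Longrightarrow> c x \<in> K \<Longrightarrow>
      norm u \<le> M * cnorm (U, c) x u \<and> cnorm (U, c) x u \<le> M * norm u"
proof -
  define q where "q y u w = g (inv_into U c y) (coord_vector A (U, c) (inv_into U c y) u)
    (coord_vector A (U, c) (inv_into U c y) w)" for y u w
  have inU: "inv_into U c y \<in> U" if "y \<in> c ` U" for y using that by (rule inv_into_into)
  have q_sum: "q y u u = (\<Sum>(i, j)\<in>Basis \<times> Basis. (u \<bullet> i) * ((u \<bullet> j) * q y i j))"
    if "y \<in> c ` U" for y u
  proof -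
    have bl: "bilinear (q y)" unfolding q_def using metric_bilinear[OF a inU[OF that]] .
    have "q y (\<Sum>i\<in>Basis. (u \<bullet> i) *\<^sub>R i) (\<Sum>j\<in>Basis. (u \<bullet> j) *\<^sub>R j) =
      (\<Sum>(i, j)\<in>Basis \<times> Basis. q y ((u \<bullet> i) *\<^sub>R i) ((u \<bullet> j) *\<^sub>R j))"
      using bilinear_sum[OF bl] by blast
    then show ?thesis
      unfolding euclidean_representation
      by (simp add: bilinear_lmul[OF bl] bilinear_rmul[OF bl] case_prod_unfold mult.left_commute)
  qed
  define S where "S = K \<times> sphere (0::'e) 1"
  have comp: "compact S" unfolding S_def by (intro compact_Times K compact_sphere)
  have cont: "continuous_on S (\<lambda>z. sqrt (q (fst z) (snd z) (snd z)))"
  proof (rule continuous_on_real_sqrt)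
    have "continuous_on S (\<lambda>z. \<Sum>(i, j)\<in>Basis \<times> Basis. (snd z \<bullet> i) * ((snd z \<bullet> j) * q (fst z) i j))"
    proof (intro continuous_on_sum)
      fix ij :: "'e \<times> 'e" assume "ij \<in> Basis \<times> Basis"
      obtain i j where ij: "ij = (i, j)" by (cases ij)
      have "continuous_on S (\<lambda>z. q (fst z) i j)"
        by (rule continuous_on_compose2[OF metric_cont[OF a, folded q_def]])
          (use K in \<open>auto simp: S_def intro!: continuous_intros\<close>)
      then show "continuous_on S (\<lambda>z. case ij of (i, j) \<Rightarrow> (snd z \<bullet> i) * ((snd z \<bullet> j) * q (fst z) i j))"
        unfolding ij by (auto intro!: continuous_intros)
    qed
    then show "continuous_on S (\<lambda>z. q (fst z) (snd z) (snd z))"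
      by (rule continuous_on_eq) (use q_sum K in \<open>auto simp: S_def\<close>)
  qed
  have qn: "sqrt (q (c x) u u) = cnorm (U, c) x u" if "x \<in> U" for x u
    using that a by (simp add: q_def cnorm_def riem_norm_def)
  obtain b1 :: 'e where b1: "b1 \<in> Basis" using nonempty_Basis by blast
  show thesis
  proof (cases "K = {}")
    case True
    show thesis by (rule that[of 1]) (use True in auto)
  next
    case False
    then have ne: "S \<noteq> {}" using b1 by (auto simp: S_def)
    obtain zm where zm: "zm \<in> S" "\<And>z. z \<in> S \<Longrightarrow>
        sqrt (q (fst zm) (snd zm) (snd zm)) \<le> sqrt (q (fst z) (snd z) (snd z))"
      using continuous_attains_inf[OF comp ne cont] by blast
    obtain zM where zM: "zM \<in> S" "\<And>z. z \<in> S \<Longrightarrow>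
        sqrt (q (fst z) (snd z) (snd z)) \<le> sqrt (q (fst zM) (snd zM) (snd zM))"
      using continuous_attains_sup[OF comp ne cont] by blast
    define m where "m = sqrt (q (fst zm) (snd zm) (snd zm))"
    define M where "M = sqrt (q (fst zM) (snd zM) (snd zM))"
    have m: "m > 0"
    proof -
      obtain x where x: "x \<in> U" "fst zm = c x" using zm(1) K(2) by (auto simp: S_def)
      have "snd zm \<noteq> 0" using zm(1) by (auto simp: S_def)
      then show ?thesis using cnorm_pos[OF a x(1)] qn[OF x(1)] x(2) by (simp add: m_def)
    qed
    have mM: "m \<le> M" using zm(2)[OF zM(1)] by (simp add: m_def M_def)
    have unit: "m * norm u \<le> cnorm (U, c) x u \<and> cnorm (U, c) x u \<le> M * norm u"
      if x: "x \<in> U" "c x \<in> K" for x u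
    proof (cases "u = 0")
      case True
      then show ?thesis using cnorm_scale[OF a x(1), of 0 u] by simp
    next
      case False
      have "(c x, (1 / norm u) *\<^sub>R u) \<in> S" using x False by (simp add: S_def)
      then have "m \<le> cnorm (U, c) x ((1 / norm u) *\<^sub>R u)" "cnorm (U, c) x ((1 / norm u) *\<^sub>R u) \<le> M"
        using zm(2)[of "(c x, (1 / norm u) *\<^sub>R u)"] zM(2)[of "(c x, (1 / norm u) *\<^sub>R u)"]
          qn[OF x(1)] by (auto simp: m_def M_def)
      then show ?thesis
        using False cnorm_scale[OF a x(1), of "1 / norm u" u] by (simp add: field_simps)
    qed
    show thesis
    proof (rule that[of "max M (1 / m)"])
      show "max M (1 / m) > 0" using m by (simp add: less_max_iff_disj)
      fix x u assume x: "x \<in> U" "c x \<in> K"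
      have "norm u \<le> (1 / m) * cnorm (U, c) x u" using unit[OF x, of u] m by (simp add: field_simps)
      also have "\<dots> \<le> max M (1 / m) * cnorm (U, c) x u"
        by (intro mult_right_mono cnorm_nonneg[OF a x(1)]) simp
      finally have 1: "norm u \<le> max M (1 / m) * cnorm (U, c) x u" .
      have "cnorm (U, c) x u \<le> M * norm u" using unit[OF x] by blast
      also have "\<dots> \<le> max M (1 / m) * norm u" by (intro mult_right_mono) auto
      finally show "norm u \<le> max M (1 / m) * cnorm (U, c) x u \<and>
          cnorm (U, c) x u \<le> max M (1 / m) * norm u" using 1 by blast
    qed
  qed
qed

end


section \<open>Paths in leaves\<close>

lemma path_component_of_set_eq:
  "path_component_of T x y \<Longrightarrow> path_component_of_set T y = path_component_of_set T x"
  using path_component_of_equiv[of T x y] by simp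

lemma path_componentI:
  fixes k :: "real \<Rightarrow> 'a"
  assumes "continuous_map (top_of_set {0..1}) X k" "\<And>s. s \<in> {0..1} \<Longrightarrow> k s \<in> S"
  shows "path_component_of (subtopology X S) (k 0) (k 1)"
proof -
  have "pathin (subtopology X S) k"
    unfolding pathin_def using assms by (auto simp: continuous_map_in_subtopology)
  then show ?thesis unfolding path_component_of_def by blast
qed

locale foliated_mfd = riemannian_mfd X A g
  for X :: "'a topology" and A :: "('a, 'e::euclidean_space) chart set" and g +
  fixes p :: nat and F :: "'a set set"
  assumes fol: "foliation TYPE('e) X p F"
    and dim_pos: "p > 0"
    and slices: "smooth_leaves X A p F"
    and tangent_cont: "continuous_tangent_bundle X A p F"
begin

lemma leaf_unique: "L \<in> F \<Longrightarrow> L' \<in> F \<Longrightarrow> x \<in> L \<Longrightarrow> x \<in> L' \<Longrightarrow> L = L'"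
  using partition_onD2[of "topspace X" F] fol disjointD[of F L L']
  unfolding foliation_def by blast

lemma leaf_at:
  assumes "x \<in> topspace X"
  obtains L where "L \<in> F" "x \<in> L"
proof -
  have "\<Union>F = topspace X" using fol partition_onD1[of "topspace X" F] unfolding foliation_def by simp
  then show ?thesis using assms that by blast
qed

lemma leaf_slice_iff:
  "leaf_slice X A p F x (U, c) P \<longleftrightarrow> (U, c) \<in> A \<and> x \<in> U \<and> subspace P \<and> dim P = p \<and>
     (\<exists>L\<in>F. x \<in> L \<and> path_component_of_set (subtopology X (L \<inter> U)) x = plaque (U, c) P x)"
  by (simp add: leaf_slice_def)

lemma plaque_eq:
  assumes "subspace P" "y \<in> plaque (U, c) P x"
  shows "plaque (U, c) P y = plaque (U, c) P x"
proof -
  have 1: "c y - c x \<in> P" using assms(2) by (simp add: plaque_def)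
  have "c z - c y \<in> P \<longleftrightarrow> c z - c x \<in> P" for z
    using subspace_add[OF assms(1) _ 1, of "c z - c y"]
      subspace_diff[OF assms(1) _ 1, of "c z - c x"] by (auto simp: algebra_simps)
  then show ?thesis by (simp add: plaque_def)
qed

text \<open>The leaf through a point is unique, so the slice criterion holds for every leaf that is known
  to contain the point.\<close>

lemma slice_plaque_eq:
  assumes "leaf_slice X A p F x (U, c) P" "L \<in> F" "x \<in> L"
  shows "path_component_of_set (subtopology X (L \<inter> U)) x = plaque (U, c) P x"
  using assms leaf_unique unfolding leaf_slice_iff by blast

lemma slice_plaque_leaf:
  assumes "leaf_slice X A p F x (U, c) P" "L \<in> F" "x \<in> L" "y \<in> plaque (U, c) P x"
  shows "y \<in> L"
proof -
  have "path_component_of (subtopology X (L \<inter> U)) x y"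
    using slice_plaque_eq[OF assms(1-3)] assms(4) by blast
  then have "y \<in> topspace (subtopology X (L \<inter> U))" using path_component_in_topspace by metis
  then show ?thesis by simp
qed

text \<open>A slice chart at a point is a slice chart at all points of the same plaque. Therefore the
  tangent space of a leaf is the same subspace \<open>P\<close> of the coordinates along the whole plaque.\<close>

lemma slice_move:
  assumes "leaf_slice X A p F x (U, c) P" "y \<in> plaque (U, c) P x"
  shows "leaf_slice X A p F y (U, c) P"
proof -
  obtain L where L: "L \<in> F" "x \<in> L" using assms(1) leaf_slice_iff by blast
  have pc: "path_component_of (subtopology X (L \<inter> U)) x y"
    using slice_plaque_eq[OF assms(1) L] assms(2) by blast
  have sp: "subspace P" using assms(1) leaf_slice_iff by blast
  have "path_component_of_set (subtopology X (L \<inter> U)) y = plaque (U, c) P y"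
    using path_component_of_set_eq[OF pc] slice_plaque_eq[OF assms(1) L]
      plaque_eq[OF sp assms(2)] by simp
  moreover have "y \<in> U" using assms(2) by (simp add: plaque_def)
  ultimately show ?thesis
    using assms(1) L slice_plaque_leaf[OF assms(1) L assms(2)] unfolding leaf_slice_iff by blast
qed

lemma slice_at:
  assumes "x \<in> topspace X"
  obtains U c P where "leaf_slice X A p F x (U, c) P"
  using slices assms unfolding smooth_leaves_def by (metis surj_pair)


text \<open>A curve in a leaf that is a straight segment in some slice chart, with speed at most \<open>l\<close>, hence
  of length at most \<open>l\<close>. This class of curves is mapped to itself by the action, because the
  action carries slice charts to slice charts and leaves the coordinates of the segment alone.\<close>

definition leaf_arc :: "real \<Rightarrow> 'a \<Rightarrow> 'a \<Rightarrow> bool" where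
  "leaf_arc l x y \<longleftrightarrow> (\<exists>U c P u. leaf_slice X A p F x (U, c) P \<and> u \<in> P \<and>
     (\<forall>s\<in>{0..1}. c x + s *\<^sub>R u \<in> c ` U \<and> cnorm (U, c) (inv_into U c (c x + s *\<^sub>R u)) u \<le> l) \<and>
     y = inv_into U c (c x + u))"

text \<open>A certificate that the leafwise distance from \<open>x\<close> to \<open>y\<close> is at most \<open>l\<close>: a finite chain
  of arcs. As a relation with a length parameter it has the triangle inequality and the
  contraction under negative times, which are the metric properties that the proof uses.\<close>

inductive reach :: "real \<Rightarrow> 'a \<Rightarrow> 'a \<Rightarrow> bool" where
  reach_refl: "x \<in> topspace X \<Longrightarrow> 0 \<le> l \<Longrightarrow> reach l x x"
| reach_step: "reach l x y \<Longrightarrow> leaf_arc m y z \<Longrightarrow> l + m \<le> n \<Longrightarrow> reach n x z"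

lemma reach_mono:
  assumes "reach l x y" "l \<le> l'"
  shows "reach l' x y"
  using assms by (cases rule: reach.cases) (auto intro: reach.intros)

lemma reach_trans:
  assumes "reach m y z" "reach l x y"
  shows "reach (l + m) x z"
  using assms
proof (induction rule: reach.induct)
  case (reach_refl x l)
  then show ?case by (elim reach_mono) simp
next
  case (reach_step m y z m' w n)
  then show ?case using reach.reach_step[of "l + m" x z m' w "l + n"] by simp
qed

lemma slice_segment:
  assumes sl: "leaf_slice X A p F x (U, c) P" and u: "u \<in> P"
    and seg: "\<And>s. s \<in> {0..1} \<Longrightarrow> c x + s *\<^sub>R u \<in> c ` U"
  defines "k \<equiv> \<lambda>s. inv_into U c (c x + s *\<^sub>R u)"
  shows "continuous_map (top_of_set {0..1}) X k"
    and "\<And>s. s \<in> {0..1} \<Longrightarrow> c (k s) = c x + s *\<^sub>R u"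
    and "\<And>s. s \<in> {0..1} \<Longrightarrow> k s \<in> plaque (U, c) P x"
    and "k 0 = x"
proof -
  have a: "(U, c) \<in> A" "x \<in> U" "subspace P" using sl leaf_slice_iff by blast+
  show ck: "c (k s) = c x + s *\<^sub>R u" if "s \<in> {0..1}" for s
    using seg[OF that] by (simp add: k_def f_inv_into_f)
  show "k s \<in> plaque (U, c) P x" if "s \<in> {0..1}" for s
    using ck[OF that] seg[OF that] subspace_scale[OF a(3) u]
    by (simp add: plaque_def k_def inv_into_into)
  show "k 0 = x" using a by (simp add: k_def)
  have "continuous_map (top_of_set {0..1}) (top_of_set (c ` U)) (\<lambda>s. c x + s *\<^sub>R u)"
    using seg by (auto simp: continuous_map_in_subtopology intro!: continuous_intros)
  then have "continuous_map (top_of_set {0..1}) X (inv_into U c \<circ> (\<lambda>s. c x + s *\<^sub>R u))"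
    using is_chart_inv_cont[OF chart[OF a(1)]] continuous_map_compose by blast
  then show "continuous_map (top_of_set {0..1}) X k" by (simp add: k_def o_def)
qed

text \<open>The speed of an arc is measured in its own slice chart; the bound holds in every other chart,
  since the norm of a tangent vector does not depend on coordinates.\<close>

lemma leaf_arc_curve:
  assumes "leaf_arc l x y"
  obtains k where "continuous_map (top_of_set {0..1}) X k" "k 0 = x" "k 1 = y"
    "\<And>s L. s \<in> {0..1} \<Longrightarrow> L \<in> F \<Longrightarrow> x \<in> L \<Longrightarrow> k s \<in> L"
    "\<And>s V d. s \<in> {0..1} \<Longrightarrow> (V, d) \<in> A \<Longrightarrow> k s \<in> V \<Longrightarrow>
       \<exists>w. ((\<lambda>r. d (k r)) has_vector_derivative w) (at s within {0..1}) \<and> cnorm (V, d) (k s) w \<le> l"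
proof -
  obtain U c P u where sl: "leaf_slice X A p F x (U, c) P" "u \<in> P"
    and s1: "\<And>s. s \<in> {0..1} \<Longrightarrow> c x + s *\<^sub>R u \<in> c ` U"
    and s2: "\<And>s. s \<in> {0..1} \<Longrightarrow> cnorm (U, c) (inv_into U c (c x + s *\<^sub>R u)) u \<le> l"
    and y: "y = inv_into U c (c x + u)"
    using assms unfolding leaf_arc_def by blast
  define k where "k = (\<lambda>s. inv_into U c (c x + s *\<^sub>R u))"
  have k: "continuous_map (top_of_set {0..1}) X k"
    "\<And>s. s \<in> {0..1} \<Longrightarrow> c (k s) = c x + s *\<^sub>R u"
    "\<And>s. s \<in> {0..1} \<Longrightarrow> k s \<in> plaque (U, c) P x" "k 0 = x"
    using slice_segment[OF sl] s1 by (simp_all add: k_def)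
  have a: "(U, c) \<in> A" using sl(1) leaf_slice_iff by blast
  have kU: "k s \<in> U" if "s \<in> {0..1}" for s using k(3)[OF that] by (simp add: plaque_def)
  have der: "((\<lambda>r. c (k r)) has_vector_derivative u) (at s within {0..1})" if s: "s \<in> {0..1}" for s
  proof -
    have "((\<lambda>r. c x + r *\<^sub>R u) has_vector_derivative u) (at s within {0..1})"
      by (auto intro!: derivative_eq_intros)
    then show ?thesis
      using has_vector_derivative_transform[OF s, of "\<lambda>r. c (k r)" "\<lambda>r. c x + r *\<^sub>R u"] k(2) by simp
  qed
  show thesis
  proof (rule that[OF k(1) k(4)])
    show "k 1 = y" by (simp add: k_def y)
    show "k s \<in> L" if "s \<in> {0..1}" "L \<in> F" "x \<in> L" for s L
      using slice_plaque_leaf[OF sl(1) that(2,3) k(3)[OF that(1)]] .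
    show "\<exists>w. ((\<lambda>r. d (k r)) has_vector_derivative w) (at s within {0..1}) \<and> cnorm (V, d) (k s) w \<le> l"
      if s: "s \<in> {0..1}" and d: "(V, d) \<in> A" "k s \<in> V" for s V d
    proof (intro exI conjI)
      show "((\<lambda>r. d (k r)) has_vector_derivative trans_deriv (U, c) (V, d) (k s) u) (at s within {0..1})"
        by (rule curve_change[OF a d(1) kU[OF s] d(2) s der[OF s]])
          (simp add: eventually_at_filter kU)
      show "cnorm (V, d) (k s) (trans_deriv (U, c) (V, d) (k s) u) \<le> l"
        using cnorm_change[OF a d(1) kU[OF s] d(2), of u] s2[OF s] by (simp add: k_def)
    qed
  qed
qed

lemma leaf_arc_nonneg:
  assumes "leaf_arc l x y" shows "0 \<le> l"
proof -
  obtain U c P u where sl: "leaf_slice X A p F x (U, c) P"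
    and s2: "\<And>s. s \<in> {0..1} \<Longrightarrow> cnorm (U, c) (inv_into U c (c x + s *\<^sub>R u)) u \<le> l"
    using assms unfolding leaf_arc_def by blast
  have a: "(U, c) \<in> A" "x \<in> U" using sl leaf_slice_iff by blast+
  have "cnorm (U, c) x u \<le> l" using s2[of 0] a by simp
  then show ?thesis using cnorm_nonneg[OF a, of u] by linarith
qed

lemma leaf_arc_topspace:
  assumes "leaf_arc l x y" shows "y \<in> topspace X"
proof -
  obtain k where k: "continuous_map (top_of_set {0..1::real}) X k" "k 1 = y"
    using leaf_arc_curve[OF assms] by metis
  then show ?thesis using continuous_map_image_subset_topspace[OF k(1)] by auto
qed

lemma reach_topspace: "reach l x y \<Longrightarrow> x \<in> topspace X \<and> y \<in> topspace X"
  by (induction rule: reach.induct) (auto dest: leaf_arc_topspace)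

text \<open>A single chart \<open>W\<close> in which the leaves are products. Unlike a slice chart it controls all
  plaques in \<open>W\<close> at once, but only topologically: lengths make no sense in it.\<close>

definition foliated_at :: "'a set \<Rightarrow> ('a \<Rightarrow> 'e) \<Rightarrow> 'e set \<Rightarrow> bool" where
  "foliated_at W \<psi> P \<longleftrightarrow> foliated_chart X p (W, \<psi>) P \<and>
     (\<Union>L\<in>F. path_components_of (subtopology X (L \<inter> W))) = plaque (W, \<psi>) P ` W"

lemma foliated_at_ex:
  assumes "x \<in> topspace X"
  obtains W \<psi> P where "x \<in> W" "foliated_at W \<psi> P"
proof -
  have "\<exists>W (\<psi>::'a \<Rightarrow> 'e) P. x \<in> W \<and> foliated_at W \<psi> P"
    using fol assms unfolding foliation_def foliated_at_def by simp
  then show ?thesis using that by blast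
qed

text \<open>The plaque of \<open>y\<close> is a path component of some leaf in \<open>W\<close>; as it contains \<open>y\<close>, that leaf is
  the one through \<open>y\<close>.\<close>

lemma foliated_plaque_eq:
  assumes W: "foliated_at W \<psi> P" and y: "y \<in> W" "y \<in> L" "L \<in> F"
  shows "plaque (W, \<psi>) P y = path_component_of_set (subtopology X (L \<inter> W)) y"
proof -
  have sp: "subspace P" using W by (simp add: foliated_at_def foliated_chart_def)
  have "plaque (W, \<psi>) P y \<in> (\<Union>L\<in>F. path_components_of (subtopology X (L \<inter> W)))"
    using W y(1) unfolding foliated_at_def by blast
  then obtain L' where L': "L' \<in> F" "plaque (W, \<psi>) P y \<in> path_components_of (subtopology X (L' \<inter> W))"
    by blast
  then obtain z where z: "z \<in> topspace (subtopology X (L' \<inter> W))"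
    "plaque (W, \<psi>) P y = path_component_of_set (subtopology X (L' \<inter> W)) z"
    by (auto simp: path_components_of_def)
  have "y \<in> plaque (W, \<psi>) P y" using y sp by (simp add: plaque_def subspace_0)
  then have zy: "path_component_of (subtopology X (L' \<inter> W)) z y" using z(2) by simp
  then have "y \<in> L'" using path_component_in_topspace[OF zy] by auto
  then have "L' = L" using leaf_unique L'(1) y by blast
  then show ?thesis using z(2) path_component_of_set_eq[OF zy] by simp
qed

lemma arc_ball:
  assumes a: "(V, d) \<in> A" "ball y0 \<rho> \<subseteq> d ` V"
    and K: "K > 0" "\<And>y u. y \<in> V \<Longrightarrow> d y \<in> ball y0 \<rho> \<Longrightarrow> norm u \<le> K * cnorm (V, d) y u"
    and arc: "leaf_arc l x y" and x: "x \<in> V" "dist (d x) y0 + K * l < \<rho>"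
  obtains k :: "real \<Rightarrow> 'a"
    where "continuous_map (top_of_set {0..1}) X k" "k 0 = x" "k 1 = y"
    "\<And>s L. s \<in> {0..1} \<Longrightarrow> L \<in> F \<Longrightarrow> x \<in> L \<Longrightarrow> k s \<in> L"
    "\<And>s. s \<in> {0..1} \<Longrightarrow> k s \<in> V \<and> dist (d (k s)) (d x) \<le> K * l"
proof -
  have l: "0 \<le> l" using leaf_arc_nonneg[OF arc] .
  obtain k where k: "continuous_map (top_of_set {0..1}) X k" "k 0 = x" "k 1 = y"
    "\<And>s L. s \<in> {0..1} \<Longrightarrow> L \<in> F \<Longrightarrow> x \<in> L \<Longrightarrow> k s \<in> L"
    and der: "\<And>s V d. s \<in> {0..1} \<Longrightarrow> (V, d) \<in> A \<Longrightarrow> k s \<in> V \<Longrightarrow>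
       \<exists>w. ((\<lambda>r. d (k r)) has_vector_derivative w) (at s within {0..1}) \<and> cnorm (V, d) (k s) w \<le> l"
    using leaf_arc_curve[OF arc] by metis
  have "k s \<in> V \<and> dist (d (k s)) (d (k 0)) \<le> (K * l) * s" if "s \<in> {0..1}" for s
  proof (rule curve_stays_in_chart_ball[OF a k(1)])
    show "k 0 \<in> V" "dist (d (k 0)) y0 + K * l < \<rho>" "0 \<le> K * l" using k(2) x K l by auto
    fix s :: real assume s: "s \<in> {0..1}" "k s \<in> V" "dist (d (k s)) y0 < \<rho>"
    obtain w where w: "((\<lambda>r. d (k r)) has_vector_derivative w) (at s within {0..1})" "cnorm (V, d) (k s) w \<le> l"
      using der[OF s(1) a(1) s(2)] by blast
    have "norm w \<le> K * cnorm (V, d) (k s) w" using K(2)[OF s(2)] s(3) by (simp add: dist_commute)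
    also have "\<dots> \<le> K * l" using w(2) K(1) by simp
    finally show "\<exists>u. ((\<lambda>r. d (k r)) has_vector_derivative u) (at s within {0..1}) \<and> norm u \<le> K * l"
      using w(1) by blast
  qed (use that in simp)
  moreover have "(K * l) * s \<le> K * l" if "s \<in> {0..1}" for s
    using that K l by (simp add: mult_left_le)
  ultimately have "k s \<in> V \<and> dist (d (k s)) (d x) \<le> K * l" if "s \<in> {0..1}" for s
    using that k(2) by (meson order_trans)
  then show thesis using that[OF k(1-4)] by blast
qed

text \<open>Leafwise closeness implies closeness in coordinates, with a locally uniform constant. The chain
  of arcs cannot leave the ball by the mean value inequality.\<close>

lemma reach_ball:
  assumes a: "(V, d) \<in> A" "ball y0 \<rho> \<subseteq> d ` V"
    and K: "K > 0" "\<And>y u. y \<in> V \<Longrightarrow> d y \<in> ball y0 \<rho> \<Longrightarrow> norm u \<le> K * cnorm (V, d) y u"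
    and "reach l x y" "x \<in> V" "dist (d x) y0 + K * l < \<rho>"
  shows "y \<in> V \<and> dist (d y) (d x) \<le> K * l"
  using assms(5-)
proof (induction rule: reach.induct)
  case (reach_refl x l)
  then show ?case using K by simp
next
  case (reach_step l x y m z n)
  have m: "0 \<le> m" using leaf_arc_nonneg[OF reach_step(2)] .
  have ln: "K * l + K * m \<le> K * n" using reach_step(3) K(1) by (metis distrib_left mult_le_cancel_left_pos)
  have Km: "0 \<le> K * m" using K m by simp
  have y: "y \<in> V" "dist (d y) (d x) \<le> K * l"
    using reach_step.IH reach_step.prems ln Km by auto
  have "dist (d y) y0 + K * m < \<rho>"
    using y(2) ln reach_step.prems(2) dist_triangle[of "d y" y0 "d x"] by linarith
  then obtain k where "k (1::real) = z" "\<And>s. s \<in> {0..1} \<Longrightarrow> k s \<in> V \<and> dist (d (k s)) (d y) \<le> K * m"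
    using arc_ball[OF a K reach_step(2) y(1)] by metis
  then have "z \<in> V" "dist (d z) (d y) \<le> K * m" by force+
  then show ?case using y ln dist_triangle[of "d z" "d x" "d y"] by linarith
qed

text \<open>A chain of arcs that stays in the domain \<open>W\<close> of a foliated chart is a path in the
  intersection of \<open>W\<close> with one leaf, so it ends in the plaque where it starts.\<close>

lemma reach_plaque:
  assumes a: "(V, d) \<in> A" "ball y0 \<rho> \<subseteq> d ` (V \<inter> W)" and W: "foliated_at W \<psi> P"
    and K: "K > 0" "\<And>y u. y \<in> V \<Longrightarrow> d y \<in> ball y0 \<rho> \<Longrightarrow> norm u \<le> K * cnorm (V, d) y u"
    and "reach l x y" "x \<in> V" "dist (d x) y0 + K * l < \<rho>"
  shows "y \<in> plaque (W, \<psi>) P x"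
proof -
  have sp: "subspace P" using W by (simp add: foliated_at_def foliated_chart_def)
  have aV: "ball y0 \<rho> \<subseteq> d ` V" using a by blast
  have inW: "y \<in> W" if "y \<in> V" "dist (d y) y0 < \<rho>" for y
  proof -
    have "d y \<in> d ` (V \<inter> W)" using that a(2) by (auto simp: dist_commute)
    then show ?thesis using that(1) is_chart_inj[OF chart[OF a(1)]] by (auto simp: inj_on_def)
  qed
  show ?thesis using assms(6-)
  proof (induction rule: reach.induct)
    case (reach_refl x l)
    have "0 \<le> K * l" using K(1) reach_refl(2) by simp
    then have "x \<in> W" using inW reach_refl by force
    then show ?case using sp by (simp add: plaque_def subspace_0)
  next
    case (reach_step l x y m z n)
    have m: "0 \<le> m" using leaf_arc_nonneg[OF reach_step(2)] .
    have ln: "K * l + K * m \<le> K * n" using reach_step(3) K(1) by (metis distrib_left mult_le_cancel_left_pos)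
    have Km: "0 \<le> K * m" using K m by simp
    have pr: "dist (d x) y0 + K * l < \<rho>" using reach_step.prems(2) ln Km by linarith
    have y: "y \<in> V" "dist (d y) (d x) \<le> K * l"
      using reach_ball[OF a(1) aV K reach_step(1) reach_step.prems(1) pr] by auto
    have yp: "y \<in> plaque (W, \<psi>) P x" using reach_step.IH[OF reach_step.prems(1) pr] .
    have yb: "dist (d y) y0 + K * m < \<rho>"
      using y(2) ln reach_step.prems(2) dist_triangle[of "d y" y0 "d x"] by linarith
    obtain k :: "real \<Rightarrow> 'a"
      where k: "continuous_map (top_of_set {0..1}) X k" "k 0 = y" "k 1 = z"
      "\<And>s L. s \<in> {0..1} \<Longrightarrow> L \<in> F \<Longrightarrow> y \<in> L \<Longrightarrow> k s \<in> L"
      "\<And>s. s \<in> {0..1} \<Longrightarrow> k s \<in> V \<and> dist (d (k s)) (d y) \<le> K * m"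
      using arc_ball[OF a(1) aV K reach_step(2) y(1) yb] by metis
    have kW: "k s \<in> W" if "s \<in> {0..1}" for s
      using k(5)[OF that] inW[of "k s"] yb dist_triangle[of "d (k s)" y0 "d y"] by linarith
    obtain L where L: "L \<in> F" "y \<in> L" using leaf_at reach_topspace[OF reach_step(1)] by blast
    have "path_component_of (subtopology X (L \<inter> W)) (k 0) (k 1)"
      by (rule path_componentI[OF k(1)]) (use kW k(4) L in auto)
    then have "z \<in> plaque (W, \<psi>) P y"
      using foliated_plaque_eq[OF W _ L(2,1)] kW[of 0] k(2,3) by simp
    then show ?case using plaque_eq[OF sp yp] by simp
  qed
qed

end


section \<open>Moving along leaves in a prescribed direction\<close>

context foliated_mfd
begin

text \<open>Within a plaque of a foliated chart, closeness in the topology of the manifold implies leafwise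
  closeness. For \<open>y\<close> near \<open>z\<close> the segment from \<open>y\<close> to \<open>z\<close> in the foliated chart is a short path
  in the leaf that stays in the domain of a slice chart at \<open>z\<close>, so \<open>y\<close> lies in the slice of
  \<open>z\<close>; there \<open>y\<close> and \<open>z\<close> are joined by a straight segment, whose length is controlled.\<close>

lemma plaque_local:
  assumes W: "foliated_at W \<psi> P" and z: "z \<in> W" and \<epsilon>: "\<epsilon> > 0"
  obtains Q where "openin X Q" "z \<in> Q" "\<And>y. y \<in> Q \<Longrightarrow> y \<in> plaque (W, \<psi>) P z \<Longrightarrow> reach \<epsilon> y z"
proof -
  have chW: "is_chart X (W, \<psi>)" and sp: "subspace P"
    using W by (simp_all add: foliated_at_def foliated_chart_def)
  have zX: "z \<in> topspace X" using z is_chart_subset[OF chW] by blast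
  obtain U c P' where sl: "leaf_slice X A p F z (U, c) P'" using slice_at[OF zX] .
  have a: "(U, c) \<in> A" "z \<in> U" "subspace P'" using sl leaf_slice_iff by blast+
  obtain L where L: "L \<in> F" "z \<in> L" using leaf_at[OF zX] .
  have "open (c ` U)" using is_chart_open_image chart[OF a(1)] by blast
  then obtain r where r: "r > 0" "cball (c z) r \<subseteq> c ` U"
    using a(2) open_contains_cball[of "c ` U"] by blast
  obtain M where M: "M > 0" "\<And>x u. x \<in> U \<Longrightarrow> c x \<in> cball (c z) r \<Longrightarrow>
      norm u \<le> M * cnorm (U, c) x u \<and> cnorm (U, c) x u \<le> M * norm u"
    using cnorm_bounds[OF a(1) compact_cball r(2)] by blast
  define r' where "r' = min r (\<epsilon> / M)"
  have r': "r' > 0" "r' \<le> r" "M * r' \<le> \<epsilon>"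
    using r M \<epsilon> by (auto simp: r'_def min_def field_simps)
  have "open (\<psi> ` (W \<inter> U))"
    by (rule overlap_open[OF chW chart[OF a(1)]])
  then obtain \<beta> where \<beta>: "\<beta> > 0" "ball (\<psi> z) \<beta> \<subseteq> \<psi> ` (W \<inter> U)"
    using z a(2) open_contains_ball[of "\<psi> ` (W \<inter> U)"] by blast
  define Q where "Q = {y\<in>W. \<psi> y \<in> ball (\<psi> z) \<beta>} \<inter> {y\<in>U. c y \<in> ball (c z) r'}"
  have "openin X Q"
    unfolding Q_def using is_chart_openin_preimage[OF chW, of "ball (\<psi> z) \<beta>"]
      is_chart_openin_preimage[OF chart[OF a(1)], of "ball (c z) r'"] by blast
  moreover have "z \<in> Q" using z a r' \<beta> by (simp add: Q_def)
  moreover have "reach \<epsilon> y z" if yQ: "y \<in> Q" and yp: "y \<in> plaque (W, \<psi>) P z" for y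
  proof -
    have y: "y \<in> W" "y \<in> U" "\<psi> y \<in> ball (\<psi> z) \<beta>" "c y \<in> ball (c z) r'"
      using yQ by (auto simp: Q_def)
    define k where "k s = inv_into W \<psi> (\<psi> y + s *\<^sub>R (\<psi> z - \<psi> y))" for s :: real
    have seg: "\<psi> y + s *\<^sub>R (\<psi> z - \<psi> y) \<in> ball (\<psi> z) \<beta>" if "s \<in> {0..1}" for s
    proof -
      have "(1 - s) *\<^sub>R \<psi> y + s *\<^sub>R \<psi> z \<in> ball (\<psi> z) \<beta>"
        by (rule convexD[OF convex_ball y(3)]) (use that \<beta>(1) in auto)
      then show ?thesis by (simp add: algebra_simps)
    qed
    have img: "\<exists>w\<in>W \<inter> U. \<psi> w = \<psi> y + s *\<^sub>R (\<psi> z - \<psi> y)" if "s \<in> {0..1}" for s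
    proof -
      have "\<psi> y + s *\<^sub>R (\<psi> z - \<psi> y) \<in> \<psi> ` (W \<inter> U)" using seg[OF that] \<beta>(2) by blast
      then show ?thesis by (metis image_iff)
    qed
    have k: "k s \<in> W \<inter> U" "\<psi> (k s) = \<psi> y + s *\<^sub>R (\<psi> z - \<psi> y)" if s: "s \<in> {0..1}" for s
    proof -
      obtain w where w: "w \<in> W \<inter> U" "\<psi> w = \<psi> y + s *\<^sub>R (\<psi> z - \<psi> y)" using img[OF s] by blast
      have "k s = w" unfolding k_def w(2)[symmetric] using w(1) is_chart_inj[OF chW] by simp
      then show "k s \<in> W \<inter> U" "\<psi> (k s) = \<psi> y + s *\<^sub>R (\<psi> z - \<psi> y)" using w by auto
    qed
    have "continuous_map (top_of_set {0..1}) (top_of_set (\<psi> ` W)) (\<lambda>s. \<psi> y + s *\<^sub>R (\<psi> z - \<psi> y))"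
      using seg \<beta>(2) by (force simp: continuous_map_in_subtopology intro!: continuous_intros)
    then have "continuous_map (top_of_set {0..1}) X (inv_into W \<psi> \<circ> (\<lambda>s. \<psi> y + s *\<^sub>R (\<psi> z - \<psi> y)))"
      using is_chart_inv_cont[OF chW] continuous_map_compose by blast
    then have kc: "continuous_map (top_of_set {0..1}) X k" by (simp add: k_def[abs_def] o_def)
    have yz: "\<psi> y - \<psi> z \<in> P" using yp by (simp add: plaque_def)
    have kp: "k s \<in> plaque (W, \<psi>) P z" if "s \<in> {0..1}" for s
    proof -
      have "\<psi> (k s) - \<psi> z = (1 - s) *\<^sub>R (\<psi> y - \<psi> z)"
        using k(2)[OF that] by (simp add: algebra_simps)
      then show ?thesis using k(1)[OF that] subspace_scale[OF sp yz] by (simp add: plaque_def)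
    qed
    have kL: "k s \<in> L" if "s \<in> {0..1}" for s
    proof -
      have "path_component_of (subtopology X (L \<inter> W)) z (k s)"
        using kp[OF that] foliated_plaque_eq[OF W z L(2,1)] by blast
      then show ?thesis using path_component_in_topspace[of "subtopology X (L \<inter> W)" z "k s"] by simp
    qed
    have k01: "k 0 = y" "k 1 = z" using is_chart_inj[OF chW] y(1) z by (simp_all add: k_def)
    have "path_component_of (subtopology X (L \<inter> U)) (k 0) (k 1)"
      by (rule path_componentI[OF kc]) (use kL k(1) in auto)
    then have "path_component_of (subtopology X (L \<inter> U)) z y"
      using k01 path_component_of_sym by metis
    then have yP': "y \<in> plaque (U, c) P' z" using slice_plaque_eq[OF sl L] by blast
    have sly: "leaf_slice X A p F y (U, c) P'" by (rule slice_move[OF sl yP'])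
    have u: "c z - c y \<in> P'" using yP' subspace_neg[OF a(3), of "c y - c z"] by (simp add: plaque_def)
    have "leaf_arc \<epsilon> y z"
      unfolding leaf_arc_def
    proof (intro exI conjI ballI)
      show "leaf_slice X A p F y (U, c) P'" by (rule sly)
      show "c z - c y \<in> P'" by (rule u)
      show "z = inv_into U c (c y + (c z - c y))" using a by simp
      fix s :: real assume s: "s \<in> {0..1}"
      have "(1 - s) *\<^sub>R c y + s *\<^sub>R c z \<in> ball (c z) r'"
        by (rule convexD[OF convex_ball y(4)]) (use s r' in auto)
      then have b: "c y + s *\<^sub>R (c z - c y) \<in> ball (c z) r'" by (simp add: algebra_simps)
      then have b': "c y + s *\<^sub>R (c z - c y) \<in> cball (c z) r" using r' by auto
      then show "c y + s *\<^sub>R (c z - c y) \<in> c ` U" using r(2) by blast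
      then have "cnorm (U, c) (inv_into U c (c y + s *\<^sub>R (c z - c y))) (c z - c y) \<le> M * norm (c z - c y)"
        using M(2)[OF inv_into_into, of "c y + s *\<^sub>R (c z - c y)"] b' by (simp add: f_inv_into_f)
      also have "\<dots> \<le> M * r'" using y(4) M(1) by (simp add: dist_norm)
      finally show "cnorm (U, c) (inv_into U c (c y + s *\<^sub>R (c z - c y))) (c z - c y) \<le> \<epsilon>"
        using r' by linarith
    qed
    moreover have "reach 0 y y" using reach_refl is_chart_subset[OF chW] y(1) by blast
    ultimately show ?thesis using reach_step by fastforce
  qed
  ultimately show thesis using that by blast
qed

text \<open>The leaves have positive dimension, so one of the continuous fields spanning the tangent bundle
  is not zero at \<open>x0\<close>.\<close>

lemma leaf_direction:
  assumes "x0 \<in> topspace X"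
  obtains V d e where "(V, d) \<in> A" "x0 \<in> V" "continuous_map (subtopology X V) euclidean e"
    "e x0 \<noteq> (0::'e)" "\<And>y. y \<in> V \<Longrightarrow> \<exists>v\<in>leaf_tangent_space X A p F y. v (V, d) = e y"
proof -
  obtain V d es where V: "(V, d) \<in> A" "x0 \<in> V"
    and es: "\<And>i. i < p \<Longrightarrow> continuous_map (subtopology X V) euclidean (es i :: 'a \<Rightarrow> 'e)"
    and sp: "\<And>y. y \<in> V \<Longrightarrow> (\<lambda>v. v (V, d)) ` leaf_tangent_space X A p F y = span ((\<lambda>i. es i y) ` {..<p})"
  proof -
    have "\<exists>(U, c)\<in>A. x0 \<in> U \<and> (\<exists>e :: nat \<Rightarrow> 'a \<Rightarrow> 'e.
        (\<forall>i<p. continuous_map (subtopology X U) euclidean (e i)) \<and>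
        (\<forall>y\<in>U. (\<lambda>v. v (U, c)) ` leaf_tangent_space X A p F y = span ((\<lambda>i. e i y) ` {..<p})))"
      using tangent_cont assms unfolding continuous_tangent_bundle_def by blast
    then show thesis using that by blast
  qed
  obtain U c P where sl: "leaf_slice X A p F x0 (U, c) P" using slice_at[OF assms] .
  have a: "(U, c) \<in> A" "x0 \<in> U" "subspace P" "dim P = p" using sl leaf_slice_iff by blast+
  have "\<not> P \<subseteq> {0}" using a(4) dim_pos dim_eq_0[of P] by linarith
  then obtain u where u: "u \<in> P" "u \<noteq> 0" by blast
  define v where "v = coord_vector A (U, c) x0 u"
  have vt: "v \<in> leaf_tangent_space X A p F x0"
  proof -
    have "v (U, c) \<in> P" using coord_vector_self[OF a(1,2), of u] u(1) by (simp add: v_def)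
    then show ?thesis
      using coord_vector_tangent[OF a(1,2), of u] sl unfolding leaf_tangent_space_def v_def by blast
  qed
  have vV: "v (V, d) = trans_deriv (U, c) (V, d) x0 u" using V by (simp add: v_def coord_vector_apply)
  have "v (V, d) \<noteq> 0"
  proof
    assume "v (V, d) = 0"
    then have "trans_deriv (V, d) (U, c) x0 0 = u"
      using trans_cocycle[OF a(1) V(1) a(1) a(2) V(2) a(2), of u] trans_id[OF a(1,2)] vV by simp
    then show False using linear_0[OF trans_linear[OF V(1) a(1) V(2) a(2)]] u(2) by simp
  qed
  moreover have "v (V, d) \<in> span ((\<lambda>i. es i x0) ` {..<p})" using sp[OF V(2)] vt by blast
  ultimately have "\<not> (\<lambda>i. es i x0) ` {..<p} \<subseteq> {0}" by (metis insertE empty_iff span_empty span_insert_0 span_mono subsetD)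
  then obtain i where i: "i < p" "es i x0 \<noteq> 0" by blast
  have "\<exists>v\<in>leaf_tangent_space X A p F y. v (V, d) = es i y" if "y \<in> V" for y
  proof -
    have "es i y \<in> span ((\<lambda>i. es i y) ` {..<p})" using i(1) by (intro span_base) auto
    then show ?thesis using sp[OF that] by (metis (no_types, lifting) imageE)
  qed
  then show thesis using that[OF V es[OF i(1)] i(2)] by blast
qed

text \<open>Infinitesimal form of the next lemma: along a straight segment in direction \<open>v\<close> the height
  \<open>h \<bullet> d\<close> grows at rate \<open>h \<bullet> v (V, d)\<close> and the length at rate \<open>cnorm (V, d) y (v (V, d))\<close>.\<close>

lemma leaf_step:
  assumes V: "(V, d) \<in> A" "y \<in> V" and v: "v \<in> leaf_tangent_space X A p F y"
    and \<kappa>: "\<kappa> > 0" "\<kappa> * cnorm (V, d) y (v (V, d)) < h \<bullet> v (V, d)" and \<delta>: "\<delta> > 0"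
  obtains z l where "reach l y z" "z \<in> V" "\<kappa> * l \<le> h \<bullet> (d z - d y)" "0 < h \<bullet> (d z - d y)"
    "h \<bullet> (d z - d y) \<le> \<delta>"
proof -
  obtain U c P where sl: "leaf_slice X A p F y (U, c) P" and u: "v (U, c) \<in> P" and vt: "v \<in> tangent_space A y"
  proof -
    have vt: "v \<in> tangent_space A y" using v unfolding leaf_tangent_space_def by blast
    obtain a P where aP: "leaf_slice X A p F y a P" "v a \<in> P"
      using v unfolding leaf_tangent_space_def by blast
    obtain U c where "a = (U, c)" by (cases a)
    then show thesis using that aP vt by blast
  qed
  have a: "(U, c) \<in> A" "y \<in> U" "subspace P" using sl leaf_slice_iff by blast+
  define u where "u = v (U, c)"
  define w where "w = v (V, d)"
  have w: "w = trans_deriv (U, c) (V, d) y u"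
    using tangent_eq_coord[OF a(1,2) vt] V by (metis coord_vector_apply fst_conv u_def w_def)
  have nw: "cnorm (U, c) y u = cnorm (V, d) y w"
    using cnorm_change[OF a(1) V(1) a(2) V(2)] w by simp
  have "cnorm (V, d) y w < (h \<bullet> w) / \<kappa>" using \<kappa> by (simp add: w_def field_simps)
  then obtain M where M: "cnorm (U, c) y u < M" "M < (h \<bullet> w) / \<kappa>" using dense nw by metis
  have Mpos: "M > 0" using cnorm_nonneg[OF a(1,2), of u] M(1) by linarith
  define k where "k s = inv_into U c (c y + s *\<^sub>R u)" for s :: real
  have k0: "k 0 = y" using a by (simp add: k_def)
  have opU: "open (c ` U)" using is_chart_open_image chart[OF a(1)] by blast
  have opUV: "open (c ` (U \<inter> V))" by (rule overlap_open[OF chart[OF a(1)] chart[OF V(1)]])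
  have lim: "((\<lambda>s. c y + s *\<^sub>R u) \<longlongrightarrow> c y) (at (0::real))"
    by (auto intro!: tendsto_eq_intros)
  have evUV: "\<forall>\<^sub>F s in at 0. c y + s *\<^sub>R u \<in> c ` (U \<inter> V)"
    by (rule topological_tendstoD[OF lim opUV]) (use a V in auto)
  have kUV: "\<forall>\<^sub>F s in at 0. k s \<in> U \<and> k s \<in> V \<and> c (k s) = c y + s *\<^sub>R u"
    using evUV
  proof eventually_elim
    case (elim s)
    then obtain x where x: "x \<in> U" "x \<in> V" "c y + s *\<^sub>R u = c x" by auto
    then show ?case using a(1) by (simp add: k_def)
  qed
  have "((\<lambda>s. c y + s *\<^sub>R u) has_vector_derivative u) (at 0)"
    by (auto intro!: derivative_eq_intros)
  then have derc: "((\<lambda>s. c (k s)) has_vector_derivative u) (at 0)"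
    unfolding has_vector_derivative_def
    by (rule has_derivative_transform_eventually)
      (use kUV k0 in \<open>auto elim: eventually_mono\<close>)
  have "((\<lambda>s. d (k s)) has_vector_derivative trans_deriv (U, c) (V, d) (k 0) u) (at 0)"
    by (rule curve_change[OF a(1) V(1)])
      (use k0 a V derc kUV in \<open>auto elim: eventually_mono\<close>)
  then have derd: "((\<lambda>s. d (k s)) has_vector_derivative w) (at 0)" using w k0 by simp
  define f where "f s = h \<bullet> (d (k s) - d y)" for s
  have f0: "f 0 = 0" by (simp add: f_def k0)
  have derf: "(f has_real_derivative h \<bullet> w) (at 0)"
  proof -
    have "((\<lambda>s. h \<bullet> (d (k s) - d y)) has_derivative (\<lambda>x. h \<bullet> (x *\<^sub>R w - 0))) (at 0)"
      by (intro has_derivative_inner_right has_derivative_diff has_derivative_const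
          derd[unfolded has_vector_derivative_def])
    moreover have "(\<lambda>x. h \<bullet> (x *\<^sub>R w - 0)) = (*) (h \<bullet> w)"
      by (simp add: fun_eq_iff)
    ultimately show ?thesis
      unfolding has_field_derivative_def f_def[abs_def] by simp
  qed
  have "((\<lambda>s. f s / s) \<longlongrightarrow> h \<bullet> w) (at 0)"
    using derf unfolding DERIV_def by (simp add: f0)
  moreover have "\<kappa> * M < h \<bullet> w" using M(2) \<kappa>(1) by (simp add: field_simps)
  ultimately have e1: "\<forall>\<^sub>F s in at 0. \<kappa> * M < f s / s" by (rule order_tendstoD)
  have "(f \<longlongrightarrow> f 0) (at 0)" using DERIV_isCont[OF derf] by (simp add: isCont_def)
  then have e2: "\<forall>\<^sub>F s in at 0. f s < \<delta>" using order_tendstoD(2) \<delta> f0 by metis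
  have e3: "\<forall>\<^sub>F s in at 0. cnorm (U, c) (k s) u < M"
  proof -
    have "isCont (\<lambda>q. cnorm (U, c) (inv_into U c q) u) (c y)"
      using cnorm_continuous[OF a(1)] opU a(2) by (simp add: continuous_on_eq_continuous_at)
    then have "((\<lambda>s. cnorm (U, c) (k s) u) \<longlongrightarrow> cnorm (U, c) (inv_into U c (c y)) u) (at 0)"
      unfolding k_def by (rule isCont_tendsto_compose[OF _ lim])
    then show ?thesis using order_tendstoD(2) M(1) a by fastforce
  qed
  have "\<forall>\<^sub>F s in at_right 0. \<kappa> * M < f s / s \<and> f s < \<delta> \<and> cnorm (U, c) (k s) u < M \<and>
      c y + s *\<^sub>R u \<in> c ` (U \<inter> V)"
    using e1 e2 e3 evUV at_le[of "{0<..}" UNIV "0::real"]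
    by (intro eventually_conj) (blast intro: filter_leD)+
  then obtain b where b: "b > 0" "\<And>s. 0 < s \<Longrightarrow> s < b \<Longrightarrow> \<kappa> * M < f s / s \<and> f s < \<delta> \<and>
      cnorm (U, c) (k s) u < M \<and> c y + s *\<^sub>R u \<in> c ` (U \<inter> V)"
    unfolding eventually_at_right_field by blast
  define s where "s = b / 2"
  have s: "0 < s" "s < b" using b(1) by (auto simp: s_def)
  note bs = b(2)[OF s]
  have fs: "\<kappa> * (s * M) < f s" using bs s(1) by (simp add: field_simps)
  have "leaf_arc (s * M) y (k s)"
    unfolding leaf_arc_def
  proof (intro exI conjI ballI)
    show "leaf_slice X A p F y (U, c) P" by (rule sl)
    show "s *\<^sub>R u \<in> P" using subspace_scale[OF a(3)] \<open>v (U, c) \<in> P\<close> by (simp add: u_def)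
    show "k s = inv_into U c (c y + s *\<^sub>R u)" by (simp add: k_def)
    fix r :: real assume r: "r \<in> {0..1}"
    have rs: "c y + (r * s) *\<^sub>R u \<in> c ` U \<and> cnorm (U, c) (k (r * s)) u \<le> M"
    proof (cases "r = 0")
      case True
      then show ?thesis using a(2) M(1) k0 by simp
    next
      case False
      then have "0 < r * s" using r s by simp
      moreover have "r * s \<le> s" using r s(1) by (simp add: mult_left_le_one_le)
      ultimately show ?thesis using b(2)[of "r * s"] s(2) by auto
    qed
    then show "c y + r *\<^sub>R s *\<^sub>R u \<in> c ` U" by simp
    have "k (r * s) \<in> U" unfolding k_def by (rule inv_into_into) (use rs in blast)
    then have "cnorm (U, c) (k (r * s)) (s *\<^sub>R u) \<le> s * M"
      using cnorm_scale[OF a(1), of "k (r * s)" s u] rs s(1) by simp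
    then show "cnorm (U, c) (inv_into U c (c y + r *\<^sub>R s *\<^sub>R u)) (s *\<^sub>R u) \<le> s * M"
      by (simp add: k_def)
  qed
  moreover have "reach 0 y y" using reach_refl is_chart_subset[OF chart[OF a(1)]] a(2) by blast
  ultimately have "reach (s * M) y (k s)" using reach_step by fastforce
  moreover have "k s \<in> V"
  proof -
    obtain x where x: "x \<in> U" "x \<in> V" "c y + s *\<^sub>R u = c x" using bs by auto
    then show ?thesis using a(1) by (simp add: k_def)
  qed
  moreover have "0 < f s"
  proof -
    have "0 \<le> \<kappa> * (s * M)" using \<kappa>(1) Mpos s(1) by simp
    then show ?thesis using fs by linarith
  qed
  ultimately show thesis using that[of "s * M" "k s"] fs bs unfolding f_def by (simp add: less_imp_le)
qed

text \<open>Integral curves of a merely continuous field tangent to the foliation may leave the leaf, so the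
  point at height \<open>\<sigma>\<close> is not found by integration. Instead the height is maximised over the points
  of height at most \<open>\<sigma>\<close> that can be reached at a cost bounded by their own height. By the lemma on
  plaques this set is compact, and by the lemma on small steps a maximum below \<open>\<sigma>\<close> could be
  improved. The slack \<open>\<epsilon>\<close> in the cost makes the set closed.\<close>

lemma leaf_advance:
  assumes V: "(V, d) \<in> A" "ball y0 \<rho> \<subseteq> d ` (V \<inter> W)" and W: "foliated_at W \<psi> P"
    and K: "K > 0" "\<And>y u. y \<in> V \<Longrightarrow> d y \<in> ball y0 \<rho> \<Longrightarrow> norm u \<le> K * cnorm (V, d) y u"
    and \<kappa>: "\<kappa> > 0" "\<And>y. y \<in> V \<Longrightarrow> d y \<in> ball y0 \<rho> \<Longrightarrow>
      \<exists>v\<in>leaf_tangent_space X A p F y. \<kappa> * cnorm (V, d) y (v (V, d)) < h \<bullet> v (V, d)"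
    and x: "x \<in> V" "dist (d x) y0 + K / \<kappa> * \<sigma> < \<rho>" and \<sigma>: "\<sigma> \<ge> 0"
  obtains z where "z \<in> V" "h \<bullet> (d z - d x) = \<sigma>" "\<And>\<epsilon>. \<epsilon> > 0 \<Longrightarrow> \<exists>l. reach l x z \<and> \<kappa> * l \<le> \<sigma> + \<epsilon>"
proof -
  have chW: "is_chart X (W, \<psi>)" and sp: "subspace P"
    using W by (simp_all add: foliated_at_def foliated_chart_def)
  have aV: "ball y0 \<rho> \<subseteq> d ` V" using V(2) by blast
  have xX: "x \<in> topspace X" using x(1) is_chart_subset[OF chart[OF V(1)]] by blast
  have inW: "y \<in> W" if "y \<in> V" "d y \<in> ball y0 \<rho>" for y
  proof -
    have "d y \<in> d ` (V \<inter> W)" using that V(2) by blast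
    then show ?thesis using that(1) is_chart_inj[OF chart[OF V(1)]] by (auto simp: inj_on_def)
  qed
  define f where "f z = h \<bullet> (d z - d x)" for z
  define R where "R = K / \<kappa> * \<sigma>"
  have R: "R \<ge> 0" "dist (d x) y0 + R < \<rho>" using K(1) \<kappa>(1) \<sigma> x(2) by (auto simp: R_def)
  have cb: "cball (d x) R \<subseteq> ball y0 \<rho>"
  proof
    fix q assume "q \<in> cball (d x) R"
    then show "q \<in> ball y0 \<rho>"
      using R(2) dist_triangle[of y0 q "d x"] by (simp add: dist_commute)
  qed
  define S where "S = {z\<in>V. d z \<in> cball (d x) R \<and> f z \<le> \<sigma> \<and> z \<in> plaque (W, \<psi>) P x \<and>
    (\<forall>\<epsilon>>0. \<exists>l. reach l x z \<and> \<kappa> * l \<le> f z + \<epsilon>)}"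
  \<comment> \<open>The cost bound forces the two geometric conditions in \<open>S\<close>, which serve compactness.\<close>
  have S_I: "z \<in> S" if r: "\<And>\<epsilon>. \<epsilon> > 0 \<Longrightarrow> \<exists>l. reach l x z \<and> \<kappa> * l \<le> f z + \<epsilon>" and fz: "f z \<le> \<sigma>" for z
  proof -
    have bd: "K * l \<le> R + K / \<kappa> * \<epsilon>" if "\<kappa> * l \<le> f z + \<epsilon>" for l \<epsilon>
    proof -
      have "K * l = K / \<kappa> * (\<kappa> * l)" using \<kappa>(1) by simp
      also have "\<dots> \<le> K / \<kappa> * (\<sigma> + \<epsilon>)"
        using that fz K(1) \<kappa>(1) by (intro mult_left_mono) auto
      finally show ?thesis by (simp add: R_def distrib_left)
    qed
    define \<epsilon>0 where "\<epsilon>0 = (\<rho> - dist (d x) y0 - R) / (2 * (K / \<kappa>))"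
    have \<epsilon>0: "\<epsilon>0 > 0" unfolding \<epsilon>0_def using R(2) K(1) \<kappa>(1) by (intro divide_pos_pos) auto
    have \<epsilon>0': "K / \<kappa> * \<epsilon>0 = (\<rho> - dist (d x) y0 - R) / 2" using K(1) \<kappa>(1) by (simp add: \<epsilon>0_def)
    have close: "dist (d x) y0 + K * l < \<rho>" if "\<kappa> * l \<le> f z + \<epsilon>" "\<epsilon> \<le> \<epsilon>0" for l \<epsilon>
    proof -
      have "K / \<kappa> * \<epsilon> \<le> K / \<kappa> * \<epsilon>0" using that(2) K(1) \<kappa>(1) by (intro mult_left_mono) auto
      then show ?thesis using bd[OF that(1)] \<epsilon>0' R(2) by (simp add: field_simps)
    qed
    obtain l0 where l0: "reach l0 x z" "\<kappa> * l0 \<le> f z + \<epsilon>0" using r[OF \<epsilon>0] by blast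
    have zp: "z \<in> plaque (W, \<psi>) P x"
      using reach_plaque[OF V W K l0(1) x(1) close[OF l0(2) order_refl]] by blast
    have zV: "z \<in> V" using reach_ball[OF V(1) aV K l0(1) x(1) close[OF l0(2) order_refl]] by blast
    have "dist (d z) (d x) \<le> R"
    proof (rule field_le_epsilon)
      fix e :: real assume e: "e > 0"
      define \<epsilon> where "\<epsilon> = min \<epsilon>0 (e / (K / \<kappa>))"
      have \<epsilon>: "\<epsilon> > 0" "\<epsilon> \<le> \<epsilon>0" "K / \<kappa> * \<epsilon> \<le> e"
      proof -
        show "\<epsilon> > 0" "\<epsilon> \<le> \<epsilon>0" using \<epsilon>0 e K(1) \<kappa>(1) by (auto simp: \<epsilon>_def)
        have "K / \<kappa> * \<epsilon> \<le> K / \<kappa> * (e / (K / \<kappa>))"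
          using K(1) \<kappa>(1) by (intro mult_left_mono) (auto simp: \<epsilon>_def)
        then show "K / \<kappa> * \<epsilon> \<le> e" using K(1) \<kappa>(1) by simp
      qed
      obtain l where l: "reach l x z" "\<kappa> * l \<le> f z + \<epsilon>" using r[OF \<epsilon>(1)] by blast
      have "dist (d z) (d x) \<le> K * l"
        using reach_ball[OF V(1) aV K l(1) x(1) close[OF l(2) \<epsilon>(2)]] by blast
      then show "dist (d z) (d x) \<le> R + e" using bd[OF l(2)] \<epsilon>(3) by linarith
    qed
    then show ?thesis using zp zV fz r by (auto simp: S_def dist_commute)
  qed
  have xS: "x \<in> S"
  proof (rule S_I)
    show "f x \<le> \<sigma>" using \<sigma> by (simp add: f_def)
    show "\<exists>l. reach l x x \<and> \<kappa> * l \<le> f x + \<epsilon>" if "\<epsilon> > 0" for \<epsilon>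
      using reach_refl[OF xX, of 0] that by (intro exI[of _ 0]) (simp add: f_def)
  qed
  have "compact (d ` S)"
  proof -
    have "closed (d ` S)"
      unfolding closed_sequential_limits
    proof (intro allI impI, elim conjE)
      fix q q' assume q: "\<forall>n. q n \<in> d ` S" and lim: "q \<longlonglongrightarrow> q'"
      define zn where "zn n = inv_into S d (q n)" for n
      have zn: "zn n \<in> S" "q n = d (zn n)" for n
        using q by (simp_all add: zn_def inv_into_into f_inv_into_f)
      have q'b: "q' \<in> cball (d x) R"
        using closed_sequentially[OF closed_cball _ lim] zn by (auto simp: S_def)
      then obtain z where z: "z \<in> V" "z \<in> W" "q' = d z" using cb V(2) by blast
      have f_lim: "(\<lambda>n. f (zn n)) \<longlonglongrightarrow> f z"
      proof -
        have "(\<lambda>n. h \<bullet> (q n - d x)) \<longlonglongrightarrow> h \<bullet> (q' - d x)" by (intro tendsto_intros lim)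
        then show ?thesis by (simp add: f_def z(3) zn(2))
      qed
      have fz: "f z \<le> \<sigma>"
        by (rule LIMSEQ_le_const2[OF f_lim]) (use zn(1) in \<open>auto simp: S_def\<close>)
      have opVW: "open (d ` (V \<inter> W))" by (rule overlap_open[OF chart[OF V(1)] chW])
      have zinv: "inv_into V d (q n) = zn n" for n using zn V(1) by (auto simp: S_def)
      have plim: "(\<lambda>n. \<psi> (zn n)) \<longlonglongrightarrow> \<psi> z"
      proof -
        have "continuous_map (top_of_set (d ` (V \<inter> W))) X (inv_into V d)"
          by (rule continuous_map_from_subtopology_mono[OF is_chart_inv_cont[OF chart[OF V(1)]]]) auto
        moreover have "inv_into V d ` (d ` (V \<inter> W)) \<subseteq> W" using V(1) by auto
        ultimately have "continuous_map (top_of_set (d ` (V \<inter> W))) (subtopology X W) (inv_into V d)"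
          by (auto simp: continuous_map_in_subtopology)
        then have "continuous_map (top_of_set (d ` (V \<inter> W))) euclidean (\<psi> \<circ> inv_into V d)"
          using is_chart_cont[OF chW] continuous_map_compose by blast
        then have "continuous_on (d ` (V \<inter> W)) (\<psi> \<circ> inv_into V d)" by simp
        then have "isCont (\<psi> \<circ> inv_into V d) q'"
          using opVW z continuous_on_eq_continuous_at[OF opVW, of "\<psi> \<circ> inv_into V d"] by blast
        then have "(\<lambda>n. (\<psi> \<circ> inv_into V d) (q n)) \<longlonglongrightarrow> (\<psi> \<circ> inv_into V d) q'"
          using lim isCont_tendsto_compose by blast
        then show ?thesis using zinv z V(1) by simp
      qed
      have "\<psi> z - \<psi> x \<in> P"
        by (rule closed_sequentially[OF closed_subspace[OF sp], of "\<lambda>n. \<psi> (zn n) - \<psi> x"])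
          (use zn plim in \<open>auto simp: S_def plaque_def intro!: tendsto_intros\<close>)
      then have zp: "z \<in> plaque (W, \<psi>) P x" using z by (simp add: plaque_def)
      have "z \<in> S"
      proof (rule S_I[OF _ fz])
        fix \<epsilon> :: real assume \<epsilon>: "\<epsilon> > 0"
        define \<epsilon>' where "\<epsilon>' = \<epsilon> / (3 * \<kappa>)"
        have \<epsilon>': "\<epsilon>' > 0" "\<kappa> * \<epsilon>' = \<epsilon> / 3" using \<epsilon> \<kappa>(1) by (auto simp: \<epsilon>'_def)
        obtain Q where Q: "openin X Q" "z \<in> Q"
          "\<And>y. y \<in> Q \<Longrightarrow> y \<in> plaque (W, \<psi>) P z \<Longrightarrow> reach \<epsilon>' y z"
          using plaque_local[OF W z(2) \<epsilon>'(1)] by blast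
        have "open (d ` (V \<inter> Q))"
          by (rule is_chart_open_image_subset[OF chart[OF V(1)]])
            (use Q(1) is_chart_openin[OF chart[OF V(1)]] in auto)
        moreover have "q' \<in> d ` (V \<inter> Q)" using z Q(2) by blast
        ultimately have "\<forall>\<^sub>F n in sequentially. q n \<in> d ` (V \<inter> Q)"
          by (rule topological_tendstoD[OF lim])
        moreover have "\<forall>\<^sub>F n in sequentially. f (zn n) < f z + \<epsilon> / 3"
          using order_tendstoD(2)[OF f_lim] \<epsilon> by simp
        ultimately have "\<forall>\<^sub>F n in sequentially. q n \<in> d ` (V \<inter> Q) \<and> f (zn n) < f z + \<epsilon> / 3"
          by (rule eventually_conj)
        then obtain n where n: "q n \<in> d ` (V \<inter> Q)" "f (zn n) < f z + \<epsilon> / 3"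
          using eventually_happens'[OF sequentially_bot] by blast
        have "zn n \<in> Q" using n(1) zinv[of n] V(1) by auto
        moreover have "zn n \<in> plaque (W, \<psi>) P z"
        proof -
          have "zn n \<in> plaque (W, \<psi>) P x" using zn(1)[of n] by (simp add: S_def)
          then show ?thesis using plaque_eq[OF sp zp] by simp
        qed
        ultimately have r1: "reach \<epsilon>' (zn n) z" using Q(3) by blast
        obtain l where l: "reach l x (zn n)" "\<kappa> * l \<le> f (zn n) + \<epsilon> / 3"
        proof -
          have "\<forall>\<epsilon>>0. \<exists>l. reach l x (zn n) \<and> \<kappa> * l \<le> f (zn n) + \<epsilon>"
            using zn(1)[of n] by (simp add: S_def)
          moreover have "\<epsilon> / 3 > 0" using \<epsilon> by simp
          ultimately show thesis using that by blast
        qed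
        have "reach (l + \<epsilon>') x z" by (rule reach_trans[OF r1 l(1)])
        moreover have "\<kappa> * (l + \<epsilon>') \<le> f z + \<epsilon>" using l(2) n(2) \<epsilon>'(2) by (simp add: distrib_left)
        ultimately show "\<exists>l. reach l x z \<and> \<kappa> * l \<le> f z + \<epsilon>" by blast
      qed
      then show "q' \<in> d ` S" using z(3) by blast
    qed
    moreover have "bounded (d ` S)"
      by (rule bounded_subset[OF bounded_cball[of "d x" R]]) (auto simp: S_def)
    ultimately show ?thesis by (simp add: compact_eq_bounded_closed)
  qed
  moreover have "d ` S \<noteq> {}" using xS by blast
  moreover have "continuous_on (d ` S) (\<lambda>q. h \<bullet> (q - d x))" by (intro continuous_intros)
  ultimately have "\<exists>qm\<in>d ` S. \<forall>q\<in>d ` S. h \<bullet> (q - d x) \<le> h \<bullet> (qm - d x)"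
    by (rule continuous_attains_sup)
  then have "\<exists>z\<in>S. \<forall>y\<in>S. f y \<le> f z" by (simp add: f_def)
  then obtain z where z: "z \<in> S" and zmax: "\<And>y. y \<in> S \<Longrightarrow> f y \<le> f z" by blast
  have zV: "z \<in> V" "d z \<in> ball y0 \<rho>" "f z \<le> \<sigma>" using z cb by (auto simp: S_def)
  have zr: "\<exists>l. reach l x z \<and> \<kappa> * l \<le> f z + \<epsilon>" if "\<epsilon> > 0" for \<epsilon>
    using z that unfolding S_def by blast
  have "f z = \<sigma>"
  proof (rule ccontr)
    assume "f z \<noteq> \<sigma>"
    then have \<delta>: "\<sigma> - f z > 0" using zV(3) by simp
    obtain v where v: "v \<in> leaf_tangent_space X A p F z" "\<kappa> * cnorm (V, d) z (v (V, d)) < h \<bullet> v (V, d)"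
      using \<kappa>(2)[OF zV(1,2)] by blast
    obtain y l where y: "reach l z y" "y \<in> V" "\<kappa> * l \<le> h \<bullet> (d y - d z)" "0 < h \<bullet> (d y - d z)"
      "h \<bullet> (d y - d z) \<le> \<sigma> - f z"
      using leaf_step[OF V(1) zV(1) v(1) \<kappa>(1) v(2) \<delta>] .
    have fy: "f y = f z + h \<bullet> (d y - d z)" by (simp add: f_def inner_diff_right)
    have "y \<in> S"
    proof (rule S_I)
      show "f y \<le> \<sigma>" using fy y(5) by simp
      fix \<epsilon> :: real assume "\<epsilon> > 0"
      then obtain l' where l': "reach l' x z" "\<kappa> * l' \<le> f z + \<epsilon>" using zr by blast
      have "reach (l' + l) x y" by (rule reach_trans[OF y(1) l'(1)])
      moreover have "\<kappa> * (l' + l) \<le> f y + \<epsilon>" using l'(2) y(3) fy by (simp add: distrib_left)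
      ultimately show "\<exists>l. reach l x y \<and> \<kappa> * l \<le> f y + \<epsilon>" by blast
    qed
    then show False using zmax[of y] fy y(4) by simp
  qed
  then have "h \<bullet> (d z - d x) = \<sigma>" by (simp add: f_def)
  moreover have "\<exists>l. reach l x z \<and> \<kappa> * l \<le> \<sigma> + \<epsilon>" if "\<epsilon> > 0" for \<epsilon>
    using zr[OF that] \<open>f z = \<sigma>\<close> by simp
  ultimately show thesis by (rule that[OF zV(1)])
qed

end


section \<open>Smooth actions\<close>

locale smooth_action_mfd = smooth_mfd X A
  for X :: "'a topology" and A :: "('a, 'e::euclidean_space) chart set" +
  fixes T :: "real set" and \<phi> :: "real \<Rightarrow> 'a \<Rightarrow> 'a"
  assumes action: "smooth_action X A T \<phi>"
begin

lemma T_cases: "T = UNIV \<and> smooth_flow X A \<phi> \<or> T = \<int> \<and> smooth_int_action X A \<phi>"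
  using action by (simp add: smooth_action_def)

lemma T_closed:
  shows "0 \<in> T" and "s \<in> T \<Longrightarrow> t \<in> T \<Longrightarrow> s + t \<in> T" and "t \<in> T \<Longrightarrow> - t \<in> T"
    and "real n \<in> T"
  using T_cases by auto

lemma group: "group_action_on X T \<phi>"
  using T_cases by (auto simp: smooth_flow_def smooth_int_action_def)

lemma act_in: "t \<in> T \<Longrightarrow> x \<in> topspace X \<Longrightarrow> \<phi> t x \<in> topspace X"
  and act_0: "x \<in> topspace X \<Longrightarrow> \<phi> 0 x = x"
  and act_add: "s \<in> T \<Longrightarrow> t \<in> T \<Longrightarrow> x \<in> topspace X \<Longrightarrow> \<phi> (s + t) x = \<phi> s (\<phi> t x)"
  using group by (simp_all add: group_action_on_def)

lemma act_inv:
  assumes "t \<in> T" "x \<in> topspace X"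
  shows "\<phi> (- t) (\<phi> t x) = x" "\<phi> t (\<phi> (- t) x) = x"
  using act_add[of "- t" t x] act_add[of t "- t" x] assms T_closed act_0 by simp_all

lemma flow_cont:
  assumes "smooth_flow X A \<phi>"
  shows "continuous_map (prod_topology euclideanreal X) X (\<lambda>(t, x). \<phi> t x)"
  using assms by (simp add: smooth_flow_def)

lemma int_action_inv:
  assumes "T = \<int>" "smooth_int_action X A \<phi>" "x \<in> topspace X"
  shows "inv_into (topspace X) (\<phi> 1) x = \<phi> (- 1) x"
proof -
  have bij: "bij_betw (\<phi> 1) (topspace X) (topspace X)"
    using assms(2) by (simp add: smooth_int_action_def diffeomorphism_def)
  have 1: "1 \<in> T" "- 1 \<in> T" using assms(1) by auto
  have "inv_into (topspace X) (\<phi> 1) (\<phi> 1 (\<phi> (- 1) x)) = \<phi> (- 1) x"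
    by (rule inv_into_f_f[OF bij_betw_imp_inj_on[OF bij] act_in[OF 1(2) assms(3)]])
  then show ?thesis using act_inv(2)[OF 1(1) assms(3)] by simp
qed

lemma int_induct_step:
  assumes "P 0" "\<And>t. t \<in> \<int> \<Longrightarrow> P t \<Longrightarrow> P (t + 1)" "\<And>t. t \<in> \<int> \<Longrightarrow> P t \<Longrightarrow> P (t + - 1)" "(t::real) \<in> \<int>"
  shows "P t"
proof -
  obtain k :: int where k: "t = of_int k" using assms(4) by (elim Ints_cases)
  have "P (of_int k)"
  proof (induction k rule: int_induct[of _ 0])
    case base then show ?case using assms(1) by simp
  next
    case (step1 i) then show ?case using assms(2)[of "of_int i"] by simp
  next
    case (step2 i) then show ?case using assms(3)[of "of_int i"] by simp
  qed
  then show ?thesis using k by simp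
qed

lemma act_cont:
  assumes t: "t \<in> T"
  shows "continuous_map X X (\<phi> t)"
  using T_cases
proof (elim disjE conjE)
  assume "smooth_flow X A \<phi>"
  note jc = flow_cont[OF this]
  have "continuous_map X (prod_topology euclideanreal X) (\<lambda>x. (t, x))"
    by (auto simp: continuous_map_pairwise o_def)
  then show ?thesis using continuous_map_compose[OF _ jc] by (fastforce simp: o_def)
next
  assume Z: "T = \<int>" "smooth_int_action X A \<phi>"
  have dif: "diffeomorphism X A (\<phi> 1)" using Z(2) by (simp add: smooth_int_action_def)
  have c1: "continuous_map X X (\<phi> 1)"
    using dif by (simp add: diffeomorphism_def smooth_self_map_def)
  have "continuous_map X X (inv_into (topspace X) (\<phi> 1))"
    using dif by (simp add: diffeomorphism_def smooth_self_map_def)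
  then have c2: "continuous_map X X (\<phi> (- 1))"
    by (rule continuous_map_eq) (use int_action_inv[OF Z] in auto)
  have step: "continuous_map X X (\<phi> (r + s))"
    if "r \<in> \<int>" "s \<in> \<int>" "continuous_map X X (\<phi> r)" "continuous_map X X (\<phi> s)" for r s
    by (rule continuous_map_eq[OF continuous_map_compose[OF that(4,3)]])
      (use act_add[of r s] that Z(1) in auto)
  show ?thesis
  proof (rule int_induct_step[of "\<lambda>t. continuous_map X X (\<phi> t)"])
    show "continuous_map X X (\<phi> 0)"
      by (rule continuous_map_eq[of X X id]) (use act_0 in auto)
    show "continuous_map X X (\<phi> (r + - 1))" if "r \<in> \<int>" "continuous_map X X (\<phi> r)" for r
      using step[OF that(1) _ that(2) c2] by simp
  qed (use step c1 t Z(1) in auto)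
qed

lemma act_homeo: "t \<in> T \<Longrightarrow> homeomorphic_maps X X (\<phi> t) (\<phi> (- t))"
  using act_cont act_inv T_closed by (simp add: homeomorphic_maps_def)

lemma act_inj: "t \<in> T \<Longrightarrow> inj_on (\<phi> t) (topspace X)"
  by (rule inj_on_inverseI[of _ "\<phi> (- t)"]) (rule act_inv)

text \<open>The set of pairs of a time and a coordinate vector on which the coordinate expression of a flow
  is defined.\<close>

lemma flow_domain_open:
  assumes "smooth_flow X A \<phi>" "is_chart X (U, c)" "openin X V"
  shows "open {(t, y). y \<in> c ` U \<and> \<phi> t (inv_into U c y) \<in> V}"
proof -
  have op: "open (c ` U)" by (rule is_chart_open_image[OF assms(2)])
  have m1: "continuous_map (prod_topology euclideanreal (top_of_set (c ` U))) (prod_topology euclideanreal X)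
      (\<lambda>z. (fst z, inv_into U c (snd z)))"
    unfolding continuous_map_pairwise o_def fst_conv snd_conv
    using continuous_map_compose[OF continuous_map_snd is_chart_inv_cont[OF assms(2)]]
    by (auto simp: o_def intro: continuous_map_fst)
  have m: "continuous_map (prod_topology euclideanreal (top_of_set (c ` U))) X
      (\<lambda>z. \<phi> (fst z) (inv_into U c (snd z)))"
    using continuous_map_compose[OF m1 flow_cont[OF assms(1)]] by (simp add: o_def)
  have tp: "prod_topology euclideanreal (top_of_set (c ` U)) = top_of_set (UNIV \<times> c ` U)"
    using subtopology_Times[of "euclideanreal" euclidean UNIV "c ` U"] by (simp add: euclidean_product_topology)
  have "openin (top_of_set (UNIV \<times> c ` U)) {z \<in> UNIV \<times> c ` U. \<phi> (fst z) (inv_into U c (snd z)) \<in> V}"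
    using openin_continuous_map_preimage[OF m assms(3)] unfolding tp by simp
  moreover have "open (UNIV \<times> c ` U :: (real \<times> _) set)" using op by (simp add: open_Times)
  ultimately have "open {z \<in> UNIV \<times> c ` U. \<phi> (fst z) (inv_into U c (snd z)) \<in> V}"
    by (rule openin_open_trans)
  moreover have "{z \<in> UNIV \<times> c ` U. \<phi> (fst z) (inv_into U c (snd z)) \<in> V} =
      {(t, y). y \<in> c ` U \<and> \<phi> t (inv_into U c y) \<in> V}" by auto
  ultimately show ?thesis by simp
qed

lemma flow_smooth:
  assumes "smooth_flow X A \<phi>" "(U, c) \<in> A" "(V, d) \<in> A"
  shows "smooth_on {(t, y). y \<in> c ` U \<and> \<phi> t (inv_into U c y) \<in> V} (\<lambda>(t, y). d (\<phi> t (inv_into U c y)))"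
  using assms unfolding smooth_flow_def by (metis (mono_tags, lifting) case_prodD)

lemma flow_act_smooth:
  assumes "smooth_flow X A \<phi>" "(U, c) \<in> A" "(V, d) \<in> A"
  shows "smooth_on (c ` {x\<in>U. \<phi> t x \<in> V}) (d \<circ> \<phi> t \<circ> inv_into U c)"
proof -
  let ?S = "{(t, y). y \<in> c ` U \<and> \<phi> t (inv_into U c y) \<in> V}"
  have "smooth_on {y. (t, y) \<in> ?S} (\<lambda>y. (\<lambda>(t, y). d (\<phi> t (inv_into U c y))) (t, y))"
    using smooth_on_slice flow_domain_open[OF assms(1) chart[OF assms(2)] is_chart_openin[OF chart[OF assms(3)]]]
      flow_smooth[OF assms] by blast
  moreover have "{y. (t, y) \<in> ?S} = c ` {x\<in>U. \<phi> t x \<in> V}"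
  proof
    show "{y. (t, y) \<in> ?S} \<subseteq> c ` {x\<in>U. \<phi> t x \<in> V}" using assms(2) by auto
    show "c ` {x\<in>U. \<phi> t x \<in> V} \<subseteq> {y. (t, y) \<in> ?S}" using assms(2) by auto
  qed
  ultimately show ?thesis by (simp add: o_def)
qed

lemma int_act_smooth:
  assumes Z: "T = \<int>" "smooth_int_action X A \<phi>" and UV: "(U, c) \<in> A" "(V, d) \<in> A"
  shows "smooth_on (c ` {x\<in>U. \<phi> 1 x \<in> V}) (d \<circ> \<phi> 1 \<circ> inv_into U c)"
    and "smooth_on (c ` {x\<in>U. \<phi> (- 1) x \<in> V}) (d \<circ> \<phi> (- 1) \<circ> inv_into U c)"
proof -
  have dif: "diffeomorphism X A (\<phi> 1)" using Z(2) by (simp add: smooth_int_action_def)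
  show "smooth_on (c ` {x\<in>U. \<phi> 1 x \<in> V}) (d \<circ> \<phi> 1 \<circ> inv_into U c)"
    using dif UV unfolding diffeomorphism_def smooth_self_map_def by (metis (mono_tags, lifting) case_prodD)
  let ?f = "inv_into (topspace X) (\<phi> 1)"
  have s: "smooth_on (c ` {x\<in>U. ?f x \<in> V}) (d \<circ> ?f \<circ> inv_into U c)"
    using dif UV unfolding diffeomorphism_def smooth_self_map_def by (metis (mono_tags, lifting) case_prodD)
  have UX: "U \<subseteq> topspace X" by (rule is_chart_subset[OF chart[OF UV(1)]])
  have set_eq: "{x\<in>U. ?f x \<in> V} = {x\<in>U. \<phi> (- 1) x \<in> V}"
    using int_action_inv[OF Z] UX by auto
  show "smooth_on (c ` {x\<in>U. \<phi> (- 1) x \<in> V}) (d \<circ> \<phi> (- 1) \<circ> inv_into U c)"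
  proof (rule smooth_on_cong[OF _ _ s[unfolded set_eq]])
    have "- 1 \<in> T" using Z(1) by auto
    then have "openin X {x\<in>topspace X. \<phi> (- 1) x \<in> V}"
      using openin_continuous_map_preimage[OF act_cont is_chart_openin[OF chart[OF UV(2)]]] by blast
    then have "openin X (U \<inter> {x\<in>topspace X. \<phi> (- 1) x \<in> V})"
      using is_chart_openin[OF chart[OF UV(1)]] by blast
    moreover have "U \<inter> {x\<in>topspace X. \<phi> (- 1) x \<in> V} = {x\<in>U. \<phi> (- 1) x \<in> V}" using UX by auto
    ultimately have "openin X {x\<in>U. \<phi> (- 1) x \<in> V}" by simp
    then show "open (c ` {x\<in>U. \<phi> (- 1) x \<in> V})"
      by (rule is_chart_open_image_subset[OF chart[OF UV(1)]]) auto
    fix y assume "y \<in> c ` {x\<in>U. \<phi> (- 1) x \<in> V}"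
    then obtain x where x: "x \<in> U" "y = c x" by auto
    then have "?f x = \<phi> (- 1) x" using int_action_inv[OF Z] UX by auto
    then show "(d \<circ> ?f \<circ> inv_into U c) y = (d \<circ> \<phi> (- 1) \<circ> inv_into U c) y"
      using x UV(1) by simp
  qed
qed

text \<open>The action permutes the charts, because the atlas is maximal. For the integers only the
  generator and its inverse are given as smooth maps, and the other times follow by induction,
  pushing the chart one step at a time.\<close>

lemma push_in_atlas:
  assumes t: "t \<in> T" and U: "(U, c) \<in> A"
  shows "(\<phi> t ` U, c \<circ> \<phi> (- t)) \<in> A"
  using T_cases
proof (elim disjE conjE)
  assume fl: "smooth_flow X A \<phi>"
  show ?thesis
    by (rule push_chart[OF U act_homeo[OF t]]) (use flow_act_smooth[OF fl] U in blast)+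
next
  assume Z: "T = \<int>" "smooth_int_action X A \<phi>"
  have T1: "1 \<in> T" "- 1 \<in> T" using Z(1) by auto
  have p1: "(\<phi> 1 ` V, d \<circ> \<phi> (- 1)) \<in> A" if "(V, d) \<in> A" for V d
    by (rule push_chart[OF that act_homeo[OF T1(1)]]) (use int_act_smooth[OF Z] that in blast)+
  have p2: "(\<phi> (- 1) ` V, d \<circ> \<phi> 1) \<in> A" if "(V, d) \<in> A" for V d
    by (rule push_chart[OF that]) (use act_homeo[OF T1(2)] int_act_smooth[OF Z] that in auto)
  have UX: "U \<subseteq> topspace X" by (rule is_chart_subset[OF chart[OF U]])
  have step: "(\<phi> (r + s) ` U, c \<circ> \<phi> (- (r + s))) \<in> A"
    if rs: "r \<in> T" "s \<in> T" and rA: "(\<phi> s ` \<phi> r ` U, (c \<circ> \<phi> (- r)) \<circ> \<phi> (- s)) \<in> A" for r s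
  proof -
    have im: "\<phi> s ` \<phi> r ` U = \<phi> (r + s) ` U"
      unfolding image_image
      by (rule image_cong) (use act_add[OF rs(2,1)] UX in \<open>auto simp: add.commute\<close>)
    have "((c \<circ> \<phi> (- r)) \<circ> \<phi> (- s)) y = (c \<circ> \<phi> (- (r + s))) y" if "y \<in> \<phi> (r + s) ` U" for y
    proof -
      have "y \<in> topspace X" using that act_in[OF T_closed(2)[OF rs]] UX by auto
      then show ?thesis using act_add[of "- r" "- s" y] T_closed rs by simp
    qed
    then show ?thesis using chart_cong[OF rA[unfolded im]] by blast
  qed
  show ?thesis
  proof (rule int_induct_step[of "\<lambda>t. (\<phi> t ` U, c \<circ> \<phi> (- t)) \<in> A"])
    have "\<phi> 0 ` U = U" using act_0 UX by force
    moreover have "(U, c \<circ> \<phi> (- 0)) \<in> A" by (rule chart_cong[OF U]) (use act_0 UX in auto)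
    ultimately show "(\<phi> 0 ` U, c \<circ> \<phi> (- 0)) \<in> A" by simp
    show "(\<phi> (r + 1) ` U, c \<circ> \<phi> (- (r + 1))) \<in> A" if "r \<in> \<int>" "(\<phi> r ` U, c \<circ> \<phi> (- r)) \<in> A" for r
      by (rule step) (use p1[OF that(2)] that Z(1) T1 in auto)
    show "(\<phi> (r + - 1) ` U, c \<circ> \<phi> (- (r + - 1))) \<in> A" if "r \<in> \<int>" "(\<phi> r ` U, c \<circ> \<phi> (- r)) \<in> A" for r
      by (rule step) (use p2[OF that(2)] that Z(1) T1 in auto)
  qed (use t Z in auto)
qed

lemma push_inv:
  assumes t: "t \<in> T" and U: "(U, c) \<in> A" and y: "y \<in> c ` U"
  shows "inv_into (\<phi> t ` U) (c \<circ> \<phi> (- t)) y = \<phi> t (inv_into U c y)"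
  by (rule inv_into_push[OF is_chart_inj[OF chart[OF U]] _ y])
    (use act_inv(1)[OF t] is_chart_subset[OF chart[OF U]] in blast)

lemma push_has_derivative:
  assumes t: "t \<in> T" and U: "(U, c) \<in> A" "x \<in> U" and V: "(V, d) \<in> A" "\<phi> t x \<in> V"
  shows "(d \<circ> \<phi> t \<circ> inv_into U c has_derivative
    trans_deriv (\<phi> t ` U, c \<circ> \<phi> (- t)) (V, d) (\<phi> t x)) (at (c x))"
proof -
  have xX: "x \<in> topspace X" using is_chart_subset[OF chart[OF U(1)]] U(2) by blast
  have 1: "(d \<circ> inv_into (\<phi> t ` U) (c \<circ> \<phi> (- t)) has_derivative
      trans_deriv (\<phi> t ` U, c \<circ> \<phi> (- t)) (V, d) (\<phi> t x)) (at (c x))"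
    using trans_has_derivative[OF push_in_atlas[OF t U(1)] V(1) imageI[OF U(2)] V(2)]
      act_inv(1)[OF t xX] by simp
  show ?thesis
    by (rule has_derivative_transform_within_open[OF 1 is_chart_open_image[OF chart[OF U(1)]]])
      (use U push_inv[OF t U(1)] in auto)
qed

lemma trans_push:
  assumes t: "t \<in> T" and U: "(U, c) \<in> A" "x \<in> U" and V: "(V, d) \<in> A" "x \<in> V"
  shows "trans_deriv (\<phi> t ` U, c \<circ> \<phi> (- t)) (\<phi> t ` V, d \<circ> \<phi> (- t)) (\<phi> t x) = trans_deriv (U, c) (V, d) x"
proof -
  have UX: "U \<subseteq> topspace X" using is_chart_subset[OF chart[OF U(1)]] .
  have 1: "((d \<circ> \<phi> (- t)) \<circ> \<phi> t \<circ> inv_into U c has_derivative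
      trans_deriv (\<phi> t ` U, c \<circ> \<phi> (- t)) (\<phi> t ` V, d \<circ> \<phi> (- t)) (\<phi> t x)) (at (c x))"
    by (rule push_has_derivative[OF t U push_in_atlas[OF t V(1)]]) (use V in blast)
  have "(d \<circ> inv_into U c has_derivative
      trans_deriv (\<phi> t ` U, c \<circ> \<phi> (- t)) (\<phi> t ` V, d \<circ> \<phi> (- t)) (\<phi> t x)) (at (c x))"
  proof (rule has_derivative_transform_within_open[OF 1 is_chart_open_image[OF chart[OF U(1)]]])
    show "c x \<in> c ` U" using U by blast
    fix y assume "y \<in> c ` U"
    then have "inv_into U c y \<in> topspace X" using UX inv_into_into by (metis subsetD)
    then show "((d \<circ> \<phi> (- t)) \<circ> \<phi> t \<circ> inv_into U c) y = (d \<circ> inv_into U c) y"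
      using act_inv(1)[OF t] by simp
  qed
  then show ?thesis
    using frechet_derivative_at by (fastforce simp: trans_deriv_def[of "(U, c)" "(V, d)"])
qed

text \<open>The differential of \<open>\<phi> t\<close> is the identity in coordinates, if the chart is carried along. The
  chart in the definition of the differential is an arbitrary one around \<open>x\<close>; the cocycle rule
  for coordinate changes removes it.\<close>

lemma tangent_map_coord:
  assumes t: "t \<in> T" and U: "(U, c) \<in> A" "x \<in> U"
  shows "tangent_map A (\<phi> t) x (coord_vector A (U, c) x u) =
    coord_vector A (\<phi> t ` U, c \<circ> \<phi> (- t)) (\<phi> t x) u"
proof
  fix b :: "('a, 'e) chart"
  obtain V d where b: "b = (V, d)" by (cases b)
  obtain U0 c0 where a0: "(SOME a. a \<in> A \<and> x \<in> fst a) = (U0, c0)" by (cases "SOME a. a \<in> A \<and> x \<in> fst a")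
  have "\<exists>a. a \<in> A \<and> x \<in> fst a" using U by force
  from someI_ex[OF this] have U0: "(U0, c0) \<in> A" "x \<in> U0" unfolding a0 by auto
  show "tangent_map A (\<phi> t) x (coord_vector A (U, c) x u) b =
      coord_vector A (\<phi> t ` U, c \<circ> \<phi> (- t)) (\<phi> t x) u b"
  proof (cases "(V, d) \<in> A \<and> \<phi> t x \<in> V")
    case True
    have "tangent_map A (\<phi> t) x (coord_vector A (U, c) x u) b =
        frechet_derivative (d \<circ> \<phi> t \<circ> inv_into U0 c0) (at (c0 x)) (trans_deriv (U, c) (U0, c0) x u)"
      using True U0 by (simp add: tangent_map_def b a0 coord_vector_apply)
    also have "\<dots> = trans_deriv (\<phi> t ` U0, c0 \<circ> \<phi> (- t)) (V, d) (\<phi> t x) (trans_deriv (U, c) (U0, c0) x u)"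
      using frechet_derivative_at[OF push_has_derivative[OF t U0, of V d]] True by simp
    also have "\<dots> = trans_deriv (\<phi> t ` U, c \<circ> \<phi> (- t)) (V, d) (\<phi> t x) u"
      unfolding trans_push[OF t U U0, symmetric]
      by (rule trans_cocycle) (use push_in_atlas[OF t] U U0 True in auto)
    finally show ?thesis using True by (simp add: coord_vector_apply b)
  next
    case False
    then show ?thesis
      unfolding tangent_map_def coord_vector_apply b case_prod_conv fst_conv if_not_P[OF False] by simp
  qed
qed

lemma path_component_push:
  assumes t: "t \<in> T" and pc: "path_component_of (subtopology X S) x y"
  shows "path_component_of (subtopology X (\<phi> t ` S)) (\<phi> t x) (\<phi> t y)"
proof -
  obtain k where k: "pathin (subtopology X S) k" "k 0 = x" "k 1 = y"
    using pc unfolding path_component_of_def by blast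
  have "continuous_map (subtopology X S) (subtopology X (\<phi> t ` S)) (\<phi> t)"
    using continuous_map_from_subtopology[OF act_cont[OF t]]
    by (auto simp: continuous_map_in_subtopology)
  then have "pathin (subtopology X (\<phi> t ` S)) (\<phi> t \<circ> k)"
    using k(1) unfolding pathin_def by (rule continuous_map_compose[rotated])
  then show ?thesis unfolding path_component_of_def using k by (intro exI[of _ "\<phi> t \<circ> k"]) simp
qed

end


section \<open>Expanding actions\<close>

locale expanding_action = foliated_mfd X A g p F + smooth_action_mfd X A T \<phi>
  for X :: "'a topology" and A :: "('a, 'e::euclidean_space) chart set" and g p F T \<phi> +
  fixes C l :: real
  assumes compact: "compact_space X"
    and invariant: "leaves_foliation_invariant T \<phi> F"
    and C_pos: "C > 0" and l_gt: "l > 1"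
    and expand: "\<And>x v t. x \<in> topspace X \<Longrightarrow> v \<in> leaf_tangent_space X A p F x \<Longrightarrow> t \<in> T \<Longrightarrow> t \<ge> 0 \<Longrightarrow>
      riem_norm g (\<phi> t x) (tangent_map A (\<phi> t) x v) \<ge> C * (l powr t) * riem_norm g x v"
begin

lemma leaf_image: "t \<in> T \<Longrightarrow> L \<in> F \<Longrightarrow> \<phi> t ` L \<in> F"
  using invariant by (simp add: leaves_foliation_invariant_def)

lemma leaf_subset: "L \<in> F \<Longrightarrow> L \<subseteq> topspace X"
  using fol partition_onD1[of "topspace X" F] unfolding foliation_def by auto

text \<open>All parts of the slice criterion are transported by a homeomorphism that permutes the
  leaves.\<close>

lemma slice_push:
  assumes t: "t \<in> T" and sl: "leaf_slice X A p F x (U, c) P"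
  shows "leaf_slice X A p F (\<phi> t x) (\<phi> t ` U, c \<circ> \<phi> (- t)) P"
proof -
  have a: "(U, c) \<in> A" "x \<in> U" "subspace P" "dim P = p" using sl leaf_slice_iff by blast+
  have UX: "U \<subseteq> topspace X" using is_chart_subset[OF chart[OF a(1)]] .
  obtain L where L: "L \<in> F" "x \<in> L" using sl leaf_slice_iff by blast
  have LX: "L \<subseteq> topspace X" using leaf_subset[OF L(1)] .
  have mt: "- t \<in> T" using T_closed t by blast
  have inter: "\<phi> t ` L \<inter> \<phi> t ` U = \<phi> t ` (L \<inter> U)"
    using inj_on_image_Int[OF act_inj[OF t] LX UX] by simp
  have bk: "\<phi> (- t) ` \<phi> t ` (L \<inter> U) = L \<inter> U"
    unfolding image_image using act_inv(1)[OF t] LX by force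
  have pl: "plaque (\<phi> t ` U, c \<circ> \<phi> (- t)) P (\<phi> t x) = \<phi> t ` plaque (U, c) P x"
  proof
    show "plaque (\<phi> t ` U, c \<circ> \<phi> (- t)) P (\<phi> t x) \<subseteq> \<phi> t ` plaque (U, c) P x"
    proof
      fix y assume "y \<in> plaque (\<phi> t ` U, c \<circ> \<phi> (- t)) P (\<phi> t x)"
      then obtain z where z: "z \<in> U" "y = \<phi> t z" "c (\<phi> (- t) (\<phi> t z)) - c (\<phi> (- t) (\<phi> t x)) \<in> P"
        by (auto simp: plaque_def)
      moreover have "\<phi> (- t) (\<phi> t z) = z" "\<phi> (- t) (\<phi> t x) = x"
        using act_inv(1)[OF t] UX a(2) z(1) by blast+
      ultimately have "z \<in> plaque (U, c) P x" by (simp add: plaque_def)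
      then show "y \<in> \<phi> t ` plaque (U, c) P x" using z by blast
    qed
    show "\<phi> t ` plaque (U, c) P x \<subseteq> plaque (\<phi> t ` U, c \<circ> \<phi> (- t)) P (\<phi> t x)"
    proof
      fix y assume "y \<in> \<phi> t ` plaque (U, c) P x"
      then obtain z where z: "z \<in> U" "y = \<phi> t z" "c z - c x \<in> P" by (auto simp: plaque_def)
      moreover have "\<phi> (- t) (\<phi> t z) = z" "\<phi> (- t) (\<phi> t x) = x"
        using act_inv(1)[OF t] UX a(2) z(1) by blast+
      ultimately show "y \<in> plaque (\<phi> t ` U, c \<circ> \<phi> (- t)) P (\<phi> t x)" by (simp add: plaque_def)
    qed
  qed
  have "path_component_of_set (subtopology X (\<phi> t ` L \<inter> \<phi> t ` U)) (\<phi> t x) = \<phi> t ` plaque (U, c) P x"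
  proof
    show "\<phi> t ` plaque (U, c) P x \<subseteq> path_component_of_set (subtopology X (\<phi> t ` L \<inter> \<phi> t ` U)) (\<phi> t x)"
      using path_component_push[OF t] slice_plaque_eq[OF sl L] unfolding inter by blast
    show "path_component_of_set (subtopology X (\<phi> t ` L \<inter> \<phi> t ` U)) (\<phi> t x) \<subseteq> \<phi> t ` plaque (U, c) P x"
    proof
      fix y assume "y \<in> path_component_of_set (subtopology X (\<phi> t ` L \<inter> \<phi> t ` U)) (\<phi> t x)"
      then have y: "path_component_of (subtopology X (\<phi> t ` (L \<inter> U))) (\<phi> t x) y" by (simp add: inter)
      have yX: "y \<in> topspace X" using path_component_in_topspace[OF y] by simp
      have xX: "x \<in> topspace X" using a(2) UX by blast
      have "path_component_of (subtopology X (L \<inter> U)) x (\<phi> (- t) y)"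
        using path_component_push[OF mt y] unfolding bk act_inv(1)[OF t xX] .
      then have "\<phi> (- t) y \<in> plaque (U, c) P x" using slice_plaque_eq[OF sl L] by blast
      then show "y \<in> \<phi> t ` plaque (U, c) P x" using act_inv(2)[OF t yX] by (metis imageI)
    qed
  qed
  then show ?thesis
    unfolding leaf_slice_iff pl using push_in_atlas[OF t a(1)] a L leaf_image[OF t L(1)] by blast
qed

text \<open>The image of the vector under the differential has the same coordinates \<open>u\<close> in the carried chart,
  so the expansion compares the norms of one coordinate vector at two points.\<close>

lemma expand_cnorm:
  assumes t: "t \<in> T" "t \<ge> 0" and sl: "leaf_slice X A p F x (U, c) P" and u: "u \<in> P"
  shows "C * (l powr t) * cnorm (U, c) x u \<le> cnorm (\<phi> t ` U, c \<circ> \<phi> (- t)) (\<phi> t x) u"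
proof -
  have a: "(U, c) \<in> A" "x \<in> U" using sl leaf_slice_iff by blast+
  have xX: "x \<in> topspace X" using is_chart_subset[OF chart[OF a(1)]] a(2) by blast
  have "coord_vector A (U, c) x u (U, c) \<in> P" using coord_vector_self[OF a] u by simp
  then have "coord_vector A (U, c) x u \<in> leaf_tangent_space X A p F x"
    unfolding leaf_tangent_space_def using sl coord_vector_tangent[OF a] by blast
  from expand[OF xX this t] show ?thesis
    unfolding tangent_map_coord[OF t(1) a] by (simp add: cnorm_def)
qed

lemma cnorm_cong:
  assumes "\<And>x. x \<in> U \<Longrightarrow> c x = c' x" "x \<in> U"
  shows "cnorm (U, c) x u = cnorm (U, c') x u"
proof -
  have "inv_into U c = inv_into U c'" by (rule inv_into_cong) (rule assms(1))
  then have "trans_deriv (U, c) b x = trans_deriv (U, c') b x" for b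
    using assms by (simp add: trans_deriv_def)
  then have "coord_vector A (U, c) x u = coord_vector A (U, c') x u"
    by (simp add: coord_vector_apply fun_eq_iff)
  then show ?thesis by (simp add: cnorm_def)
qed

text \<open>The image of the arc under \<open>\<phi> (- t)\<close> is the same segment in the carried chart. Applying the
  expansion by \<open>\<phi> t\<close> to the velocity of the image gives back the velocity of the original arc.\<close>

lemma leaf_arc_contract:
  assumes t: "t \<in> T" "t \<ge> 0" and arc: "leaf_arc m x y"
  shows "leaf_arc (m / (C * l powr t)) (\<phi> (- t) x) (\<phi> (- t) y)"
proof -
  obtain U c P u where sl: "leaf_slice X A p F x (U, c) P" "u \<in> P"
    and s1: "\<And>s. s \<in> {0..1} \<Longrightarrow> c x + s *\<^sub>R u \<in> c ` U"
    and s2: "\<And>s. s \<in> {0..1} \<Longrightarrow> cnorm (U, c) (inv_into U c (c x + s *\<^sub>R u)) u \<le> m"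
    and y: "y = inv_into U c (c x + u)"
    using arc unfolding leaf_arc_def by blast
  have mt: "- t \<in> T" using T_closed t(1) by blast
  have a: "(U, c) \<in> A" "x \<in> U" using sl leaf_slice_iff by blast+
  have UX: "U \<subseteq> topspace X" using is_chart_subset[OF chart[OF a(1)]] .
  define U' where "U' = \<phi> (- t) ` U"
  define c' where "c' = c \<circ> \<phi> t"
  have a': "(U', c') \<in> A" using push_in_atlas[OF mt a(1)] by (simp add: U'_def c'_def)
  have inv': "inv_into U' c' q = \<phi> (- t) (inv_into U c q)" if "q \<in> c ` U" for q
    using push_inv[OF mt a(1) that] by (simp add: U'_def c'_def)
  have sl': "leaf_slice X A p F (\<phi> (- t) z) (U', c') P" if "leaf_slice X A p F z (U, c) P" for z
    using slice_push[OF mt that] by (simp add: U'_def c'_def)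
  have c'x: "c' (\<phi> (- t) z) = c z" if "z \<in> U" for z
    using act_inv(2)[OF t(1)] that UX by (auto simp: c'_def)
  have im: "c' ` U' = c ` U" unfolding U'_def image_image using c'x by force
  show ?thesis
    unfolding leaf_arc_def
  proof (intro exI conjI ballI)
    show "leaf_slice X A p F (\<phi> (- t) x) (U', c') P" by (rule sl'[OF sl(1)])
    show "u \<in> P" by (rule sl(2))
    have "c x + u \<in> c ` U" using s1[of 1] by simp
    then show "\<phi> (- t) y = inv_into U' c' (c' (\<phi> (- t) x) + u)"
      using c'x[OF a(2)] inv' y by simp
    fix s :: real assume s: "s \<in> {0..1}"
    show "c' (\<phi> (- t) x) + s *\<^sub>R u \<in> c' ` U'" using s1[OF s] im c'x[OF a(2)] by simp
    define z where "z = inv_into U c (c x + s *\<^sub>R u)"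
    have z: "z \<in> plaque (U, c) P x" using slice_segment(3)[OF sl s1 s] by (simp add: z_def)
    have zU: "z \<in> U" using z by (simp add: plaque_def)
    have zX: "z \<in> topspace X" using zU UX by blast
    have bk: "\<phi> t ` U' = U"
      unfolding U'_def image_image using act_inv(2)[OF t(1)] UX by force
    have "C * (l powr t) * cnorm (U', c') (\<phi> (- t) z) u
        \<le> cnorm (\<phi> t ` U', c' \<circ> \<phi> (- t)) (\<phi> t (\<phi> (- t) z)) u"
      by (rule expand_cnorm[OF t sl'[OF slice_move[OF sl(1) z]] sl(2)])
    also have "\<dots> = cnorm (U, c' \<circ> \<phi> (- t)) z u" using bk act_inv(2)[OF t(1) zX] by simp
    also have "\<dots> = cnorm (U, c) z u" by (rule cnorm_cong) (use c'x zU in auto)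
    also have "\<dots> \<le> m" using s2[OF s] by (simp add: z_def)
    finally have "cnorm (U', c') (\<phi> (- t) z) u \<le> m / (C * l powr t)"
      using C_pos l_gt by (simp add: field_simps)
    then show "cnorm (U', c') (inv_into U' c' (c' (\<phi> (- t) x) + s *\<^sub>R u)) u \<le> m / (C * l powr t)"
      using inv'[OF s1[OF s]] c'x[OF a(2)] by (simp add: z_def)
  qed
qed

lemma reach_contract:
  assumes t: "t \<in> T" "t \<ge> 0" and "reach m x y"
  shows "reach (m / (C * l powr t)) (\<phi> (- t) x) (\<phi> (- t) y)"
  using assms(3)
proof (induction rule: reach.induct)
  case (reach_refl x m)
  then show ?case
    using act_in[of "- t" x] T_closed t C_pos by (intro reach.reach_refl) auto
next
  case (reach_step m x y m' z n)
  show ?case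
  proof (rule reach.reach_step[OF reach_step.IH leaf_arc_contract[OF t reach_step(2)]])
    show "m / (C * l powr t) + m' / (C * l powr t) \<le> n / (C * l powr t)"
      unfolding add_divide_distrib[symmetric] using reach_step(3) C_pos
      by (intro divide_right_mono) auto
  qed
qed

end


text \<open>Local constants become global ones by compactness; the index \<open>i\<close> remembers where the local data
  come from.\<close>

lemma compact_space_finite_cover:
  assumes "compact_space X" "\<And>x. x \<in> topspace X \<Longrightarrow> \<exists>Q. openin X Q \<and> x \<in> Q \<and> R x Q"
  obtains I Q where "finite I" "I \<subseteq> topspace X" "topspace X \<subseteq> \<Union>(Q ` I)"
    "\<And>i. i \<in> I \<Longrightarrow> openin X (Q i) \<and> R i (Q i)"
proof -
  have "\<forall>x\<in>topspace X. \<exists>Q. openin X Q \<and> x \<in> Q \<and> R x Q" using assms(2) by blast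
  from bchoice[OF this] obtain Q where Q: "\<forall>x\<in>topspace X. openin X (Q x) \<and> x \<in> Q x \<and> R x (Q x)" ..
  have "\<exists>\<F>. finite \<F> \<and> \<F> \<subseteq> Q ` topspace X \<and> topspace X \<subseteq> \<Union>\<F>"
    by (rule compactinD[of X "topspace X"]) (use assms(1) Q in \<open>auto simp: compact_space_def\<close>)
  then obtain \<F> where \<F>: "finite \<F>" "\<F> \<subseteq> Q ` topspace X" "topspace X \<subseteq> \<Union>\<F>" by blast
  obtain I where I: "I \<subseteq> topspace X" "finite I" "\<F> = Q ` I"
    using finite_subset_image[OF \<F>(1,2)] by blast
  show thesis by (rule that[of I Q]) (use I \<F>(3) Q in auto)
qed


section \<open>The velocity of an expanding flow is transverse to the leaves\<close>

locale smooth_flow_mfd = smooth_action_mfd X A T \<phi>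
  for X :: "'a topology" and A :: "('a, 'e::euclidean_space) chart set" and T \<phi> +
  assumes T_UNIV: "T = UNIV" and flow: "smooth_flow X A \<phi>"
begin

definition velocity :: "('a, 'e) chart \<Rightarrow> 'a \<Rightarrow> 'e" where
  "velocity a x = vector_derivative (\<lambda>s. snd a (\<phi> s x)) (at 0)"

lemma T_all [simp]: "t \<in> T" using T_UNIV by simp

lemma flow_derivative_continuous:
  assumes U: "(U, c) \<in> A"
  obtains D where "continuous_on {(t, y). y \<in> c ` U \<and> \<phi> t (inv_into U c y) \<in> U} D"
    "\<And>s x. x \<in> U \<Longrightarrow> \<phi> s x \<in> U \<Longrightarrow> ((\<lambda>s. c (\<phi> s x)) has_vector_derivative D (s, c x)) (at s)"
proof -
  let ?\<Omega> = "{(t, y). y \<in> c ` U \<and> \<phi> t (inv_into U c y) \<in> U}"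
  define \<Psi> where "\<Psi> = (\<lambda>(t, y). c (\<phi> t (inv_into U c y)))"
  have sm: "smooth_on ?\<Omega> \<Psi>" unfolding \<Psi>_def by (rule flow_smooth[OF flow U U])
  define D where "D z = frechet_derivative \<Psi> (at z) (1, 0)" for z
  have "Ck_on (Suc 0) \<Psi> ?\<Omega>" using sm by (simp only: smooth_on_def)
  then have cont: "continuous_on ?\<Omega> D" unfolding D_def by simp
  have "((\<lambda>s. c (\<phi> s x)) has_vector_derivative D (s, c x)) (at s)" if x: "x \<in> U" "\<phi> s x \<in> U" for s x
  proof -
    have "\<Psi> differentiable (at (s, c x))"
      by (rule smooth_on_differentiable[OF sm]) (use x U in auto)
    then have d: "(\<Psi> has_derivative frechet_derivative \<Psi> (at (s, c x))) (at (s, c x))"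
      using frechet_derivative_works by blast
    have "((\<lambda>r. (r, c x)) has_derivative (\<lambda>r. (r, 0))) (at s)"
      by (auto intro!: derivative_eq_intros)
    from has_derivative_compose[OF this d]
    have "((\<lambda>r. \<Psi> (r, c x)) has_derivative (\<lambda>r. frechet_derivative \<Psi> (at (s, c x)) (r, 0))) (at s)" .
    moreover have "frechet_derivative \<Psi> (at (s, c x)) (r, 0) = r *\<^sub>R D (s, c x)" for r
      using linear_scale[OF has_derivative_linear[OF d], of r "(1, 0)"] by (simp add: D_def)
    moreover have "\<Psi> (r, c x) = c (\<phi> r x)" for r using x U by (simp add: \<Psi>_def)
    ultimately show ?thesis by (simp add: has_vector_derivative_def)
  qed
  then show thesis using that[OF cont] by blast
qed

lemma velocity_eq:
  assumes "((\<lambda>s. c (\<phi> s x)) has_vector_derivative v) (at 0)"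
  shows "velocity (U, c) x = v"
  unfolding velocity_def using vector_derivative_at[OF assms] by simp

lemma velocity_deriv_0:
  assumes U: "(U, c) \<in> A" "x \<in> U"
  shows "((\<lambda>s. c (\<phi> s x)) has_vector_derivative velocity (U, c) x) (at 0)"
proof -
  have "\<phi> 0 x \<in> U" using act_0 U is_chart_subset[OF chart[OF U(1)]] by auto
  then obtain v where v: "((\<lambda>s. c (\<phi> s x)) has_vector_derivative v) (at 0)"
    using flow_derivative_continuous[OF U(1)] U(2) by metis
  then show ?thesis using velocity_eq[OF v] by simp
qed

lemma velocity_deriv:
  assumes U: "(U, c) \<in> A" "\<phi> s x \<in> U" and x: "x \<in> topspace X"
  shows "((\<lambda>r. c (\<phi> r x)) has_vector_derivative velocity (U, c) (\<phi> s x)) (at s)"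
proof -
  have g: "((\<lambda>r. r - s) has_vector_derivative 1) (at s)"
    by (auto intro!: derivative_eq_intros simp: has_vector_derivative_def)
  have "((\<lambda>q. c (\<phi> q (\<phi> s x))) has_vector_derivative velocity (U, c) (\<phi> s x)) (at (s - s))"
    using velocity_deriv_0[OF U] by simp
  from vector_diff_chain_at[OF g this]
  have "(((\<lambda>q. c (\<phi> q (\<phi> s x))) \<circ> (\<lambda>r. r - s)) has_vector_derivative velocity (U, c) (\<phi> s x)) (at s)"
    by simp
  moreover have "((\<lambda>q. c (\<phi> q (\<phi> s x))) \<circ> (\<lambda>r. r - s)) = (\<lambda>r. c (\<phi> r x))"
    using act_add[of _ s x] x by (simp add: fun_eq_iff flip: act_add)
  ultimately show ?thesis by simp
qed

lemma orbit_continuous: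
  assumes "x \<in> topspace X"
  shows "continuous_map euclideanreal X (\<lambda>s. \<phi> s x)"
proof -
  have "continuous_map euclideanreal (prod_topology euclideanreal X) (\<lambda>s. (s, x))"
    using assms by (auto simp: continuous_map_pairwise o_def)
  then show ?thesis using continuous_map_compose[OF _ flow_cont[OF flow]] by (fastforce simp: o_def)
qed

lemma orbit_eventually:
  assumes "x \<in> topspace X" "openin X V" "\<phi> s x \<in> V"
  shows "\<forall>\<^sub>F r in at s. \<phi> r x \<in> V"
proof -
  have "open {r. \<phi> r x \<in> V}"
    using openin_continuous_map_preimage[OF orbit_continuous[OF assms(1)] assms(2)] by simp
  then show ?thesis using eventually_at_in_open'[of "{r. \<phi> r x \<in> V}" s] assms(3) by simp
qed

lemma velocity_change:
  assumes "(U, c) \<in> A" "(V, d) \<in> A" "x \<in> U" "x \<in> V"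
  shows "velocity (V, d) x = trans_deriv (U, c) (V, d) x (velocity (U, c) x)"
proof -
  have xX: "x \<in> topspace X" using is_chart_subset[OF chart[OF assms(1)]] assms(3) by blast
  have "((\<lambda>r. d (\<phi> r x)) has_vector_derivative trans_deriv (U, c) (V, d) (\<phi> 0 x) (velocity (U, c) x)) (at 0)"
    by (rule curve_change[OF assms(1,2)])
      (use assms xX act_0 velocity_deriv_0 orbit_eventually[OF xX is_chart_openin[OF chart[OF assms(1)]], of 0] in auto)
  then show ?thesis using velocity_eq act_0[OF xX] by simp
qed

text \<open>A flow commutes with itself, so in carried charts the velocity field is constant along an
  orbit.\<close>

lemma velocity_push:
  assumes "x \<in> topspace X"
  shows "velocity (\<phi> t ` U, c \<circ> \<phi> (- t)) (\<phi> t x) = velocity (U, c) x"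
proof -
  have "\<phi> (- t) (\<phi> s (\<phi> t x)) = \<phi> s x" for s
    using assms act_in[of t x] by (simp flip: act_add)
  then show ?thesis by (simp add: velocity_def)
qed

lemma velocity_continuous:
  assumes U: "(U, c) \<in> A"
  shows "continuous_on (c ` U) (\<lambda>y. velocity (U, c) (inv_into U c y))"
proof -
  obtain D where D: "continuous_on {(t, y). y \<in> c ` U \<and> \<phi> t (inv_into U c y) \<in> U} D"
    "\<And>s x. x \<in> U \<Longrightarrow> \<phi> s x \<in> U \<Longrightarrow> ((\<lambda>s. c (\<phi> s x)) has_vector_derivative D (s, c x)) (at s)"
    using flow_derivative_continuous[OF U] by blast
  have p0: "\<phi> 0 x = x" if "x \<in> U" for x using act_0 is_chart_subset[OF chart[OF U]] that by auto
  have eq: "D (0, y) = velocity (U, c) (inv_into U c y)" if y: "y \<in> c ` U" for y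
  proof -
    obtain x where x: "x \<in> U" "y = c x" using y by auto
    then show ?thesis using velocity_eq[OF D(2)[of x 0]] p0 U by simp
  qed
  have "continuous_on (c ` U) (\<lambda>y. D (0, y))"
    by (rule continuous_on_compose2[OF D(1)]) (use p0 U in \<open>auto intro!: continuous_intros\<close>)
  then show ?thesis by (rule continuous_on_eq) (rule eq)
qed

text \<open>For small \<open>s\<close> the displacement \<open>d (\<phi> s y) - d y\<close> is \<open>s *\<^sub>R w\<close> up to an error that is small
  relative to \<open>s\<close>, where \<open>w\<close> is the velocity at \<open>x0\<close>. So it lies in a narrow cone around \<open>w\<close>,
  on which the functional \<open>h\<close> orthogonal to \<open>w\<close> is small.\<close>

lemma flow_cone:
  assumes V: "(V, d) \<in> A" "x0 \<in> V" and w: "velocity (V, d) x0 \<noteq> 0" "h \<bullet> velocity (V, d) x0 = 0"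
    and \<epsilon>: "\<epsilon> > 0"
  obtains \<tau> \<rho> where "\<tau> > 0" "\<rho> > 0"
    "\<And>s y. \<bar>s\<bar> \<le> \<tau> \<Longrightarrow> y \<in> V \<Longrightarrow> d y \<in> ball (d x0) \<rho> \<Longrightarrow>
      \<bar>h \<bullet> (d (\<phi> s y) - d y)\<bar> \<le> \<epsilon> * norm (d (\<phi> s y) - d y)"
proof -
  define w where "w = velocity (V, d) x0"
  have w: "w \<noteq> 0" "h \<bullet> w = 0" using assms by (auto simp: w_def)
  let ?\<Omega> = "{(t, y). y \<in> d ` V \<and> \<phi> t (inv_into V d y) \<in> V}"
  obtain D where D: "continuous_on ?\<Omega> D"
    "\<And>s x. x \<in> V \<Longrightarrow> \<phi> s x \<in> V \<Longrightarrow> ((\<lambda>s. d (\<phi> s x)) has_vector_derivative D (s, d x)) (at s)"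
    using flow_derivative_continuous[OF V(1)] by blast
  have p0: "\<phi> 0 x = x" if "x \<in> V" for x using act_0 is_chart_subset[OF chart[OF V(1)]] that by auto
  have Dw: "D (0, d x0) = w" using velocity_eq[OF D(2)[of x0 0]] p0 V by (simp add: w_def)
  \<comment> \<open>The error \<open>\<epsilon>2\<close> solves \<open>norm h * \<epsilon>2 = \<epsilon> * (norm w - \<epsilon>2)\<close>: the left side bounds the height and
    the right side is \<open>\<epsilon>\<close> times a lower bound of the displacement, both per unit of time.\<close>
  define \<epsilon>2 where "\<epsilon>2 = \<epsilon> * norm w / (norm h + \<epsilon>)"
  have nh: "norm h + \<epsilon> > 0" using \<epsilon> by (simp add: add_nonneg_pos)
  have \<epsilon>2: "\<epsilon>2 > 0" "norm h * \<epsilon>2 = \<epsilon> * (norm w - \<epsilon>2)"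
  proof -
    show "\<epsilon>2 > 0" using \<epsilon> w nh by (simp add: \<epsilon>2_def)
    have "\<epsilon>2 * (norm h + \<epsilon>) = \<epsilon> * norm w" using nh by (simp add: \<epsilon>2_def)
    then show "norm h * \<epsilon>2 = \<epsilon> * (norm w - \<epsilon>2)" by (simp add: algebra_simps)
  qed
  have op: "open ?\<Omega>" by (rule flow_domain_open[OF flow chart[OF V(1)] is_chart_openin[OF chart[OF V(1)]]])
  have "open (?\<Omega> \<inter> D -` ball w \<epsilon>2)" by (rule continuous_open_preimage[OF D(1) op open_ball])
  moreover have "(0, d x0) \<in> ?\<Omega> \<inter> D -` ball w \<epsilon>2" using V Dw \<epsilon>2(1) p0 by auto
  ultimately obtain A1 B1 where AB: "open A1" "open B1" "(0, d x0) \<in> A1 \<times> B1" "A1 \<times> B1 \<subseteq> ?\<Omega> \<inter> D -` ball w \<epsilon>2"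
    by (rule open_prod_elim)
  obtain \<tau> where \<tau>: "\<tau> > 0" "cball 0 \<tau> \<subseteq> A1" using AB open_contains_cball[of A1] by auto
  obtain \<rho> where \<rho>: "\<rho> > 0" "ball (d x0) \<rho> \<subseteq> B1" using AB open_contains_ball[of B1] by auto
  have "\<bar>h \<bullet> (d (\<phi> s y) - d y)\<bar> \<le> \<epsilon> * norm (d (\<phi> s y) - d y)"
    if s: "\<bar>s\<bar> \<le> \<tau>" and y: "y \<in> V" "d y \<in> ball (d x0) \<rho>" for s y
  proof -
    define f where "f r = d (\<phi> r y) - r *\<^sub>R w" for r
    have loc: "\<phi> r y \<in> V \<and> norm (D (r, d y) - w) \<le> \<epsilon>2" if "\<bar>r\<bar> \<le> \<tau>" for r
    proof -
      have "r \<in> cball 0 \<tau>" using that by simp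
      then have "(r, d y) \<in> A1 \<times> B1" using \<tau>(2) \<rho>(2) y(2) by blast
      then have "(r, d y) \<in> ?\<Omega> \<inter> D -` ball w \<epsilon>2" by (rule subsetD[OF AB(4)])
      then show ?thesis using V(1) y(1) by (simp add: dist_norm norm_minus_commute)
    qed
    have "norm (f s - f 0) \<le> \<epsilon>2 * norm (s - 0)"
    proof (rule differentiable_bound[of "{- \<tau>..\<tau>}" f "\<lambda>r k. k *\<^sub>R (D (r, d y) - w)"])
      fix r assume r: "r \<in> {- \<tau>..\<tau>}"
      have "((\<lambda>r. d (\<phi> r y)) has_vector_derivative D (r, d y)) (at r)"
        using D(2)[OF y(1)] loc[of r] r by auto
      then have "(f has_vector_derivative (D (r, d y) - 1 *\<^sub>R w)) (at r)"
        unfolding f_def by (auto intro!: derivative_eq_intros)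
      then have "(f has_vector_derivative (D (r, d y) - w)) (at r within {- \<tau>..\<tau>})"
        using has_vector_derivative_at_within by auto
      then show "(f has_derivative (\<lambda>k. k *\<^sub>R (D (r, d y) - w))) (at r within {- \<tau>..\<tau>})"
        by (simp add: has_vector_derivative_def)
      show "onorm (\<lambda>k. k *\<^sub>R (D (r, d y) - w)) \<le> \<epsilon>2"
      proof (rule onorm_le)
        fix k :: real
        show "norm (k *\<^sub>R (D (r, d y) - w)) \<le> \<epsilon>2 * norm k"
          using mult_right_mono[of "norm (D (r, d y) - w)" \<epsilon>2 "\<bar>k\<bar>"] loc[of r] r
          by (auto simp: mult.commute)
      qed
    qed (use s \<tau> in auto)
    then have nf: "norm ((d (\<phi> s y) - d y) - s *\<^sub>R w) \<le> \<epsilon>2 * \<bar>s\<bar>"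
      using p0[OF y(1)] by (simp add: f_def algebra_simps)
    define q where "q = d (\<phi> s y) - d y"
    have "h \<bullet> q = h \<bullet> (q - s *\<^sub>R w)" using w(2) by (simp add: inner_diff_right)
    then have "\<bar>h \<bullet> q\<bar> \<le> norm h * norm (q - s *\<^sub>R w)" by (metis Cauchy_Schwarz_ineq2)
    also have "\<dots> \<le> norm h * (\<epsilon>2 * \<bar>s\<bar>)" using nf by (simp add: q_def mult_left_mono)
    also have "\<dots> = \<epsilon> * ((norm w - \<epsilon>2) * \<bar>s\<bar>)" using \<epsilon>2(2) by (metis mult.assoc)
    also have "\<dots> \<le> \<epsilon> * norm q"
    proof (rule mult_left_mono)
      have "\<bar>s\<bar> * norm w \<le> norm q + norm (q - s *\<^sub>R w)"
        using norm_triangle_ineq4[of q "q - s *\<^sub>R w"] by simp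
      then show "(norm w - \<epsilon>2) * \<bar>s\<bar> \<le> norm q" using nf by (simp add: q_def algebra_simps)
    qed (use \<epsilon> in simp)
    finally show ?thesis by (simp add: q_def)
  qed
  then show thesis using that[OF \<tau>(1) \<rho>(1)] by blast
qed

text \<open>A zero of the velocity spreads along the orbit, and a curve with zero velocity is constant for
  short times, hence for all times by the group law.\<close>

lemma velocity_zero_fixed:
  assumes U: "(U, c) \<in> A" "x \<in> U" and zero: "velocity (U, c) x = 0"
  shows "\<phi> t x = x"
proof -
  have UX: "U \<subseteq> topspace X" using is_chart_subset[OF chart[OF U(1)]] .
  have xX: "x \<in> topspace X" using UX U by blast
  have v0: "velocity (U, c) (\<phi> s x) = 0" if "\<phi> s x \<in> U" for s
  proof -
    have a: "(\<phi> s ` U, c \<circ> \<phi> (- s)) \<in> A" using push_in_atlas[OF _ U(1)] by simp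
    have "velocity (\<phi> s ` U, c \<circ> \<phi> (- s)) (\<phi> s x) = 0" using velocity_push[OF xX] zero by simp
    then show ?thesis
      using velocity_change[OF a U(1) imageI[OF U(2)] that]
        linear_0[OF trans_linear[OF a U(1) imageI[OF U(2)] that]] by simp
  qed
  have "open {r. \<phi> r x \<in> U}"
    using openin_continuous_map_preimage[OF orbit_continuous[OF xX] is_chart_openin[OF chart[OF U(1)]]] by simp
  moreover have "0 \<in> {r. \<phi> r x \<in> U}" using U(2) act_0[OF xX] by simp
  ultimately obtain e where e: "e > 0" "cball 0 e \<subseteq> {r. \<phi> r x \<in> U}"
    unfolding open_contains_cball by blast
  have inU: "\<phi> r x \<in> U" if "r \<in> {-e..e}" for r 
  proof -
    have "r \<in> cball 0 e" using that by auto
    then show ?thesis using e(2) by blast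
  qed
  have small: "\<phi> s x = x" if s: "s \<in> {-e..e}" for s
  proof -
    have "((\<lambda>r. c (\<phi> r x)) has_vector_derivative 0) (at r within {-e..e})" if "r \<in> {-e..e}" for r
      using velocity_deriv[OF U(1) inU[OF that] xX] v0[OF inU[OF that]] has_vector_derivative_at_within by metis
    then obtain q where q: "\<And>r. r \<in> {-e..e} \<Longrightarrow> c (\<phi> r x) = q"
      using has_vector_derivative_zero_constant[of "{-e..e}" "\<lambda>r. c (\<phi> r x)"] by auto
    have "c (\<phi> s x) = c (\<phi> 0 x)" using q[OF s] q[of 0] e(1) by simp
    then show ?thesis
      using is_chart_inj[OF chart[OF U(1)]] inU[OF s] U(2) act_0[OF xX] by (auto simp: inj_on_def)
  qed
  obtain n :: nat where n: "\<bar>t\<bar> / e < real n" using reals_Archimedean2 by blast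
  have npos: "real n > 0" using n e(1) by (smt (verit) divide_nonneg_pos)
  define r where "r = t / real n"
  have "\<bar>r\<bar> \<le> e" using n npos e(1) by (simp add: r_def field_simps)
  then have fr: "\<phi> r x = x" by (intro small) auto
  have "\<phi> (real m * r) x = x" for m
  proof (induction m)
    case 0 then show ?case using act_0[OF xX] by simp
  next
    case (Suc m)
    have "\<phi> (real (Suc m) * r) x = \<phi> (r + real m * r) x" by (simp add: algebra_simps)
    also have "\<dots> = x" using act_add[of r "real m * r" x] xX Suc fr by simp
    finally show ?case .
  qed
  from this[of n] show ?thesis using npos by (simp add: r_def)
qed

end


locale expanding_flow = expanding_action X A g p F T \<phi> C l + smooth_flow_mfd X A T \<phi>
  for X :: "'a topology" and A :: "('a, 'e::euclidean_space) chart set" and g p F T \<phi> C l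
begin

lemma speed_bounded:
  obtains B where "\<And>U c x. (U, c) \<in> A \<Longrightarrow> x \<in> U \<Longrightarrow> cnorm (U, c) x (velocity (U, c) x) \<le> B"
proof -
  define R where "R = (\<lambda>(x::'a) Q. \<exists>B. \<forall>y\<in>Q. \<forall>U c. (U, c) \<in> A \<longrightarrow> y \<in> U \<longrightarrow> cnorm (U, c) y (velocity (U, c) y) \<le> B)"
  have loc: "\<exists>Q. openin X Q \<and> x \<in> Q \<and> R x Q" if x: "x \<in> topspace X" for x
  proof -
    obtain V d where V: "(V, d) \<in> A" "x \<in> V" using chart_at[OF x] .
    have "open (d ` V)" using is_chart_open_image chart[OF V(1)] by blast
    then obtain r where r: "r > 0" "cball (d x) r \<subseteq> d ` V"
      using V(2) open_contains_cball[of "d ` V"] by blast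
    obtain M where M: "M > 0" "\<And>y u. y \<in> V \<Longrightarrow> d y \<in> cball (d x) r \<Longrightarrow>
        norm u \<le> M * cnorm (V, d) y u \<and> cnorm (V, d) y u \<le> M * norm u"
      using cnorm_bounds[OF V(1) compact_cball r(2)] by blast
    have "compact ((\<lambda>y. velocity (V, d) (inv_into V d y)) ` cball (d x) r)"
      by (intro compact_continuous_image continuous_on_subset[OF velocity_continuous[OF V(1)] r(2)] compact_cball)
    then obtain B0 where B0: "\<And>y. y \<in> cball (d x) r \<Longrightarrow> norm (velocity (V, d) (inv_into V d y)) \<le> B0"
      using compact_imp_bounded bounded_iff by (metis (no_types, lifting) imageI)
    define Q where "Q = {y\<in>V. d y \<in> ball (d x) r}"
    have "openin X Q" unfolding Q_def by (rule is_chart_openin_preimage[OF chart[OF V(1)] open_ball])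
    moreover have "x \<in> Q" using V r by (simp add: Q_def)
    moreover have "cnorm (U, c) y (velocity (U, c) y) \<le> M * B0"
      if y: "y \<in> Q" and U: "(U, c) \<in> A" "y \<in> U" for y U c
    proof -
      have yV: "y \<in> V" "d y \<in> cball (d x) r" using y by (auto simp: Q_def)
      have "cnorm (U, c) y (velocity (U, c) y) = cnorm (V, d) y (velocity (V, d) y)"
        using velocity_change[OF V(1) U(1) yV(1) U(2)] cnorm_change[OF V(1) U(1) yV(1) U(2)] by simp
      also have "\<dots> \<le> M * norm (velocity (V, d) y)" using M(2)[OF yV] by blast
      also have "\<dots> \<le> M * B0" using B0[OF yV(2)] V(1) yV(1) M(1) by simp
      finally show ?thesis .
    qed
    ultimately show ?thesis unfolding R_def by blast
  qed
  obtain I Q where IQ: "finite I" "I \<subseteq> topspace X" "topspace X \<subseteq> \<Union>(Q ` I)"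
    "\<And>i. i \<in> I \<Longrightarrow> openin X (Q i) \<and> R i (Q i)"
    using compact_space_finite_cover[OF compact, of R] loc by blast
  have "\<forall>i\<in>I. \<exists>B. \<forall>y\<in>Q i. \<forall>U c. (U, c) \<in> A \<longrightarrow> y \<in> U \<longrightarrow> cnorm (U, c) y (velocity (U, c) y) \<le> B"
    using IQ(4) unfolding R_def by blast
  from bchoice[OF this] obtain B where B: "\<forall>i\<in>I. \<forall>y\<in>Q i. \<forall>U c. (U, c) \<in> A \<longrightarrow> y \<in> U \<longrightarrow>
      cnorm (U, c) y (velocity (U, c) y) \<le> B i" ..
  show thesis
  proof (rule that[of "Max (B ` I)"])
    fix U c x assume U: "(U, c) \<in> A" "x \<in> U"
    then obtain i where i: "i \<in> I" "x \<in> Q i"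
      using IQ(3) is_chart_subset[OF chart[OF U(1)]] by blast
    then have "cnorm (U, c) x (velocity (U, c) x) \<le> B i" using B U by blast
    also have "\<dots> \<le> Max (B ` I)" using i IQ(1) by simp
    finally show "cnorm (U, c) x (velocity (U, c) x) \<le> Max (B ` I)" .
  qed
qed

text \<open>If the velocity at \<open>x\<close> is tangent to the leaf, its norm grows exponentially along the orbit of
  \<open>x\<close>, but on a compact manifold the speed is bounded.\<close>

lemma velocity_tangent_zero:
  assumes sl: "leaf_slice X A p F x (U, c) P" and v: "velocity (U, c) x \<in> P"
  shows "velocity (U, c) x = 0"
proof (rule ccontr)
  assume nz: "velocity (U, c) x \<noteq> 0"
  have a: "(U, c) \<in> A" "x \<in> U" using sl leaf_slice_iff by blast+
  have xX: "x \<in> topspace X" using is_chart_subset[OF chart[OF a(1)]] a(2) by blast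
  obtain B where B: "\<And>U c x. (U, c) \<in> A \<Longrightarrow> x \<in> U \<Longrightarrow> cnorm (U, c) x (velocity (U, c) x) \<le> B"
    using speed_bounded by blast
  define m where "m = C * cnorm (U, c) x (velocity (U, c) x)"
  have m: "m > 0" using cnorm_pos[OF a nz] C_pos by (simp add: m_def)
  obtain n where n: "B / m < l ^ n" using real_arch_pow[OF l_gt] by blast
  have "m * l ^ n = C * (l powr real n) * cnorm (U, c) x (velocity (U, c) x)"
    using l_gt by (simp add: m_def powr_realpow)
  also have "\<dots> \<le> cnorm (\<phi> (real n) ` U, c \<circ> \<phi> (- real n)) (\<phi> (real n) x) (velocity (U, c) x)"
    by (rule expand_cnorm[OF _ _ sl v]) auto
  also have "\<dots> \<le> B"
    using B[OF push_in_atlas[OF _ a(1), of "real n"] imageI[OF a(2)]] velocity_push[OF xX, of "real n" U c] by simp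
  finally show False using n m by (simp add: field_simps)
qed

text \<open>Suppose \<open>x\<close> is fixed by the flow. Its leaf is then invariant, so points \<open>z\<close> of the slice near
  \<open>x\<close> stay in the slice for short times and have velocity tangent to the leaf. By the previous
  two lemmas they are fixed as well. But backward times bring \<open>x\<close> and \<open>z\<close> arbitrarily close to each
  other, so \<open>z = x\<close> for all such \<open>z\<close>, and the leaf would have dimension zero.\<close>

lemma velocity_nonzero:
  assumes U: "(U', c') \<in> A" "x \<in> U'"
  shows "velocity (U', c') x \<noteq> 0"
proof
  assume "velocity (U', c') x = 0"
  then have fix_x: "\<phi> t x = x" for t by (rule velocity_zero_fixed[OF U])
  have xX: "x \<in> topspace X" using is_chart_subset[OF chart[OF U(1)]] U(2) by blast
  obtain U c P where sl: "leaf_slice X A p F x (U, c) P" using slice_at[OF xX] .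
  have a: "(U, c) \<in> A" "x \<in> U" "subspace P" "dim P = p" using sl leaf_slice_iff by blast+
  have UX: "U \<subseteq> topspace X" using is_chart_subset[OF chart[OF a(1)]] .
  obtain L where L: "L \<in> F" "x \<in> L" using leaf_at[OF xX] .
  have Linv: "\<phi> t ` L = L" for t
    using leaf_unique[OF leaf_image[OF T_all L(1)] L(1) _ L(2)] L(2) fix_x[of t] by (metis imageI)
  let ?\<Omega> = "{(t, y). y \<in> c ` U \<and> \<phi> t (inv_into U c y) \<in> U}"
  have op: "open ?\<Omega>" by (rule flow_domain_open[OF flow chart[OF a(1)] is_chart_openin[OF chart[OF a(1)]]])
  have "(0, c x) \<in> ?\<Omega>" using a act_0[OF xX] by auto
  then obtain A1 B1 where AB: "open A1" "open B1" "(0, c x) \<in> A1 \<times> B1" "A1 \<times> B1 \<subseteq> ?\<Omega>"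
    by (rule open_prod_elim[OF op])
  obtain \<tau> where \<tau>: "\<tau> > 0" "cball 0 \<tau> \<subseteq> A1" using AB open_contains_cball[of A1] by auto
  obtain r where r: "r > 0" "cball (c x) r \<subseteq> B1" using AB open_contains_cball[of B1] by auto
  have inU: "\<phi> s z \<in> U" if "z \<in> U" "c z \<in> cball (c x) r" "\<bar>s\<bar> \<le> \<tau>" for s z
  proof -
    have "s \<in> cball 0 \<tau>" using that by simp
    then have "(s, c z) \<in> A1 \<times> B1" using that(2) r(2) \<tau>(2) by blast
    then have "(s, c z) \<in> ?\<Omega>" by (rule subsetD[OF AB(4)])
    then show ?thesis using that a(1) by simp
  qed
  have rU: "cball (c x) r \<subseteq> c ` U"
  proof
    fix y assume "y \<in> cball (c x) r"
    then have "(0, y) \<in> A1 \<times> B1" using r(2) AB(3) by auto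
    then have "(0, y) \<in> ?\<Omega>" by (rule subsetD[OF AB(4)])
    then show "y \<in> c ` U" by simp
  qed
  have fix_z: "\<phi> t z = z" if z: "z \<in> plaque (U, c) P x" "c z \<in> cball (c x) r" for z t
  proof -
    have zU: "z \<in> U" using z(1) by (simp add: plaque_def)
    have zX: "z \<in> topspace X" using zU UX by blast
    have zL: "z \<in> L" using slice_plaque_leaf[OF sl L z(1)] .
    have slz: "leaf_slice X A p F z (U, c) P" using slice_move[OF sl z(1)] .
    have inP: "c (\<phi> s z) - c z \<in> P" if s: "\<bar>s\<bar> \<le> \<tau>" for s
    proof -
      have km: "continuous_map (top_of_set {0..1}) X (\<lambda>r. \<phi> (r * s) z)"
      proof -
        have "continuous_map (top_of_set {0..1}) euclideanreal (\<lambda>r. r * s)"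
          by (auto intro!: continuous_intros)
        from continuous_map_compose[OF this orbit_continuous[OF zX]] show ?thesis by (simp add: o_def)
      qed
      have "path_component_of (subtopology X (L \<inter> U)) (\<phi> (0 * s) z) (\<phi> (1 * s) z)"
      proof (rule path_componentI[OF km])
        fix q :: real assume q: "q \<in> {0..1}"
        have "\<bar>q * s\<bar> \<le> \<bar>s\<bar>" using q by (simp add: abs_mult mult_left_le_one_le)
        then have "\<phi> (q * s) z \<in> U" using inU[OF zU z(2)] s by simp
        moreover have "\<phi> (q * s) z \<in> L" using Linv[of "q * s"] zL by blast
        ultimately show "\<phi> (q * s) z \<in> L \<inter> U" by blast
      qed
      then have "path_component_of (subtopology X (L \<inter> U)) z (\<phi> s z)" using act_0[OF zX] by simp
      then have "\<phi> s z \<in> plaque (U, c) P z" using slice_plaque_eq[OF slz L(1) zL] by blast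
      then show ?thesis by (simp add: plaque_def)
    qed
    have "velocity (U, c) z \<in> P"
    proof -
      have lim: "((\<lambda>s. (1 / s) *\<^sub>R (c (\<phi> s z) - c z)) \<longlongrightarrow> velocity (U, c) z) (at 0)"
      proof -
        have "((\<lambda>s. c (\<phi> s z)) has_derivative (\<lambda>s. s *\<^sub>R velocity (U, c) z)) (at 0)"
          using velocity_deriv_0[OF a(1) zU] by (simp add: has_vector_derivative_def)
        then have "((\<lambda>h. norm (c (\<phi> h z) - c z - h *\<^sub>R velocity (U, c) z) / norm h) \<longlongrightarrow> 0) (at 0)"
          unfolding has_derivative_at using act_0[OF zX] by simp
        then have "((\<lambda>h. norm ((1 / h) *\<^sub>R (c (\<phi> h z) - c z) - velocity (U, c) z)) \<longlongrightarrow> 0) (at 0)"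
        proof (rule Lim_transform_eventually)
          have "norm (c (\<phi> h z) - c z - h *\<^sub>R velocity (U, c) z) / norm h =
              norm ((1 / h) *\<^sub>R (c (\<phi> h z) - c z) - velocity (U, c) z)" if "h \<noteq> 0" for h
          proof -
            have "c (\<phi> h z) - c z - h *\<^sub>R velocity (U, c) z =
                h *\<^sub>R ((1 / h) *\<^sub>R (c (\<phi> h z) - c z) - velocity (U, c) z)"
              using that by (simp add: scaleR_diff_right)
            then show ?thesis using that by simp
          qed
          then show "\<forall>\<^sub>F h in at 0. norm (c (\<phi> h z) - c z - h *\<^sub>R velocity (U, c) z) / norm h =
              norm ((1 / h) *\<^sub>R (c (\<phi> h z) - c z) - velocity (U, c) z)"
            by (simp add: eventually_at_filter)
        qed
        then show ?thesis by (subst Lim_null) (rule tendsto_norm_zero_cancel)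
      qed
      have ev: "\<forall>\<^sub>F s in at 0. (1 / s) *\<^sub>R (c (\<phi> s z) - c z) \<in> P"
        unfolding eventually_at using \<tau>(1) inP subspace_scale[OF a(3)]
        by (intro exI[of _ \<tau>]) (auto simp: dist_norm)
      show ?thesis
        by (rule Lim_in_closed_set[OF closed_subspace[OF a(3)] ev at_neq_bot lim])
    qed
    then have "velocity (U, c) z = 0" by (rule velocity_tangent_zero[OF slz])
    then show ?thesis by (rule velocity_zero_fixed[OF a(1) zU])
  qed
  \<comment> \<open>A second point of the slice, so close to \<open>x\<close> that it is fixed as well.\<close>
  have "\<not> P \<subseteq> {0}" using a(4) dim_pos dim_eq_0[of P] by linarith
  then obtain u0 where u0: "u0 \<in> P" "u0 \<noteq> 0" by blast
  define u where "u = (r / (2 * norm u0)) *\<^sub>R u0"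
  have u: "u \<in> P" "u \<noteq> 0" "norm u < r"
    using u0 r(1) subspace_scale[OF a(3)] by (auto simp: u_def)
  have seg: "c x + s *\<^sub>R u \<in> cball (c x) r" if "s \<in> {0..1}" for s
  proof -
    have "norm (s *\<^sub>R u) \<le> norm u" using that by (simp add: mult_left_le_one_le)
    then show ?thesis using u(3) by (simp add: dist_norm)
  qed
  obtain M where M: "M > 0" "\<And>y u. y \<in> U \<Longrightarrow> c y \<in> cball (c x) r \<Longrightarrow>
      norm u \<le> M * cnorm (U, c) y u \<and> cnorm (U, c) y u \<le> M * norm u"
    using cnorm_bounds[OF a(1) compact_cball rU] by blast
  define z where "z = inv_into U c (c x + u)"
  have "c x + u \<in> c ` U" using seg[of 1] rU by auto
  then have cz: "c z = c x + u" and zU: "z \<in> U" by (auto simp: z_def f_inv_into_f inv_into_into)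
  have zp: "z \<in> plaque (U, c) P x" using cz zU u(1) by (simp add: plaque_def)
  have zc: "c z \<in> cball (c x) r" using seg[of 1] cz by simp
  have "leaf_arc (M * norm u) x z"
    unfolding leaf_arc_def
  proof (intro exI conjI ballI)
    show "leaf_slice X A p F x (U, c) P" "u \<in> P" "z = inv_into U c (c x + u)"
      using sl u by (auto simp: z_def)
    fix s :: real assume s: "s \<in> {0..1}"
    show b: "c x + s *\<^sub>R u \<in> c ` U" using seg[OF s] rU by blast
    show "cnorm (U, c) (inv_into U c (c x + s *\<^sub>R u)) u \<le> M * norm u"
      using M(2)[OF inv_into_into[OF b], of u] seg[OF s] f_inv_into_f[OF b] by simp
  qed
  then have rz: "reach (M * norm u) x z" using reach_step[OF reach_refl[OF xX, of 0]] by auto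
  \<comment> \<open>A time after which the contracted distance is less than the actual one.\<close>
  obtain n where n: "max (2 * M * (M * norm u) / (C * norm u)) (2 * M * (M * norm u) / (C * r)) < l ^ n"
    using real_arch_pow[OF l_gt] by blast
  define m where "m = M * norm u / (C * l powr real n)"
  have "reach m (\<phi> (- real n) x) (\<phi> (- real n) z)"
    unfolding m_def by (rule reach_contract[OF _ _ rz]) auto
  then have rm: "reach m x z" using fix_x fix_z[OF zp zc] by simp
  have ln: "l powr real n = l ^ n" "l ^ n > 0" using l_gt by (auto simp: powr_realpow)
  have n1: "2 * M * (M * norm u) < l ^ n * (C * norm u)" "2 * M * (M * norm u) < l ^ n * (C * r)"
    using n C_pos u(2) r(1) by (simp_all add: divide_less_eq)
  have mm: "M * m < norm u" "M * m < r"
  proof -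
    have pos: "C * l ^ n > 0" using C_pos ln by simp
    have "0 \<le> M * (M * norm u)" using M by simp
    then have "M * (M * norm u) < norm u * (C * l ^ n)" "M * (M * norm u) < r * (C * l ^ n)"
      using n1 by (simp_all add: mult.commute mult.left_commute)
    then show "M * m < norm u" "M * m < r"
      unfolding m_def ln times_divide_eq_right pos_divide_less_eq[OF pos] by blast+
  qed
  have "dist (c z) (c x) \<le> M * m"
  proof -
    have bU: "ball (c x) r \<subseteq> c ` U" using rU ball_subset_cball by blast
    have KK: "norm v \<le> M * cnorm (U, c) y v" if "y \<in> U" "c y \<in> ball (c x) r" for y v
      using M(2)[of y v] that by auto
    show ?thesis using reach_ball[OF a(1) bU M(1) KK rm a(2)] mm(2) by simp
  qed
  then show False using mm(1) cz by (simp add: dist_norm)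
qed

end


section \<open>Local separation of leaf points by flow segments\<close>

context expanding_action
begin

text \<open>The data of a coordinate ball around \<open>x0\<close> with a height function \<open>h \<bullet> d\<close>. Its last three clauses
  say that leafwise distance controls displacement (with constant \<open>K\<close>), that one can climb to
  height \<open>\<sigma>\<close> along the leaf at cost \<open>\<sigma> / \<kappa>\<close>, and that orbit segments of duration at most \<open>\<tau>\<close> are
  flat. The first two put climbing displacements in the cone where height is at least \<open>\<kappa> / K\<close>
  times length; orbit segments have at most half that slope, so the two cones are disjoint. Both
  conditions are invariant under scaling, which matters because the spacing of the points is chosen
  after the box.\<close>

definition local_box :: "'a \<Rightarrow> 'a set \<Rightarrow> ('a \<Rightarrow> 'e) \<Rightarrow> 'e \<Rightarrow> real \<Rightarrow> real \<Rightarrow> real \<Rightarrow> real \<Rightarrow> bool" where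
  "local_box x0 V d h K \<kappa> \<rho> \<tau> \<longleftrightarrow> (V, d) \<in> A \<and> x0 \<in> V \<and> K > 0 \<and> \<kappa> > 0 \<and> \<rho> > 0 \<and> \<tau> > 0 \<and>
    cball (d x0) \<rho> \<subseteq> d ` V \<and>
    (\<forall>x y m. reach m x y \<longrightarrow> x \<in> V \<longrightarrow> dist (d x) (d x0) + K * m < \<rho> \<longrightarrow>
       y \<in> V \<and> dist (d y) (d x) \<le> K * m) \<and>
    (\<forall>x \<sigma>. x \<in> V \<longrightarrow> \<sigma> > 0 \<longrightarrow> dist (d x) (d x0) + K / \<kappa> * \<sigma> < \<rho> \<longrightarrow>
       (\<exists>z m. z \<in> V \<and> reach m x z \<and> \<kappa> * m \<le> \<sigma> \<and> h \<bullet> (d z - d x) = \<sigma>)) \<and>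
    (\<forall>s\<in>T. \<forall>y\<in>V. \<bar>s\<bar> \<le> \<tau> \<longrightarrow> dist (d y) (d x0) < \<rho> \<longrightarrow>
       \<bar>h \<bullet> (d (\<phi> s y) - d y)\<bar> \<le> \<kappa> / (2 * K) * norm (d (\<phi> s y) - d y))"

text \<open>For a flow, \<open>h\<close> is the component of the leaf direction orthogonal to the velocity \<open>w\<close>. It is not
  zero because \<open>w\<close> is not tangent to the leaf. For an action of the integers orbit segments of
  duration less than one are points, and the leaf direction itself will do.\<close>

lemma local_direction:
  assumes V: "(V, d) \<in> A" "x0 \<in> V" and v: "v \<in> leaf_tangent_space X A p F x0" and nz: "v (V, d) \<noteq> 0"
  obtains h where "h \<bullet> v (V, d) > 0"
    "\<And>\<epsilon>. \<epsilon> > 0 \<Longrightarrow> \<exists>\<tau> \<rho>. \<tau> > 0 \<and> \<rho> > 0 \<and> (\<forall>s\<in>T. \<forall>y\<in>V. \<bar>s\<bar> \<le> \<tau> \<longrightarrow> d y \<in> ball (d x0) \<rho> \<longrightarrow>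
      \<bar>h \<bullet> (d (\<phi> s y) - d y)\<bar> \<le> \<epsilon> * norm (d (\<phi> s y) - d y))"
  using T_cases
proof (elim disjE conjE)
  assume Z: "T = \<int>"
  show thesis
  proof (rule that[of "v (V, d)"])
    show "v (V, d) \<bullet> v (V, d) > 0" using nz by simp
    fix \<epsilon> :: real assume "\<epsilon> > 0"
    have "s = 0" if s: "s \<in> T" "\<bar>s\<bar> \<le> 1 / 2" for s
    proof -
      obtain k :: int where k: "s = of_int k" using s(1) Z Ints_cases by blast
      have "\<bar>real_of_int k\<bar> < 1" using s(2) k by linarith
      then have "k = 0" by linarith
      then show ?thesis using k by simp
    qed
    moreover have "\<phi> 0 y = y" if "y \<in> V" for y using act_0 is_chart_subset[OF chart[OF V(1)]] that by auto
    ultimately have fixed: "\<phi> s y = y" if "s \<in> T" "\<bar>s\<bar> \<le> 1 / 2" "y \<in> V" for s y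
      using that by metis
    show "\<exists>\<tau> \<rho>. \<tau> > 0 \<and> \<rho> > 0 \<and> (\<forall>s\<in>T. \<forall>y\<in>V. \<bar>s\<bar> \<le> \<tau> \<longrightarrow> d y \<in> ball (d x0) \<rho> \<longrightarrow>
      \<bar>v (V, d) \<bullet> (d (\<phi> s y) - d y)\<bar> \<le> \<epsilon> * norm (d (\<phi> s y) - d y))"
      by (intro exI[of _ "1 / 2"] exI[of _ 1] conjI ballI impI) (simp_all add: fixed)
  qed
next
  assume fl: "T = UNIV" "smooth_flow X A \<phi>"
  interpret fl: expanding_flow X A g p F T \<phi> C l by unfold_locales (rule fl)+
  define w where "w = fl.velocity (V, d) x0"
  define u where "u = v (V, d)"
  have w0: "w \<noteq> 0" using fl.velocity_nonzero[OF V] by (simp add: w_def)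
  define h where "h = u - ((u \<bullet> w) / (w \<bullet> w)) *\<^sub>R w"
  have hw: "h \<bullet> w = 0" using w0 by (simp add: h_def inner_diff_left)
  have "h \<bullet> u = h \<bullet> h + ((u \<bullet> w) / (w \<bullet> w)) * (h \<bullet> w)"
    unfolding h_def by (simp add: inner_diff_right inner_diff_left)
  then have hu: "h \<bullet> u = h \<bullet> h" using hw by simp
  have "h \<noteq> 0"
  proof
    assume "h = 0"
    then obtain k where k: "u = k *\<^sub>R w" by (metis h_def right_minus_eq)
    have k0: "k \<noteq> 0" using k nz by (auto simp: u_def)
    have vt: "v \<in> tangent_space A x0" using v unfolding leaf_tangent_space_def by blast
    obtain a P where aP: "leaf_slice X A p F x0 a P" "v a \<in> P"
      using v unfolding leaf_tangent_space_def by blast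
    obtain U c where Uc: "a = (U, c)" by (cases a)
    have a: "(U, c) \<in> A" "x0 \<in> U" "subspace P" using aP(1) leaf_slice_iff Uc by blast+
    have "coord_vector A (V, d) x0 u (U, c) = v (U, c)"
      using tangent_eq_coord[OF V vt] by (simp add: u_def)
    then have vU: "v (U, c) = trans_deriv (V, d) (U, c) x0 u"
      using a by (simp add: coord_vector_apply)
    have "fl.velocity (U, c) x0 = trans_deriv (V, d) (U, c) x0 ((1 / k) *\<^sub>R u)"
      using fl.velocity_change[OF V(1) a(1) V(2) a(2)] k k0 by (simp add: w_def)
    also have "\<dots> = (1 / k) *\<^sub>R v (U, c)"
      using linear_scale[OF trans_linear[OF V(1) a(1) V(2) a(2)]] vU by simp
    finally have "fl.velocity (U, c) x0 \<in> P" using subspace_scale[OF a(3)] aP(2) Uc by simp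
    then have "fl.velocity (U, c) x0 = 0" using fl.velocity_tangent_zero aP(1) Uc by blast
    then show False using fl.velocity_nonzero[OF a(1,2)] by simp
  qed
  show thesis
  proof (rule that[of h])
    show "h \<bullet> v (V, d) > 0" using hu \<open>h \<noteq> 0\<close> by (simp add: u_def)
    fix \<epsilon> :: real assume e: "\<epsilon> > 0"
    obtain \<tau> \<rho> where "\<tau> > 0" "\<rho> > 0" "\<And>s y. \<bar>s\<bar> \<le> \<tau> \<Longrightarrow> y \<in> V \<Longrightarrow> d y \<in> ball (d x0) \<rho> \<Longrightarrow>
      \<bar>h \<bullet> (d (\<phi> s y) - d y)\<bar> \<le> \<epsilon> * norm (d (\<phi> s y) - d y)"
      using fl.flow_cone[OF V _ _ e, of h] w0 hw unfolding w_def by blast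
    then show "\<exists>\<tau> \<rho>. \<tau> > 0 \<and> \<rho> > 0 \<and> (\<forall>s\<in>T. \<forall>y\<in>V. \<bar>s\<bar> \<le> \<tau> \<longrightarrow> d y \<in> ball (d x0) \<rho> \<longrightarrow>
      \<bar>h \<bullet> (d (\<phi> s y) - d y)\<bar> \<le> \<epsilon> * norm (d (\<phi> s y) - d y))" by blast
  qed
qed

lemma local_box_ex:
  assumes x0: "x0 \<in> topspace X"
  obtains V d h K \<kappa> \<rho> \<tau> where "local_box x0 V d h K \<kappa> \<rho> \<tau>"
proof -
  obtain V d e where V: "(V, d) \<in> A" "x0 \<in> V" and e: "continuous_map (subtopology X V) euclidean e"
    "e x0 \<noteq> (0::'e)" and et: "\<And>y. y \<in> V \<Longrightarrow> \<exists>v\<in>leaf_tangent_space X A p F y. v (V, d) = e y"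
    using leaf_direction[OF x0] by blast
  obtain v0 where v0: "v0 \<in> leaf_tangent_space X A p F x0" "v0 (V, d) = e x0" using et[OF V(2)] by blast
  obtain h where h: "h \<bullet> e x0 > 0"
    and cone: "\<And>\<epsilon>. \<epsilon> > 0 \<Longrightarrow> \<exists>\<tau> \<rho>. \<tau> > 0 \<and> \<rho> > 0 \<and> (\<forall>s\<in>T. \<forall>y\<in>V. \<bar>s\<bar> \<le> \<tau> \<longrightarrow> d y \<in> ball (d x0) \<rho> \<longrightarrow>
      \<bar>h \<bullet> (d (\<phi> s y) - d y)\<bar> \<le> \<epsilon> * norm (d (\<phi> s y) - d y))"
    using local_direction[OF V v0(1)] e(2) unfolding v0(2) by blast
  obtain W \<psi> P where W: "x0 \<in> W" "foliated_at W \<psi> P" using foliated_at_ex[OF x0] .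
  have chW: "is_chart X (W, \<psi>)" using W(2) by (simp add: foliated_at_def foliated_chart_def)
  have "open (d ` (V \<inter> W))" by (rule overlap_open[OF chart[OF V(1)] chW])
  then obtain r0 where r0: "r0 > 0" "cball (d x0) r0 \<subseteq> d ` (V \<inter> W)"
    using V(2) W(1) open_contains_cball[of "d ` (V \<inter> W)"] by blast
  then have r0V: "cball (d x0) r0 \<subseteq> d ` V" by blast
  obtain K where K: "K > 0" "\<And>y u. y \<in> V \<Longrightarrow> d y \<in> cball (d x0) r0 \<Longrightarrow>
      norm u \<le> K * cnorm (V, d) y u \<and> cnorm (V, d) y u \<le> K * norm u"
    using cnorm_bounds[OF V(1) compact_cball r0V] by blast
  \<comment> \<open>Half of the value for which the slope condition is an equality at \<open>x0\<close>, so that it persists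
    nearby.\<close>
  define \<kappa>0 where "\<kappa>0 = h \<bullet> e x0 / (2 * K * norm (e x0))"
  have \<kappa>0: "\<kappa>0 > 0" using h K(1) e(2) by (simp add: \<kappa>0_def)
  define f where "f y = h \<bullet> e (inv_into V d y) - \<kappa>0 * K * norm (e (inv_into V d y))" for y
  have opV: "open (d ` V)" using is_chart_open_image chart[OF V(1)] by blast
  have "continuous_map (top_of_set (d ` V)) (subtopology X V) (inv_into V d)"
    using is_chart_inv_cont[OF chart[OF V(1)]] by (auto simp: continuous_map_in_subtopology inv_into_into)
  from continuous_map_compose[OF this e(1)] have "continuous_on (d ` V) (\<lambda>y. e (inv_into V d y))"
    by (simp add: o_def)
  then have fc: "continuous_on (d ` V) f" unfolding f_def by (intro continuous_intros)
  have "f (d x0) = h \<bullet> e x0 / 2" using V e(2) K(1) by (simp add: f_def \<kappa>0_def field_simps)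
  then have fpos: "f (d x0) > 0" using h by simp
  have "open (d ` V \<inter> f -` {0<..})" by (rule continuous_open_preimage[OF fc opV]) simp
  moreover have "d x0 \<in> d ` V \<inter> f -` {0<..}" using fpos V(2) by simp
  ultimately obtain r1 where r1: "r1 > 0" "ball (d x0) r1 \<subseteq> d ` V \<inter> f -` {0<..}"
    unfolding open_contains_ball by blast
  \<comment> \<open>Halving the slope pays for the slack in the cost of climbing.\<close>
  define \<kappa> where "\<kappa> = \<kappa>0 / 2"
  have \<kappa>: "\<kappa> > 0" using \<kappa>0 by (simp add: \<kappa>_def)
  have "\<kappa> / (2 * K) > 0" using \<kappa> K(1) by simp
  then obtain \<tau> r2 where r2: "\<tau> > 0" "r2 > 0"
    "\<forall>s\<in>T. \<forall>y\<in>V. \<bar>s\<bar> \<le> \<tau> \<longrightarrow> d y \<in> ball (d x0) r2 \<longrightarrow>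
      \<bar>h \<bullet> (d (\<phi> s y) - d y)\<bar> \<le> \<kappa> / (2 * K) * norm (d (\<phi> s y) - d y)"
    using cone by blast
  define \<rho> where "\<rho> = min r0 (min r1 r2)"
  have \<rho>: "\<rho> > 0" "\<rho> \<le> r0" "\<rho> \<le> r1" "\<rho> \<le> r2" using r0(1) r1(1) r2(2) by (auto simp: \<rho>_def)
  have bVW: "ball (d x0) \<rho> \<subseteq> d ` (V \<inter> W)" using r0(2) \<rho>(2) by (meson ball_subset_cball order_trans subset_ball)
  have bV: "ball (d x0) \<rho> \<subseteq> d ` V" using bVW by blast
  have KK: "norm u \<le> K * cnorm (V, d) y u" if "y \<in> V" "d y \<in> ball (d x0) \<rho>" for y u
    using K(2)[of y u] that \<rho>(2) by auto
  have lin: "\<exists>v\<in>leaf_tangent_space X A p F y. \<kappa>0 * cnorm (V, d) y (v (V, d)) < h \<bullet> v (V, d)"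
    if y: "y \<in> V" "d y \<in> ball (d x0) \<rho>" for y
  proof -
    obtain v where v: "v \<in> leaf_tangent_space X A p F y" "v (V, d) = e y" using et[OF y(1)] by blast
    have "d y \<in> ball (d x0) r1" using y(2) \<rho>(3) by simp
    then have "f (d y) > 0" using r1(2) by blast
    then have "\<kappa>0 * (K * norm (e y)) < h \<bullet> e y" using V(1) y(1) by (simp add: f_def mult.assoc)
    moreover have "\<kappa>0 * cnorm (V, d) y (e y) \<le> \<kappa>0 * (K * norm (e y))"
      using K(2)[OF y(1), of "e y"] y(2) \<rho>(2) \<kappa>0 by (intro mult_left_mono) auto
    ultimately show ?thesis using v by (intro bexI[of _ v]) auto
  qed
  have "local_box x0 V d h K \<kappa> \<rho> \<tau>"
    unfolding local_box_def
  proof (intro conjI allI impI ballI)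
    show "cball (d x0) \<rho> \<subseteq> d ` V" using r0V \<rho>(2) by (meson order_trans subset_cball)
    show "y \<in> V" "dist (d y) (d x) \<le> K * m"
      if "reach m x y" "x \<in> V" "dist (d x) (d x0) + K * m < \<rho>" for x y m
      using reach_ball[OF V(1) bV K(1) KK that] by auto
    show "\<bar>h \<bullet> (d (\<phi> s y) - d y)\<bar> \<le> \<kappa> / (2 * K) * norm (d (\<phi> s y) - d y)"
      if "s \<in> T" "y \<in> V" "\<bar>s\<bar> \<le> \<tau>" "dist (d y) (d x0) < \<rho>" for s y
      using r2(3) that \<rho>(4) by (auto simp: dist_commute)
    fix x \<sigma> assume x: "x \<in> V" "\<sigma> > 0" "dist (d x) (d x0) + K / \<kappa> * \<sigma> < \<rho>"
    have "K / \<kappa>0 * \<sigma> \<le> K / \<kappa> * \<sigma>"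
      using K(1) \<kappa>0 x(2) by (simp add: \<kappa>_def field_simps)
    then have x': "dist (d x) (d x0) + K / \<kappa>0 * \<sigma> < \<rho>" using x(3) by linarith
    obtain z where z: "z \<in> V" "h \<bullet> (d z - d x) = \<sigma>"
      "\<And>\<epsilon>. \<epsilon> > 0 \<Longrightarrow> \<exists>l. reach l x z \<and> \<kappa>0 * l \<le> \<sigma> + \<epsilon>"
      by (rule leaf_advance[OF V(1) bVW W(2) K(1) KK \<kappa>0 lin x(1) x' less_imp_le[OF x(2)]]) blast+
    obtain m where m: "reach m x z" "\<kappa>0 * m \<le> \<sigma> + \<sigma>" using z(3)[OF x(2)] by blast
    then have "\<kappa> * m \<le> \<sigma>" by (simp add: \<kappa>_def)
    then show "\<exists>z m. z \<in> V \<and> reach m x z \<and> \<kappa> * m \<le> \<sigma> \<and> h \<bullet> (d z - d x) = \<sigma>" using z m by blast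
  qed (use V K \<kappa> \<rho> r2 in auto)
  then show thesis by (rule that)
qed

text \<open>Climbing \<open>n\<close> times by \<open>\<sigma>\<close>. The displacement between any two points of the chain, not only
  consecutive ones, lies in the cone around the leaf direction, because heights and cost bounds
  add up.\<close>

lemma box_chain:
  assumes box: "local_box x0 V d h K \<kappa> \<rho> \<tau>" and x: "x \<in> V" and \<sigma>: "\<sigma> > 0"
    and far: "dist (d x) (d x0) + K / \<kappa> * (real n * \<sigma>) < \<rho>"
  obtains z where "\<And>j. j \<le> n \<Longrightarrow> z j \<in> V \<and> reach (real j * \<sigma> / \<kappa>) x (z j)"
    "\<And>i j. i \<le> j \<Longrightarrow> j \<le> n \<Longrightarrow> h \<bullet> (d (z j) - d (z i)) = real (j - i) * \<sigma> \<and>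
       dist (d (z j)) (d (z i)) \<le> K / \<kappa> * (real (j - i) * \<sigma>)"
proof -
  have B: "(V, d) \<in> A" "K > 0" "\<kappa> > 0"
    and B1: "\<And>x y m. reach m x y \<Longrightarrow> x \<in> V \<Longrightarrow> dist (d x) (d x0) + K * m < \<rho> \<Longrightarrow>
       y \<in> V \<and> dist (d y) (d x) \<le> K * m"
    and B2: "\<And>x \<sigma>. x \<in> V \<Longrightarrow> \<sigma> > 0 \<Longrightarrow> dist (d x) (d x0) + K / \<kappa> * \<sigma> < \<rho> \<Longrightarrow>
       \<exists>z m. z \<in> V \<and> reach m x z \<and> \<kappa> * m \<le> \<sigma> \<and> h \<bullet> (d z - d x) = \<sigma>"
    using box unfolding local_box_def by blast+
  have xX: "x \<in> topspace X" using x is_chart_subset[OF chart[OF B(1)]] by blast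
  define q where "q = K / \<kappa> * \<sigma>"
  have q: "q > 0" using B \<sigma> by (simp add: q_def)
  have far': "dist (d x) (d x0) + real n * q < \<rho>" using far by (simp add: q_def mult.left_commute)
  define P where "P = (\<lambda>(j::nat) z. j \<le> n \<longrightarrow> z \<in> V \<and> reach (real j * \<sigma> / \<kappa>) x z \<and> dist (d z) (d x) \<le> real j * q)"
  define Q where "Q = (\<lambda>(j::nat) z z'. j < n \<longrightarrow> h \<bullet> (d z' - d z) = \<sigma> \<and> dist (d z') (d z) \<le> q)"
  have "\<exists>f. \<forall>j. P j (f j) \<and> Q j (f j) (f (Suc j))"
  proof (rule dependent_nat_choice)
    show "\<exists>z. P 0 z" using x reach_refl[OF xX, of 0] by (intro exI[of _ x]) (simp add: P_def)
    fix z j assume Pj: "P j z"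
    show "\<exists>z'. P (Suc j) z' \<and> Q j z z'"
    proof (cases "j < n")
      case False
      then show ?thesis by (simp add: P_def Q_def)
    next
      case True
      then have z: "z \<in> V" "reach (real j * \<sigma> / \<kappa>) x z" "dist (d z) (d x) \<le> real j * q"
        using Pj by (auto simp: P_def)
      have "real (Suc j) * q \<le> real n * q" using True q by (intro mult_right_mono) auto
      then have jn: "real j * q + q \<le> real n * q" by (simp add: distrib_right)
      have zd: "dist (d z) (d x0) + q < \<rho>"
        using z(3) jn far' dist_triangle[of "d z" "d x0" "d x"] by linarith
      obtain z' m where z': "z' \<in> V" "reach m z z'" "\<kappa> * m \<le> \<sigma>" "h \<bullet> (d z' - d z) = \<sigma>"
        using B2[OF z(1) \<sigma>] zd unfolding q_def by blast
      have "K * m = K / \<kappa> * (\<kappa> * m)" using B by simp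
      also have "\<dots> \<le> q" unfolding q_def using z'(3) B by (intro mult_left_mono) auto
      finally have Km: "K * m \<le> q" .
      have d': "dist (d z') (d z) \<le> q" using B1[OF z'(2) z(1)] zd Km by linarith
      have "m \<le> \<sigma> / \<kappa>" using z'(3) B by (simp add: field_simps)
      then have "real j * \<sigma> / \<kappa> + m \<le> real (Suc j) * \<sigma> / \<kappa>" by (simp add: distrib_right add_divide_distrib)
      then have "reach (real (Suc j) * \<sigma> / \<kappa>) x z'" using reach_mono[OF reach_trans[OF z'(2) z(2)]] by blast
      moreover have "dist (d z') (d x) \<le> real (Suc j) * q"
        using d' z(3) dist_triangle[of "d z'" "d x" "d z"] by (simp add: distrib_right)
      ultimately show ?thesis using z' d' by (auto simp: P_def Q_def)
    qed
  qed
  then obtain z where z: "\<And>j. P j (z j)" "\<And>j. Q j (z j) (z (Suc j))" by blast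
  show thesis
  proof (rule that[of z])
    show "z j \<in> V \<and> reach (real j * \<sigma> / \<kappa>) x (z j)" if "j \<le> n" for j
      using z(1)[of j] that by (simp add: P_def)
    fix i j assume ij: "i \<le> j" "j \<le> n"
    have "h \<bullet> (d (z (i + k)) - d (z i)) = real k * \<sigma> \<and> dist (d (z (i + k))) (d (z i)) \<le> real k * q"
      if "i + k \<le> n" for k
      using that
    proof (induction k)
      case 0 then show ?case by simp
    next
      case (Suc k)
      then have IH: "h \<bullet> (d (z (i + k)) - d (z i)) = real k * \<sigma>" "dist (d (z (i + k))) (d (z i)) \<le> real k * q"
        by auto
      have st: "h \<bullet> (d (z (i + Suc k)) - d (z (i + k))) = \<sigma>" "dist (d (z (i + Suc k))) (d (z (i + k))) \<le> q"
        using z(2)[of "i + k"] Suc.prems by (auto simp: Q_def)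
      have "h \<bullet> (d (z (i + Suc k)) - d (z i)) = real (Suc k) * \<sigma>"
        using IH(1) st(1) by (simp add: inner_diff_right distrib_right)
      moreover have "dist (d (z (i + Suc k))) (d (z i)) \<le> real (Suc k) * q"
        using IH(2) st(2) dist_triangle[of "d (z (i + Suc k))" "d (z i)" "d (z (i + k))"]
        by (simp add: distrib_right)
      ultimately show ?case by blast
    qed
    from this[of "j - i"] ij show "h \<bullet> (d (z j) - d (z i)) = real (j - i) * \<sigma> \<and>
       dist (d (z j)) (d (z i)) \<le> K / \<kappa> * (real (j - i) * \<sigma>)"
      by (simp add: q_def mult.left_commute)
  qed
qed

end


section \<open>Leaf points whose small leaf neighbourhoods avoid a finite set of orbit segments\<close>

lemma exp_beats_linear:
  fixes C l \<alpha> \<beta> :: real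
  assumes "C > 0" "l > 1"
  obtains n where "n \<ge> 1" "\<alpha> + \<beta> * real n \<le> C * l ^ n"
proof -
  have n1: "norm (1 / l) < 1" using assms by simp
  have "(\<lambda>n. \<alpha> * (1 / l) ^ n + \<beta> * (of_nat n * (1 / l) ^ n)) \<longlonglongrightarrow> \<alpha> * 0 + \<beta> * 0"
    by (intro tendsto_intros powser_times_n_limit_0 LIMSEQ_power_zero n1)
  then have "\<forall>\<^sub>F n in sequentially. \<alpha> * (1 / l) ^ n + \<beta> * (of_nat n * (1 / l) ^ n) < C"
    using order_tendstoD(2) assms(1) by fastforce
  then have "\<forall>\<^sub>F n in sequentially. \<alpha> * (1 / l) ^ n + \<beta> * (of_nat n * (1 / l) ^ n) < C \<and> n \<ge> 1"
    using eventually_ge_at_top eventually_conj by blast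
  then obtain n where n: "\<alpha> * (1 / l) ^ n + \<beta> * (real n * (1 / l) ^ n) < C" "n \<ge> 1"
    using eventually_happens'[OF sequentially_bot] by blast
  have "l ^ n > 0" using assms by simp
  have "\<alpha> * (1 / l) ^ n + \<beta> * (real n * (1 / l) ^ n) = (\<alpha> + \<beta> * real n) / l ^ n"
    by (simp add: power_one_over add_divide_distrib)
  then have "(\<alpha> + \<beta> * real n) / l ^ n < C" using n(1) by simp
  then have "\<alpha> + \<beta> * real n \<le> C * l ^ n"
    using \<open>l ^ n > 0\<close> by (simp add: pos_divide_less_eq)
  then show thesis using that n(2) by blast
qed

context expanding_action
begin

text \<open>The displacement between two points on one short orbit segment is flat, the one between two
  points of a chain is steep. If the points are pairwise \<open>e\<close>-close, the height difference \<open>\<Delta>\<close> must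
  be of the order of \<open>e\<close>.\<close>

lemma box_separation:
  assumes box: "local_box x0 V d h K \<kappa> \<rho> \<tau>"
    and z: "h \<bullet> (d z' - d z) = \<Delta>" "dist (d z') (d z) \<le> K / \<kappa> * \<Delta>"
    and \<gamma>: "\<gamma> \<in> V" "dist (d \<gamma>) (d x0) < \<rho>" "s \<in> T" "\<bar>s\<bar> \<le> \<tau>"
    and close: "dist (d \<gamma>) (d z) \<le> e" "dist (d (\<phi> s \<gamma>)) (d z') \<le> e"
  shows "\<Delta> \<le> 2 * (2 * norm h + \<kappa> / K) * e"
proof -
  have K: "K > 0" "\<kappa> > 0" using box unfolding local_box_def by blast+
  have cone: "\<bar>h \<bullet> (d (\<phi> s \<gamma>) - d \<gamma>)\<bar> \<le> \<kappa> / (2 * K) * norm (d (\<phi> s \<gamma>) - d \<gamma>)"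
    using box \<gamma> unfolding local_box_def by blast
  have "norm (d (\<phi> s \<gamma>) - d \<gamma>) \<le> K / \<kappa> * \<Delta> + 2 * e"
    using dist_triangle[of "d (\<phi> s \<gamma>)" "d \<gamma>" "d z'"] dist_triangle[of "d z'" "d \<gamma>" "d z"] close z(2)
    by (simp add: dist_norm norm_minus_commute)
  then have "\<kappa> / (2 * K) * norm (d (\<phi> s \<gamma>) - d \<gamma>) \<le> \<kappa> / (2 * K) * (K / \<kappa> * \<Delta> + 2 * e)"
    using K by (intro mult_left_mono) auto
  also have "\<dots> = \<Delta> / 2 + \<kappa> / K * e" using K by (simp add: field_simps)
  finally have 1: "\<bar>h \<bullet> (d (\<phi> s \<gamma>) - d \<gamma>)\<bar> \<le> \<Delta> / 2 + \<kappa> / K * e" using cone by linarith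
  have "\<bar>h \<bullet> (d (\<phi> s \<gamma>) - d z')\<bar> \<le> norm h * e"
    using Cauchy_Schwarz_ineq2[of h "d (\<phi> s \<gamma>) - d z'"] close(2)
      mult_left_mono[of "norm (d (\<phi> s \<gamma>) - d z')" e "norm h"] by (simp add: dist_norm)
  moreover have "\<bar>h \<bullet> (d \<gamma> - d z)\<bar> \<le> norm h * e"
    using Cauchy_Schwarz_ineq2[of h "d \<gamma> - d z"] close(1)
      mult_left_mono[of "norm (d \<gamma> - d z)" e "norm h"] by (simp add: dist_norm)
  moreover have "h \<bullet> (d (\<phi> s \<gamma>) - d \<gamma>) = \<Delta> + h \<bullet> (d (\<phi> s \<gamma>) - d z') - h \<bullet> (d \<gamma> - d z)"
    using z(1) by (simp add: inner_diff_right)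
  ultimately have "\<Delta> \<le> \<Delta> / 2 + \<kappa> / K * e + 2 * (norm h * e)" using 1 by linarith
  then show ?thesis by (simp add: distrib_left distrib_right)
qed

text \<open>The orbit segments of \<open>Q\<close> during the time \<open>n\<close> are cut into about \<open>card Q * n / \<tau>\<close> pieces of
  duration \<open>\<tau>\<close>. From every point one can reach a chain with more points than there are pieces, at
  a cost \<open>R\<close> that depends neither on the point nor on \<open>n\<close>, and with spacing of the order of \<open>1 / n\<close>.
  Each piece comes near at most one point of the chain, so by the pigeonhole principle some point of
  the chain has a leafwise \<open>r\<close>-ball away from all pieces, with \<open>r\<close> of the order of \<open>1 / n\<close>. Since
  the expansion in time \<open>n\<close> is exponential in \<open>n\<close>, it exceeds \<open>(R + r) / r\<close> for suitable \<open>n\<close>.\<close>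

lemma avoiding_neighbourhood:
  assumes Q: "finite Q" "Q \<subseteq> topspace X"
  obtains n R r N where "n \<ge> 1" "r > 0" "R \<ge> 0" "(R + r) / (C * l ^ n) \<le> r" "openin X N"
    "\<And>q s. q \<in> Q \<Longrightarrow> s \<in> T \<Longrightarrow> 0 \<le> s \<Longrightarrow> s \<le> real n \<Longrightarrow> \<phi> (- s) q \<in> N"
    "\<And>x. x \<in> topspace X \<Longrightarrow> \<exists>x'. reach R x x' \<and> (\<forall>y. reach r x' y \<longrightarrow> y \<notin> N)"
proof -
  define Rel where "Rel = (\<lambda>x0 S. \<exists>V d h K \<kappa> \<rho> \<tau>. local_box x0 V d h K \<kappa> \<rho> \<tau> \<and> S = {x\<in>V. d x \<in> ball (d x0) (\<rho> / 2)})"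
  have ex: "\<exists>S. openin X S \<and> x \<in> S \<and> Rel x S" if x: "x \<in> topspace X" for x
  proof -
    obtain V d h K \<kappa> \<rho> \<tau> where b: "local_box x V d h K \<kappa> \<rho> \<tau>" using local_box_ex[OF x] .
    have V: "(V, d) \<in> A" "x \<in> V" "\<rho> > 0" using b unfolding local_box_def by blast+
    have "openin X {y\<in>V. d y \<in> ball (d x) (\<rho> / 2)}"
      by (rule is_chart_openin_preimage[OF chart[OF V(1)] open_ball])
    moreover have "x \<in> {y\<in>V. d y \<in> ball (d x) (\<rho> / 2)}" using V by simp
    moreover have "Rel x {y\<in>V. d y \<in> ball (d x) (\<rho> / 2)}" unfolding Rel_def using b by blast
    ultimately show ?thesis by blast
  qed
  obtain I S where IS: "finite I" "I \<subseteq> topspace X" "topspace X \<subseteq> \<Union>(S ` I)"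
    "\<And>i. i \<in> I \<Longrightarrow> openin X (S i) \<and> Rel i (S i)"
    using compact_space_finite_cover[OF compact, of Rel] ex by blast
  have "\<forall>i\<in>I. \<exists>b. case b of (V, d, h, K, \<kappa>, \<rho>, \<tau>) \<Rightarrow>
      local_box i V d h K \<kappa> \<rho> \<tau> \<and> S i = {x\<in>V. d x \<in> ball (d i) (\<rho> / 2)}"
    using IS(4) unfolding Rel_def by (fastforce)
  from bchoice[OF this] obtain b where b: "\<forall>i\<in>I. case b i of (V, d, h, K, \<kappa>, \<rho>, \<tau>) \<Rightarrow>
      local_box i V d h K \<kappa> \<rho> \<tau> \<and> S i = {x\<in>V. d x \<in> ball (d i) (\<rho> / 2)}" ..
  define V where "V i = fst (b i)" for i
  define d where "d i = fst (snd (b i))" for i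
  define h where "h i = fst (snd (snd (b i)))" for i
  define K where "K i = fst (snd (snd (snd (b i))))" for i
  define \<kappa> where "\<kappa> i = fst (snd (snd (snd (snd (b i)))))" for i
  define \<rho> where "\<rho> i = fst (snd (snd (snd (snd (snd (b i))))))" for i
  define \<tau>i where "\<tau>i i = snd (snd (snd (snd (snd (snd (b i))))))" for i
  have box: "local_box i (V i) (d i) (h i) (K i) (\<kappa> i) (\<rho> i) (\<tau>i i)"
    and Si: "S i = {x\<in>V i. d i x \<in> ball (d i i) (\<rho> i / 2)}" if "i \<in> I" for i
    using b[rule_format, OF that]
    by (simp_all add: V_def d_def h_def K_def \<kappa>_def \<rho>_def \<tau>i_def case_prod_unfold)
  have pos: "(V i, d i) \<in> A" "K i > 0" "\<kappa> i > 0" "\<rho> i > 0" "\<tau>i i > 0" "cball (d i i) (\<rho> i) \<subseteq> d i ` V i"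
    if "i \<in> I" for i
    using box[OF that] unfolding local_box_def by blast+
  \<comment> \<open>\<open>\<eta> i\<close> is the total height of a chain: it moves the point by a quarter of the radius of the box.
    \<open>\<beta> i / m\<close> is the radius of leafwise balls that the points of a chain of \<open>m\<close> steps can afford: it
    makes the bound of the separation lemma, with \<open>e = 2 * K i * r\<close>, half of the spacing.\<close>
  define \<eta> where "\<eta> i = \<kappa> i * \<rho> i / (4 * K i)" for i
  define \<beta> where "\<beta> i = \<eta> i / (4 * K i * (2 * (2 * norm (h i) + \<kappa> i / K i)))" for i
  have \<eta>: "\<eta> i > 0" "K i / \<kappa> i * \<eta> i = \<rho> i / 4" if "i \<in> I" for i
    using pos[OF that] by (simp_all add: \<eta>_def)
  have \<beta>: "\<beta> i > 0" if "i \<in> I" for i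
    unfolding \<beta>_def using pos[OF that] \<eta>(1)[OF that]
    by (intro divide_pos_pos mult_pos_pos add_nonneg_pos) auto
  define \<tau> where "\<tau> = Min (insert 1 (\<tau>i ` I))"
  define a where "a = Min (insert 1 ((\<lambda>i. min (\<beta> i) (\<rho> i / (8 * K i))) ` I))"
  define R where "R = Max (insert 0 ((\<lambda>i. \<eta> i / \<kappa> i) ` I))"
  have \<tau>: "\<tau> > 0" "\<And>i. i \<in> I \<Longrightarrow> \<tau> \<le> \<tau>i i"
    using IS(1) pos by (auto simp: \<tau>_def)
  have a: "a > 0" "\<And>i. i \<in> I \<Longrightarrow> a \<le> \<beta> i" "\<And>i. i \<in> I \<Longrightarrow> a \<le> \<rho> i / (8 * K i)"
  proof -
    show "a > 0" unfolding a_def using IS(1) pos \<beta> by (subst Min_gr_iff) auto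
    have "a \<le> min (\<beta> i) (\<rho> i / (8 * K i))" if "i \<in> I" for i
      unfolding a_def using IS(1) that by (intro Min_le) auto
    then show "\<And>i. i \<in> I \<Longrightarrow> a \<le> \<beta> i" "\<And>i. i \<in> I \<Longrightarrow> a \<le> \<rho> i / (8 * K i)" by fastforce+
  qed
  have R: "R \<ge> 0" "\<And>i. i \<in> I \<Longrightarrow> \<eta> i / \<kappa> i \<le> R"
    unfolding R_def using IS(1) by auto
  \<comment> \<open>With \<open>m\<close> and \<open>r\<close> as defined below this implies \<open>1 + R / r \<le> C * l ^ n\<close>: the left side bounds
    \<open>1 + R / a * m\<close>, as \<open>m\<close> is at most \<open>card Q * (n / \<tau> + 1) + 1\<close>.\<close>
  obtain n where n: "n \<ge> 1" "(1 + R / a * (real (card Q) + 1)) + (R / a * real (card Q) / \<tau>) * real n \<le> C * l ^ n"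
    using exp_beats_linear[OF C_pos l_gt] by blast
  define m where "m = card Q * (nat \<lfloor>real n / \<tau>\<rfloor> + 1) + 1"
  have m1: "m \<ge> 1" by (simp add: m_def)
  define r where "r = a / real m"
  have r: "r > 0" "r \<le> a" using a(1) m1 by (simp_all add: r_def field_simps)
  have contr: "(R + r) / (C * l ^ n) \<le> r"
  proof -
    define w where "w = nat \<lfloor>real n / \<tau>\<rfloor>"
    have "real w \<le> real n / \<tau>" using \<tau>(1) by (simp add: w_def)
    then have "real (card Q) * (real w + 1) \<le> real (card Q) * (real n / \<tau> + 1)"
      by (intro mult_left_mono) auto
    moreover have "real m = real (card Q) * (real w + 1) + 1"
      unfolding m_def w_def[symmetric] by (simp add: distrib_left)
    ultimately have "real m \<le> real (card Q) * (real n / \<tau> + 1) + 1" by linarith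
    then have "R / a * real m \<le> R / a * (real (card Q) * (real n / \<tau> + 1) + 1)"
      using R(1) a(1) by (intro mult_left_mono) auto
    also have "\<dots> = R / a * (real (card Q) + 1) + (R / a * real (card Q) / \<tau>) * real n"
      by (simp add: algebra_simps)
    finally have "1 + R / a * real m \<le> C * l ^ n" using n(2) by linarith
    then have "r * (1 + R / a * real m) \<le> r * (C * l ^ n)" using r(1) by (intro mult_left_mono) auto
    moreover have "r * (1 + R / a * real m) = R + r"
      using a(1) m1 by (simp add: r_def distrib_left)
    moreover have "C * l ^ n > 0" using C_pos l_gt by simp
    ultimately show ?thesis by (simp add: pos_divide_le_eq)
  qed
  define \<Gamma> where "\<Gamma> = {\<phi> (- s) q | s q. q \<in> Q \<and> s \<in> T \<and> 0 \<le> s \<and> s \<le> real n}"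
  \<comment> \<open>The neighbourhood of the orbit segments is the complement of finitely many compact sets, which
    are defined in coordinates.\<close>
  define good where "good i = {y\<in>V i. d i y \<in> cball (d i i) (7 / 8 * \<rho> i) \<inter>
      (\<Inter>\<gamma>\<in>{\<gamma>\<in>\<Gamma>. \<gamma> \<in> V i \<and> dist (d i \<gamma>) (d i i) < \<rho> i}. {w. K i * r \<le> dist w (d i \<gamma>)})}" for i
  define N where "N = topspace X - (\<Union>i\<in>I. good i)"
  have good_closed: "closedin X (good i)" if i: "i \<in> I" for i
    unfolding good_def
  proof (rule compact_ball_closedin[OF pos(1)[OF i]])
    have "closed {w. K i * r \<le> dist w (d i \<gamma>)}" for \<gamma>
      by (intro closed_Collect_le continuous_intros)
    then show "compact (cball (d i i) (7 / 8 * \<rho> i) \<inter>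
        (\<Inter>\<gamma>\<in>{\<gamma>\<in>\<Gamma>. \<gamma> \<in> V i \<and> dist (d i \<gamma>) (d i i) < \<rho> i}. {w. K i * r \<le> dist w (d i \<gamma>)}))"
      by (intro compact_Int_closed compact_cball closed_INT) blast
    have "cball (d i i) (7 / 8 * \<rho> i) \<subseteq> cball (d i i) (\<rho> i)" using pos(4)[OF i] by (intro subset_cball) simp
    then show "cball (d i i) (7 / 8 * \<rho> i) \<inter>
        (\<Inter>\<gamma>\<in>{\<gamma>\<in>\<Gamma>. \<gamma> \<in> V i \<and> dist (d i \<gamma>) (d i i) < \<rho> i}. {w. K i * r \<le> dist w (d i \<gamma>)}) \<subseteq> d i ` V i"
      using pos(6)[OF i] by blast
  qed
  have N_open: "openin X N"
    unfolding N_def using good_closed IS(1) by (intro openin_diff openin_topspace closedin_Union) auto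
  have \<Gamma>X: "\<Gamma> \<subseteq> topspace X" using act_in T_closed(3) Q(2) unfolding \<Gamma>_def by blast
  have \<Gamma>N: "\<gamma> \<in> N" if \<gamma>: "\<gamma> \<in> \<Gamma>" for \<gamma>
  proof -
    have "\<gamma> \<notin> good i" if i: "i \<in> I" for i
    proof
      assume g: "\<gamma> \<in> good i"
      then have gv: "\<gamma> \<in> V i" "d i \<gamma> \<in> cball (d i i) (7 / 8 * \<rho> i)" by (simp_all add: good_def)
      then have "dist (d i \<gamma>) (d i i) < \<rho> i"
        using pos(4)[OF i] unfolding mem_cball dist_commute[of "d i i"] by linarith
      then have "K i * r \<le> dist (d i \<gamma>) (d i \<gamma>)" using g gv(1) \<gamma> unfolding good_def by blast
      moreover have "K i * r > 0" using pos(2)[OF i] r(1) by simp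
      ultimately show False by simp
    qed
    then show ?thesis using \<Gamma>X \<gamma> unfolding N_def by blast
  qed
  have main: "\<exists>x'. reach R x x' \<and> (\<forall>y. reach r x' y \<longrightarrow> y \<notin> N)" if x: "x \<in> topspace X" for x
  proof -
    obtain i where i: "i \<in> I" "x \<in> S i" using x IS(3) by blast
    have xV: "x \<in> V i" "dist (d i x) (d i i) < \<rho> i / 2"
      using i(2) Si[OF i(1)] by (auto simp: dist_commute)
    define \<sigma> where "\<sigma> = \<eta> i / real m"
    have \<sigma>: "\<sigma> > 0" "real m * \<sigma> = \<eta> i" using \<eta>[OF i(1)] m1 by (simp_all add: \<sigma>_def)
    have far: "dist (d i x) (d i i) + K i / \<kappa> i * (real m * \<sigma>) < \<rho> i"
      using xV(2) \<eta>(2)[OF i(1)] \<sigma>(2) pos(4)[OF i(1)] by simp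
    obtain z where z: "\<And>j. j \<le> m \<Longrightarrow> z j \<in> V i \<and> reach (real j * \<sigma> / \<kappa> i) x (z j)"
      and zz: "\<And>j k. j \<le> k \<Longrightarrow> k \<le> m \<Longrightarrow> h i \<bullet> (d i (z k) - d i (z j)) = real (k - j) * \<sigma> \<and>
         dist (d i (z k)) (d i (z j)) \<le> K i / \<kappa> i * (real (k - j) * \<sigma>)"
      using box_chain[OF box[OF i(1)] xV(1) \<sigma>(1) far] by metis
    have reachR: "reach R x (z j)" if j: "j \<le> m" for j
    proof -
      have "real j * \<sigma> \<le> \<eta> i" unfolding \<sigma>(2)[symmetric] using j \<sigma>(1) by (intro mult_right_mono) auto
      then have "real j * \<sigma> / \<kappa> i \<le> \<eta> i / \<kappa> i" using pos(3)[OF i(1)] by (intro divide_right_mono) auto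
      then show ?thesis using z[OF j] R(2)[OF i(1)] reach_mono by (meson order_trans)
    qed
    have zx: "dist (d i (z j)) (d i x) \<le> \<rho> i / 4" if j: "j \<le> m" for j
    proof -
      have Rj: "K i * (real j * \<sigma> / \<kappa> i) \<le> \<rho> i / 4"
      proof -
        have "real j * \<sigma> \<le> \<eta> i" unfolding \<sigma>(2)[symmetric] using j \<sigma>(1) by (intro mult_right_mono) auto
        then have "K i / \<kappa> i * (real j * \<sigma>) \<le> K i / \<kappa> i * \<eta> i"
          using pos[OF i(1)] by (intro mult_left_mono) auto
        moreover have "K i * (real j * \<sigma> / \<kappa> i) = K i / \<kappa> i * (real j * \<sigma>)" by simp
        ultimately show ?thesis using \<eta>(2)[OF i(1)] by linarith
      qed
      have "dist (d i x) (d i i) + K i * (real j * \<sigma> / \<kappa> i) < \<rho> i"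
        using Rj xV(2) pos(4)[OF i(1)] by linarith
      then have "dist (d i (z j)) (d i x) \<le> K i * (real j * \<sigma> / \<kappa> i)"
        using box[OF i(1)] z[OF j] xV(1) unfolding local_box_def by blast
      then show ?thesis using Rj by linarith
    qed
    have Kr: "K i * r \<le> \<rho> i / 8"
    proof -
      have "K i * r \<le> K i * (\<rho> i / (8 * K i))"
        using r(2) a(3)[OF i(1)] pos(2)[OF i(1)] by (intro mult_left_mono) auto
      then show ?thesis using pos(2)[OF i(1)] by simp
    qed
    have y_close: "y \<in> V i \<and> dist (d i y) (d i (z j)) \<le> K i * r \<and> d i y \<in> cball (d i i) (7 / 8 * \<rho> i)"
      if j: "j \<le> m" and y: "reach r (z j) y" for j y
    proof -
      have zi: "dist (d i (z j)) (d i i) < 3 / 4 * \<rho> i"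
        using zx[OF j] xV(2) dist_triangle[of "d i (z j)" "d i i" "d i x"] by linarith
      have "dist (d i (z j)) (d i i) + K i * r < \<rho> i" using zi Kr pos(4)[OF i(1)] by linarith
      then have yV: "y \<in> V i" "dist (d i y) (d i (z j)) \<le> K i * r"
        using box[OF i(1)] z[OF j] y unfolding local_box_def by blast+
      have "dist (d i y) (d i i) \<le> 7 / 8 * \<rho> i"
        using yV(2) Kr zi dist_triangle[of "d i y" "d i i" "d i (z j)"] by linarith
      then show ?thesis using yV by (simp add: dist_commute)
    qed
    have "\<exists>j\<le>m. \<forall>y. reach r (z j) y \<longrightarrow> y \<in> good i"
    proof (rule ccontr)
      assume neg: "\<not> ?thesis"
      define near where "near j = (\<lambda>(q, s). q \<in> Q \<and> s \<in> T \<and> 0 \<le> s \<and> s \<le> real n \<and> \<phi> (- s) q \<in> V i \<and>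
        dist (d i (\<phi> (- s) q)) (d i i) < \<rho> i \<and> dist (d i (\<phi> (- s) q)) (d i (z j)) \<le> 2 * (K i * r))" for j
      have "\<exists>qs. near j qs" if j: "j \<le> m" for j
      proof -
        obtain y where y: "reach r (z j) y" "y \<notin> good i" using neg j by blast
        then obtain \<gamma> where \<gamma>: "\<gamma> \<in> \<Gamma>" "\<gamma> \<in> V i" "dist (d i \<gamma>) (d i i) < \<rho> i" "\<not> K i * r \<le> dist (d i y) (d i \<gamma>)"
          using y_close[OF j y(1)] unfolding good_def by blast
        obtain q s where qs: "q \<in> Q" "s \<in> T" "0 \<le> s" "s \<le> real n" "\<gamma> = \<phi> (- s) q"
          using \<gamma>(1) unfolding \<Gamma>_def by blast
        have "dist (d i \<gamma>) (d i (z j)) \<le> 2 * (K i * r)"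
          using \<gamma>(4) y_close[OF j y(1)] dist_triangle[of "d i \<gamma>" "d i (z j)" "d i y"]
          by (simp add: dist_commute)
        then show ?thesis using qs \<gamma> by (intro exI[of _ "(q, s)"]) (simp add: near_def)
      qed
      then have "\<forall>j\<in>{..m}. \<exists>qs. near j qs" by simp
      from bchoice[OF this] obtain qs where "\<forall>j\<in>{..m}. near j (qs j)" ..
      then have qs: "\<forall>j\<in>{..m}. fst (qs j) \<in> Q \<and> snd (qs j) \<in> T \<and>
          0 \<le> snd (qs j) \<and> snd (qs j) \<le> real n \<and>
          \<phi> (- snd (qs j)) (fst (qs j)) \<in> V i \<and> dist (d i (\<phi> (- snd (qs j)) (fst (qs j)))) (d i i) < \<rho> i \<and>
          dist (d i (\<phi> (- snd (qs j)) (fst (qs j)))) (d i (z j)) \<le> 2 * (K i * r)"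
        by (simp add: near_def case_prod_unfold)
      define f where "f j = (fst (qs j), nat \<lfloor>snd (qs j) / \<tau>\<rfloor>)" for j
      have "f ` {..m} \<subseteq> Q \<times> {..nat \<lfloor>real n / \<tau>\<rfloor>}"
      proof
        fix w assume "w \<in> f ` {..m}"
        then obtain j where j: "j \<in> {..m}" "w = f j" by blast
        have "snd (qs j) / \<tau> \<le> real n / \<tau>" using qs j(1) \<tau>(1) by (intro divide_right_mono) auto
        then have "nat \<lfloor>snd (qs j) / \<tau>\<rfloor> \<le> nat \<lfloor>real n / \<tau>\<rfloor>" by (intro nat_mono floor_mono)
        then show "w \<in> Q \<times> {..nat \<lfloor>real n / \<tau>\<rfloor>}" using qs j by (simp add: f_def)
      qed
      then have "card (f ` {..m}) \<le> card (Q \<times> {..nat \<lfloor>real n / \<tau>\<rfloor>})"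
        using Q(1) by (intro card_mono) auto
      also have "\<dots> < card {..m}" by (simp add: m_def card_cartesian_product)
      finally have "\<not> inj_on f {..m}" by (rule pigeonhole)
      then obtain j1 j2 where j12: "j1 \<le> m" "j2 \<le> m" "f j1 = f j2" "j1 \<noteq> j2"
        unfolding inj_on_def by auto
      define j where "j = min j1 j2"
      define k where "k = max j1 j2"
      have jk: "j < k" "k \<le> m" "j \<le> m" "f j = f k"
        using j12 by (auto simp: j_def k_def min_def max_def)
      define q where "q = fst (qs j)"
      define s where "s = snd (qs j)"
      define s' where "s' = snd (qs k)"
      have qk: "fst (qs k) = q" using jk(4) by (simp add: f_def q_def)
      have fl: "nat \<lfloor>s / \<tau>\<rfloor> = nat \<lfloor>s' / \<tau>\<rfloor>" using jk(4) by (simp add: f_def s_def s'_def)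
      have J: "q \<in> Q" "s \<in> T" "0 \<le> s" "\<phi> (- s) q \<in> V i" "dist (d i (\<phi> (- s) q)) (d i i) < \<rho> i"
        "dist (d i (\<phi> (- s) q)) (d i (z j)) \<le> 2 * (K i * r)"
        using qs jk(3) by (auto simp: q_def s_def)
      have J': "s' \<in> T" "0 \<le> s'" "dist (d i (\<phi> (- s') q)) (d i (z k)) \<le> 2 * (K i * r)"
        using qs jk(2) qk by (auto simp: s'_def)
      have "\<lfloor>s / \<tau>\<rfloor> = \<lfloor>s' / \<tau>\<rfloor>" using fl J(3) J'(2) \<tau>(1) by (simp add: eq_nat_nat_iff)
      then have "\<bar>s / \<tau> - s' / \<tau>\<bar> \<le> 1" by linarith
      moreover have "\<bar>s / \<tau> - s' / \<tau>\<bar> = \<bar>s - s'\<bar> / \<tau>"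
        using \<tau>(1) by (simp add: diff_divide_distrib[symmetric])
      ultimately have st: "\<bar>s - s'\<bar> \<le> \<tau>i i" using \<tau>(1) \<tau>(2)[OF i(1)] by (simp add: pos_divide_le_eq)
      have sT: "s - s' \<in> T" using T_closed(2)[OF J(2) T_closed(3)[OF J'(1)]] by simp
      have qX: "q \<in> topspace X" using J(1) Q(2) by blast
      have move: "\<phi> (s - s') (\<phi> (- s) q) = \<phi> (- s') q"
        using act_add[OF sT T_closed(3)[OF J(2)] qX] by simp
      have kj: "h i \<bullet> (d i (z k) - d i (z j)) = real (k - j) * \<sigma>"
        "dist (d i (z k)) (d i (z j)) \<le> K i / \<kappa> i * (real (k - j) * \<sigma>)"
        using zz[OF less_imp_le[OF jk(1)] jk(2)] by blast+
      have "real (k - j) * \<sigma> \<le> 2 * (2 * norm (h i) + \<kappa> i / K i) * (2 * (K i * r))"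
        by (rule box_separation[OF box[OF i(1)] kj J(4,5) sT st J(6)]) (simp only: move J'(3))
      moreover have "\<sigma> \<le> real (k - j) * \<sigma>" using jk(1) \<sigma>(1) by simp
      moreover have "2 * (2 * norm (h i) + \<kappa> i / K i) * (2 * (K i * r)) < \<sigma>"
      proof -
        define M where "M = 2 * (2 * norm (h i) + \<kappa> i / K i)"
        have M: "M > 0" unfolding M_def using pos[OF i(1)] by (simp add: add_nonneg_pos)
        have "r \<le> \<beta> i / real m" unfolding r_def using a(2)[OF i(1)] by (simp add: divide_right_mono)
        then have "M * (2 * (K i * r)) \<le> M * (2 * (K i * (\<beta> i / real m)))"
          using M pos(2)[OF i(1)] by (intro mult_left_mono) auto
        also have "\<dots> = \<sigma> / 2"
          unfolding \<sigma>_def \<beta>_def M_def[symmetric] using M pos(2)[OF i(1)] m1 by (simp add: field_simps)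
        also have "\<dots> < \<sigma>" using \<sigma>(1) by simp
        finally show ?thesis by (simp add: M_def)
      qed
      ultimately show False by linarith
    qed
    then obtain j where j: "j \<le> m" "\<And>y. reach r (z j) y \<Longrightarrow> y \<in> good i" by blast
    have "y \<notin> N" if "reach r (z j) y" for y using j(2)[OF that] i(1) by (auto simp: N_def)
    then show ?thesis using reachR[OF j(1)] by blast
  qed
  show thesis
    by (rule that[OF n(1) r(1) R(1) contr N_open _ main]) (use \<Gamma>N \<Gamma>_def in blast)
qed


section \<open>Orbits avoiding finitely many points, and minimal sets\<close>

text \<open>Choose points \<open>x k\<close> whose leafwise \<open>r\<close>-balls avoid \<open>N\<close>, with \<open>x (Suc k)\<close> within \<open>R\<close> of the image of
  \<open>x k\<close> under the time-\<open>n\<close> map. One step backwards the ball around \<open>x (Suc k)\<close> shrinks into the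
  ball around \<open>x k\<close>, as \<open>(R + r) / (C * l ^ n) \<le> r\<close>. So the balls pulled back to time zero are nested,
  and a point in all their closures follows the closed balls, which miss the open set \<open>N\<close>.\<close>

lemma avoiding_orbit_discrete:
  assumes r: "r > 0" "(R + r) / (C * l ^ n) \<le> r" and N: "openin X N"
    and av: "\<And>x. x \<in> topspace X \<Longrightarrow> \<exists>x'. reach R x x' \<and> (\<forall>y. reach r x' y \<longrightarrow> y \<notin> N)"
    and ne: "topspace X \<noteq> {}"
  obtains y where "y \<in> topspace X" "\<And>k. \<phi> (real k * real n) y \<notin> N"
proof -
  define D where "D x = {y. reach r x y}" for x
  define P where "P = (\<lambda>(k::nat) x. x \<in> topspace X \<and> D x \<inter> N = {})"
  define t where "t = real n"
  have tT: "t \<in> T" "- t \<in> T" "t \<ge> 0" using T_closed by (simp_all add: t_def)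
  have "\<exists>x. \<forall>k. P k (x k) \<and> reach R (\<phi> t (x k)) (x (Suc k))"
  proof (rule dependent_nat_choice)
    obtain x where "x \<in> topspace X" using ne by blast
    then obtain x' where "reach R x x'" "\<forall>y. reach r x' y \<longrightarrow> y \<notin> N" using av by blast
    then show "\<exists>x. P 0 x" using reach_topspace[of R x x'] unfolding P_def D_def by blast
    fix x k assume "P k x"
    then have "\<phi> t x \<in> topspace X" using act_in[OF tT(1)] by (simp add: P_def)
    then obtain x' where x': "reach R (\<phi> t x) x'" "\<forall>y. reach r x' y \<longrightarrow> y \<notin> N" using av by blast
    then show "\<exists>x'. P (Suc k) x' \<and> reach R (\<phi> t x) x'"
      using reach_topspace[OF x'(1)] unfolding P_def D_def by blast
  qed
  then obtain x where x: "\<And>k. P k (x k)" "\<And>k. reach R (\<phi> t (x k)) (x (Suc k))" by blast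
  have xX: "x k \<in> topspace X" for k using x(1)[of k] by (simp add: P_def)
  have DX: "D (x k) \<subseteq> topspace X" for k using reach_topspace unfolding D_def by blast
  have step: "\<phi> (- t) y \<in> D (x k)" if y: "y \<in> D (x (Suc k))" for k y
  proof -
    have e: "C * l powr t = C * l ^ n" using l_gt by (simp add: t_def powr_realpow)
    have 1: "reach (R / (C * l ^ n)) (\<phi> (- t) (\<phi> t (x k))) (\<phi> (- t) (x (Suc k)))"
      using reach_contract[OF tT(1,3) x(2)] unfolding e .
    have 2: "reach (r / (C * l ^ n)) (\<phi> (- t) (x (Suc k))) (\<phi> (- t) y)"
      using reach_contract[OF tT(1,3), of r "x (Suc k)" y] y unfolding e D_def by simp
    have "reach (R / (C * l ^ n) + r / (C * l ^ n)) (x k) (\<phi> (- t) y)"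
      using reach_trans[OF 2 1] act_inv(1)[OF tT(1) xX] by simp
    then show ?thesis
      using r(2) reach_mono unfolding D_def by (simp add: add_divide_distrib)
  qed
  have kT: "real k * t \<in> T" "- (real k * t) \<in> T" for k
    using T_closed(4)[of "k * n"] T_closed(3) by (simp_all add: t_def)
  define S where "S k = \<phi> (- (real k * t)) ` D (x k)" for k
  have dec: "S (Suc k) \<subseteq> S k" for k
  proof
    fix w assume "w \<in> S (Suc k)"
    then obtain y where y: "y \<in> D (x (Suc k))" "w = \<phi> (- (real (Suc k) * t)) y" by (auto simp: S_def)
    have "- (real (Suc k) * t) = - (real k * t) + - t" by (simp add: algebra_simps)
    then have "w = \<phi> (- (real k * t)) (\<phi> (- t) y)"
      using act_add[OF kT(2) tT(2), of y] y DX by auto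
    then show "w \<in> S k" using step[OF y(1)] by (auto simp: S_def)
  qed
  have SX: "S k \<subseteq> topspace X" for k using act_in[OF kT(2)] DX unfolding S_def by blast
  have "x k \<in> D (x k)" for k using reach_refl[OF xX] r(1) by (simp add: D_def)
  then have Sne: "S k \<noteq> {}" for k by (auto simp: S_def)
  have "(\<Inter>k. X closure_of S k) \<noteq> {}"
  proof (rule compact_space_imp_nest[OF compact])
    show "X closure_of S k \<noteq> {}" for k
      using Sne[of k] closure_of_subset[OF SX[of k]] by blast
    show "decseq (\<lambda>k. X closure_of S k)"
      by (rule decseq_SucI) (rule closure_of_mono[OF dec])
  qed simp
  then obtain y where y: "\<And>k. y \<in> X closure_of S k" by blast
  show thesis
  proof (rule that[of y])
    show "y \<in> topspace X" using y[of 0] closure_of_subset_topspace[of X "S 0"] by blast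
    fix k
    have "\<phi> (real k * t) y \<in> X closure_of (\<phi> (real k * t) ` S k)"
      using continuous_map_image_closure_subset[OF act_cont[OF kT(1)], of k "S k"] y[of k] by blast
    moreover have "\<phi> (real k * t) ` S k = D (x k)"
      unfolding S_def image_image using act_inv(2)[OF kT(1), of _ k] DX[of k] by force
    moreover have "X closure_of D (x k) \<subseteq> topspace X - N"
    proof (rule closure_of_minimal)
      show "D (x k) \<subseteq> topspace X - N" using DX x(1)[of k] unfolding P_def by blast
      show "closedin X (topspace X - N)" using N by blast
    qed
    ultimately show "\<phi> (real k * real n) y \<notin> N" by (auto simp: t_def)
  qed
qed

lemma orbit_segments_closed:
  assumes Y: "closedin X Y"
  shows "closedin X {\<phi> s y | s y. s \<in> T \<and> 0 \<le> s \<and> s \<le> real n \<and> y \<in> Y}"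
proof -
  have cY: "compactin X Y" using closedin_compact_space[OF compact Y] .
  have "compactin X {\<phi> s y | s y. s \<in> T \<and> 0 \<le> s \<and> s \<le> real n \<and> y \<in> Y}"
    using T_cases
  proof (elim disjE conjE)
    assume fl: "T = UNIV" "smooth_flow X A \<phi>"
    have "compactin (prod_topology euclideanreal X) ({0..real n} \<times> Y)"
      using cY by (simp add: compactin_Times)
    from image_compactin[OF this flow_cont[OF fl(2)]]
    have "compactin X ((\<lambda>(t, x). \<phi> t x) ` ({0..real n} \<times> Y))" .
    moreover have "(\<lambda>(t, x). \<phi> t x) ` ({0..real n} \<times> Y) =
        {\<phi> s y | s y. s \<in> T \<and> 0 \<le> s \<and> s \<le> real n \<and> y \<in> Y}"
      using fl(1) by force
    ultimately show ?thesis by simp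
  next
    assume Z: "T = \<int>"
    have "compactin X (\<Union>((\<lambda>k. \<phi> (real k) ` Y) ` {..n}))"
      by (intro compactin_Union) (use image_compactin[OF cY act_cont[OF T_closed(4)]] in auto)
    moreover have "\<Union>((\<lambda>k. \<phi> (real k) ` Y) ` {..n}) =
        {\<phi> s y | s y. s \<in> T \<and> 0 \<le> s \<and> s \<le> real n \<and> y \<in> Y}"
    proof (intro equalityI subsetI)
      fix w assume "w \<in> \<Union>((\<lambda>k. \<phi> (real k) ` Y) ` {..n})"
      then obtain k y where "k \<le> n" "y \<in> Y" "w = \<phi> (real k) y" by blast
      then show "w \<in> {\<phi> s y | s y. s \<in> T \<and> 0 \<le> s \<and> s \<le> real n \<and> y \<in> Y}"
        using T_closed(4)[of k] by (intro CollectI exI[of _ "real k"] exI[of _ y]) simp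
    next
      fix w assume "w \<in> {\<phi> s y | s y. s \<in> T \<and> 0 \<le> s \<and> s \<le> real n \<and> y \<in> Y}"
      then obtain s y where w: "w = \<phi> s y" "s \<in> \<int>" "0 \<le> s" "s \<le> real n" "y \<in> Y" using Z by blast
      obtain i :: int where i: "s = of_int i" using w(2) Ints_cases by blast
      have "s = real (nat i)" "nat i \<le> n" using i w(3,4) by auto
      then show "w \<in> \<Union>((\<lambda>k. \<phi> (real k) ` Y) ` {..n})" using w(1,5) by blast
    qed
    ultimately show ?thesis by simp
  qed
  then show ?thesis using Hausdorff compactin_imp_closedin by blast
qed

text \<open>Between two consecutive multiples of the time \<open>n\<close> the orbit stays in the compact set \<open>Y\<close> swept
  out by the complement of \<open>N\<close>. This set misses \<open>Q\<close> because \<open>N\<close> contains the backward orbit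
  segments of \<open>Q\<close>.\<close>

lemma forward_orbit_avoiding:
  assumes Q: "finite Q" "Q \<subseteq> topspace X" and ne: "topspace X \<noteq> {}"
  obtains y Y where "y \<in> topspace X" "closedin X Y" "Y \<inter> Q = {}"
    "\<And>t. t \<in> T \<Longrightarrow> t \<ge> 0 \<Longrightarrow> \<phi> t y \<in> Y"
proof -
  obtain n R r N where n: "n \<ge> 1" "r > 0" "R \<ge> 0" "(R + r) / (C * l ^ n) \<le> r" "openin X N"
    and \<Gamma>: "\<And>q s. q \<in> Q \<Longrightarrow> s \<in> T \<Longrightarrow> 0 \<le> s \<Longrightarrow> s \<le> real n \<Longrightarrow> \<phi> (- s) q \<in> N"
    and av: "\<And>x. x \<in> topspace X \<Longrightarrow> \<exists>x'. reach R x x' \<and> (\<forall>y. reach r x' y \<longrightarrow> y \<notin> N)"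
    by (rule avoiding_neighbourhood[OF Q]) (rule that; assumption)
  obtain y where y: "y \<in> topspace X" "\<And>k. \<phi> (real k * real n) y \<notin> N"
    using avoiding_orbit_discrete[OF n(2,4,5) av ne] by blast
  define Y where "Y = {\<phi> s y | s y. s \<in> T \<and> 0 \<le> s \<and> s \<le> real n \<and> y \<in> topspace X - N}"
  have "closedin X Y" unfolding Y_def by (rule orbit_segments_closed) (use n(5) in blast)
  moreover have "q \<notin> Y" if q: "q \<in> Q" for q
  proof
    assume "q \<in> Y"
    then obtain s w where w: "q = \<phi> s w" "s \<in> T" "0 \<le> s" "s \<le> real n" "w \<in> topspace X" "w \<notin> N"
      unfolding Y_def by blast
    have "\<phi> (- s) q = w" using act_inv(1)[OF w(2,5)] w(1) by simp
    then show False using \<Gamma>[OF q w(2-4)] w(6) by simp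
  qed
  moreover have "\<phi> t y \<in> Y" if t: "t \<in> T" "t \<ge> 0" for t
  proof -
    define k where "k = nat \<lfloor>t / real n\<rfloor>"
    define s where "s = t - real k * real n"
    have kr: "real k \<le> t / real n" "t / real n < real k + 1"
      using t(2) n(1) by (simp_all add: k_def)
    have s: "0 \<le> s" "s \<le> real n" using kr n(1) by (simp_all add: s_def field_simps)
    have kT: "real k * real n \<in> T" using T_closed(4)[of "k * n"] by simp
    have sT: "s \<in> T" using T_closed(2)[OF t(1) T_closed(3)[OF kT]] by (simp add: s_def)
    have "\<phi> t y = \<phi> s (\<phi> (real k * real n) y)"
      using act_add[OF sT kT y(1)] by (simp add: s_def)
    then show ?thesis unfolding Y_def using sT s y(2)[of k] act_in[OF kT y(1)] by blast
  qed
  ultimately show thesis using that[OF y(1)] by blast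
qed

end

context smooth_action_mfd
begin

text \<open>The intersection of the \<open>E n\<close> is the omega-limit set of \<open>y\<close>.\<close>

lemma omega_limit_invariant:
  assumes comp: "compact_space X" and y: "y \<in> topspace X"
  defines "E \<equiv> \<lambda>n::nat. X closure_of {\<phi> t y | t. t \<in> T \<and> t \<ge> real n}"
  shows "(\<Inter>n. E n) \<noteq> {}" and "closed_invariant X T \<phi> (\<Inter>n. E n)"
proof -
  have sub: "{\<phi> t y | t. t \<in> T \<and> t \<ge> real n} \<subseteq> topspace X" for n using act_in y by blast
  have dec: "decseq E"
    unfolding E_def by (rule decseq_SucI, rule closure_of_mono) auto
  show "(\<Inter>n. E n) \<noteq> {}"
  proof (rule compact_space_imp_nest[OF comp _ _ dec])
    show "E n \<noteq> {}" for n
      using closure_of_subset[OF sub[of n]] T_closed(4)[of n] unfolding E_def by blast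
  qed (simp add: E_def)
  have EX: "E n \<subseteq> topspace X" for n unfolding E_def by (rule closure_of_subset_topspace)
  have inv: "\<phi> s ` (\<Inter>n. E n) \<subseteq> (\<Inter>n. E n)" if s: "s \<in> T" for s
  proof (intro subsetI INT_I)
    fix w n assume "w \<in> \<phi> s ` (\<Inter>n. E n)"
    then obtain v where v: "v \<in> (\<Inter>n. E n)" "w = \<phi> s v" by blast
    define k where "k = nat \<lceil>real n - s\<rceil>"
    have k: "real k \<ge> real n - s" unfolding k_def by linarith
    have "w \<in> X closure_of (\<phi> s ` {\<phi> t y | t. t \<in> T \<and> t \<ge> real k})"
      using continuous_map_image_closure_subset[OF act_cont[OF s]] v unfolding E_def by blast
    also have "\<dots> \<subseteq> E n"
      unfolding E_def
    proof (rule closure_of_mono, rule subsetI)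
      fix u assume "u \<in> \<phi> s ` {\<phi> t y | t. t \<in> T \<and> t \<ge> real k}"
      then obtain t where t: "t \<in> T" "t \<ge> real k" "u = \<phi> s (\<phi> t y)" by blast
      then have "u = \<phi> (s + t) y" using act_add[OF s t(1) y] by simp
      moreover have "s + t \<in> T" using T_closed(2)[OF s t(1)] .
      moreover have "s + t \<ge> real n" using t(2) k by linarith
      ultimately show "u \<in> {\<phi> t y | t. t \<in> T \<and> t \<ge> real n}" by blast
    qed
    finally show "w \<in> E n" .
  qed
  have "\<phi> s ` (\<Inter>n. E n) = (\<Inter>n. E n)" if s: "s \<in> T" for s
  proof
    show "\<phi> s ` (\<Inter>n. E n) \<subseteq> (\<Inter>n. E n)" by (rule inv[OF s])
    show "(\<Inter>n. E n) \<subseteq> \<phi> s ` (\<Inter>n. E n)"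
    proof
      fix w assume w: "w \<in> (\<Inter>n. E n)"
      then have "\<phi> (- s) w \<in> (\<Inter>n. E n)" using inv[OF T_closed(3)[OF s]] by blast
      moreover have "w \<in> topspace X" using w EX[of 0] by blast
      then have "w = \<phi> s (\<phi> (- s) w)" using act_inv(2)[OF s] by simp
      ultimately show "w \<in> \<phi> s ` (\<Inter>n. E n)" by blast
    qed
  qed
  moreover have "closedin X (\<Inter>n. E n)"
    by (rule closedin_Inter) (auto simp: E_def)
  ultimately show "closed_invariant X T \<phi> (\<Inter>n. E n)" by (simp add: closed_invariant_def)
qed

text \<open>Zorn's lemma, applied to the complements of the closed invariant subsets of \<open>S\<close>: by compactness
  a chain of proper open sets does not cover the space.\<close>

lemma minimal_set_exists:
  assumes comp: "compact_space X" and S: "S \<noteq> {}" "closed_invariant X T \<phi> S"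
  obtains M where "minimal_set X T \<phi> M" "M \<subseteq> S"
proof -
  define \<A> where "\<A> = {topspace X - S' | S'. S' \<noteq> {} \<and> S' \<subseteq> S \<and> closed_invariant X T \<phi> S'}"
  have SX: "S' \<subseteq> topspace X" if "closed_invariant X T \<phi> S'" for S'
    using that closedin_subset unfolding closed_invariant_def by blast
  have A_D: "\<exists>S'. S' \<noteq> {} \<and> S' \<subseteq> S \<and> closed_invariant X T \<phi> S' \<and> B = topspace X - S'"
    if "B \<in> \<A>" for B
    using that by (auto simp: \<A>_def)
  have "\<exists>M\<in>\<A>. \<forall>B\<in>\<A>. M \<subseteq> B \<longrightarrow> B = M"
  proof (rule subset_Zorn_nonempty)
    show "\<A> \<noteq> {}" unfolding \<A>_def using S by blast
    fix \<C> assume ne: "\<C> \<noteq> {}" and ch: "subset.chain \<A> \<C>"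
    have CA: "\<C> \<subseteq> \<A>" using ch unfolding subset.chain_def by blast
    define S1 where "S1 = topspace X - \<Union>\<C>"
    have opC: "openin X B" if B: "B \<in> \<C>" for B
    proof -
      obtain S' where S': "closed_invariant X T \<phi> S'" "B = topspace X - S'"
        using A_D[of B] CA B by blast
      then have "closedin X S'" by (simp add: closed_invariant_def)
      then show ?thesis using S'(2) openin_diff[OF openin_topspace] by simp
    qed
    have "S1 \<noteq> {}"
    proof
      assume "S1 = {}"
      then have "topspace X \<subseteq> \<Union>\<C>" by (auto simp: S1_def)
      then obtain \<F> where F: "finite \<F>" "\<F> \<subseteq> \<C>" "topspace X \<subseteq> \<Union>\<F>"
        using compactinD[of X "topspace X" \<C>] comp opC unfolding compact_space_def by blast
      have "\<F> \<noteq> {}" using F(3) S SX[OF S(2)] by auto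
      moreover have "subset.chain \<A> \<F>" using ch F(2) unfolding subset.chain_def by blast
      ultimately have "\<Union>\<F> \<in> \<F>" using Union_in_chain[OF F(1)] by blast
      then have "\<Union>\<F> \<in> \<A>" using F(2) CA by blast
      then obtain S' where S': "S' \<noteq> {}" "closed_invariant X T \<phi> S'" "\<Union>\<F> = topspace X - S'"
        using A_D[of "\<Union>\<F>"] by blast
      then show False using F(3) SX[OF S'(2)] by blast
    qed
    moreover have "S1 \<subseteq> S"
    proof -
      obtain B where B: "B \<in> \<C>" using ne by blast
      obtain S' where S': "S' \<subseteq> S" "B = topspace X - S'" using A_D[of B] CA B by blast
      have "S1 \<subseteq> topspace X - B" using B unfolding S1_def by blast
      then show ?thesis using S' by blast
    qed
    moreover have "closed_invariant X T \<phi> S1"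
    proof -
      have "closedin X S1" unfolding S1_def using opC by (intro closedin_diff closedin_topspace openin_Union) auto
      moreover have inv: "\<phi> t w \<in> S1" if t: "t \<in> T" and w: "w \<in> S1" for t w
      proof -
        have wX: "w \<in> topspace X" using w by (simp add: S1_def)
        have "\<phi> t w \<notin> B" if B: "B \<in> \<C>" for B
        proof -
          obtain S' where S': "closed_invariant X T \<phi> S'" "B = topspace X - S'"
            using A_D[of B] CA B by blast
          then have "w \<in> S'" using w B wX unfolding S1_def by blast
          then have "\<phi> t w \<in> S'" using S'(1) t unfolding closed_invariant_def by blast
          then show ?thesis using S'(2) by blast
        qed
        then show ?thesis using act_in[OF t wX] unfolding S1_def by blast
      qed
      moreover have "\<phi> t ` S1 = S1" if t: "t \<in> T" for t
      proof
        show "\<phi> t ` S1 \<subseteq> S1" using inv[OF t] by blast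
        show "S1 \<subseteq> \<phi> t ` S1"
        proof
          fix w assume w: "w \<in> S1"
          then have "w = \<phi> t (\<phi> (- t) w)" using act_inv(2)[OF t] by (simp add: S1_def)
          then show "w \<in> \<phi> t ` S1" using inv[OF T_closed(3)[OF t] w] by blast
        qed
      qed
      ultimately show ?thesis by (simp add: closed_invariant_def)
    qed
    moreover have "\<Union>\<C> = topspace X - S1"
      unfolding S1_def using opC openin_subset by blast
    ultimately show "\<Union>\<C> \<in> \<A>" unfolding \<A>_def by blast
  qed
  then obtain M' where M': "M' \<in> \<A>" "\<And>B. B \<in> \<A> \<Longrightarrow> M' \<subseteq> B \<Longrightarrow> B = M'" by blast
  obtain M where M: "M \<noteq> {}" "M \<subseteq> S" "closed_invariant X T \<phi> M" "M' = topspace X - M"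
    using A_D[OF M'(1)] by blast
  have "\<not> (S' \<noteq> {} \<and> S' \<subset> M \<and> closed_invariant X T \<phi> S')" for S'
  proof
    assume S': "S' \<noteq> {} \<and> S' \<subset> M \<and> closed_invariant X T \<phi> S'"
    then have "topspace X - S' \<in> \<A>" using M(2) unfolding \<A>_def by blast
    moreover have "M' \<subseteq> topspace X - S'" using S' M(4) by blast
    ultimately have "topspace X - S' = topspace X - M" using M'(2) M(4) by blast
    then show False using S' SX[OF M(3)] by blast
  qed
  then have "minimal_set X T \<phi> M" using M unfolding minimal_set_def by blast
  then show thesis using that M(2) by blast
qed

end

context expanding_action
begin

lemma minimal_set_avoiding:
  assumes Q: "finite Q" "Q \<subseteq> topspace X" and ne: "topspace X \<noteq> {}"
  obtains M where "minimal_set X T \<phi> M" "M \<inter> Q = {}"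
proof -
  obtain y Y where y: "y \<in> topspace X" "closedin X Y" "Y \<inter> Q = {}"
    "\<And>t. t \<in> T \<Longrightarrow> t \<ge> 0 \<Longrightarrow> \<phi> t y \<in> Y"
    using forward_orbit_avoiding[OF assms] by blast
  define E where "E n = X closure_of {\<phi> t y | t. t \<in> T \<and> t \<ge> real n}" for n :: nat
  have E: "(\<Inter>n. E n) \<noteq> {}" "closed_invariant X T \<phi> (\<Inter>n. E n)"
    unfolding E_def by (rule omega_limit_invariant[OF compact y(1)])+
  have "E 0 \<subseteq> Y" unfolding E_def by (rule closure_of_minimal[OF _ y(2)]) (use y(4) in auto)
  then have "(\<Inter>n. E n) \<subseteq> Y" by blast
  moreover obtain M where M: "minimal_set X T \<phi> M" "M \<subseteq> (\<Inter>n. E n)"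
    by (rule minimal_set_exists[OF compact E])
  ultimately have "M \<subseteq> Y" by (meson order_trans)
  then have "M \<inter> Q = {}" using y(3) by blast
  then show thesis by (rule that[OF M(1)])
qed

text \<open>If there were finitely many minimal sets, pick a point in each. A minimal set that avoids all these
  points would be a new one.\<close>

lemma infinite_minimal_sets:
  assumes ne: "topspace X \<noteq> {}"
  shows "infinite {S. minimal_set X T \<phi> S}"
proof
  assume fin: "finite {S. minimal_set X T \<phi> S}"
  define pick where "pick S = (SOME x. x \<in> S)" for S :: "'a set"
  have pick: "pick S \<in> S" if "minimal_set X T \<phi> S" for S
  proof -
    have "\<exists>x. x \<in> S" using that unfolding minimal_set_def by blast
    then show ?thesis unfolding pick_def by (rule someI_ex)
  qed
  define Q where "Q = pick ` {S. minimal_set X T \<phi> S}"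
  have "Q \<subseteq> topspace X"
  proof
    fix q assume "q \<in> Q"
    then obtain S where S: "minimal_set X T \<phi> S" "q = pick S" by (auto simp: Q_def)
    then have "closedin X S" unfolding minimal_set_def closed_invariant_def by blast
    then show "q \<in> topspace X" using pick[OF S(1)] S(2) closedin_subset by blast
  qed
  then obtain M where M: "minimal_set X T \<phi> M" "M \<inter> Q = {}"
    using minimal_set_avoiding[of Q] fin ne by (auto simp: Q_def)
  then show False using pick[OF M(1)] by (auto simp: Q_def)
qed

end

theorem theorem2p1:
  fixes X :: "'a topology"
    and A :: "('a, 'e::euclidean_space) chart set"
    and p :: nat
    and F :: "'a set set"
    and T :: "real set"
    and \<phi> :: "real \<Rightarrow> 'a \<Rightarrow> 'a"
  assumes "smooth_manifold X A"
    and "topspace X \<noteq> {}"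
    and "compact_space X"
    and "connected_space X"
    and "smooth_action X A T \<phi>"
    and "foliation TYPE('e) X p F"
    and "p > 0"
    and "smooth_leaves X A p F"
    and "continuous_tangent_bundle X A p F"
    and "leaves_foliation_invariant T \<phi> F"
    and "uniformly_expands X A p F T \<phi>"
  shows "infinite {S. minimal_set X T \<phi> S}"
proof -
  obtain g C l where g: "riemannian_metric A g" and C: "C > 0" "l > 1"
    and ex: "\<forall>x\<in>topspace X. \<forall>v\<in>leaf_tangent_space X A p F x. \<forall>t\<in>T. t \<ge> 0 \<longrightarrow>
      riem_norm g (\<phi> t x) (tangent_map A (\<phi> t) x v) \<ge> C * (l powr t) * riem_norm g x v"
    using assms(11) unfolding uniformly_expands_def by blast
  interpret expanding_action X A g p F T \<phi> C l
    by unfold_locales (use assms g C ex in blast)+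
  show ?thesis by (rule infinite_minimal_sets[OF assms(2)])
qed

end
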